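(* Let $p,q\in(0,1)$ be constants, and let $k=k_n$ and $p'=p'_n$ satisfy $k=o(n^{1/4}\log^{-17/4}n)$ and $p'\le 1/(n\log n)$. Then there are efficient (polynomial-time, randomized) algorithms $\mathcal A_{\triangle}$ and $\mathcal A$ mapping graphs on $[n]$ to graphs on $[n]$, and parameter maps $f=f_n$ and $g=g_n$, such that: 1. $\mathcal A_\triangle$ maps both hypotheses of the planted dense subgraph problem to those of the planted RGT problem: $$d_{TV}\big(\mathcal A_\triangle(G(n,p)),\,\mathrm{RGT}(n,p,p')\big)=o_n(1),\qquad d_{TV}\big(\mathcal A_\triangle(G(n,p,k,q)),\,\mathrm{RGT}(n,p,p',k,f(q))\big)=o_n(1).$$ 2. $\mathcal A$ maps both hypotheses of the planted RGT problem to those of the planted dense subgraph problem: $$d_{TV}\big(\mathcal A(\mathrm{RGT}(n,p,p')),\,G(n,p)\big)=o_n(1),\qquad d_{TV}\big(\mathcal A(\mathrm{RGT}(n,p,p',k,q)),\,G(n,p,k,g(q))\big)=o_n(1).$$ Moreover, $f\circ g(q)=q+o_n(1)$ and $g\circ f(q)=q+o_n(1)$.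
   Context: $G(n,p)$ is the Erdős–Rényi random graph on $[n]$. $\mathrm{RGT}(n,p,p')$ (random graph with triangles) is the law of the graph obtained by sampling $G\sim G(n,p)$ and then, independently for every triple $\{i,j,k\}\in\binom{[n]}{3}$, with probability $p'$ adding the three edges $(i,j),(j,k),(i,k)$ to $G$. $G(n,p,k,q)$ (resp. $\mathrm{RGT}(n,p,p',k,q)$) is the law of the graph obtained by sampling from $G(n,p)$ (resp. $\mathrm{RGT}(n,p,p')$), choosing a uniformly random subset $S\subset[n]$ of size $k$, erasing all edges inside $S$, and then including each edge inside $S$ independently with probability $q$. The planted dense subgraph problem is to test $H_0:G(n,p)$ against $H_1:G(n,p,k,q)$; the planted RGT problem is to test $H_0:\mathrm{RGT}(n,p,p')$ against $H_1:\mathrm{RGT}(n,p,p',k,q)$. For a randomized algorithm $\mathcal A$ and a distribution $\mu$, $\mathcal A(\mu)$ is the law of $\mathcal A(X)$ for $X\sim\mu$. $d_{TV}$ is total variation distance. Asymptotics are as $n\to\infty$; the algorithms know the parameters of the models. *)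

theory Defs
  imports "HOL-Probability.Probability" "HOL-Library.Ramsey" "HOL-Library.Landau_Symbols"
    "HOL-Computational_Algebra.Polynomial"
begin

text \<open>
  A graph on the vertex set \<open>[n]\<close>, represented as \<open>{..<n}\<close>, is its edge set, a subset of
  \<open>nsets {..<n} 2\<close>, where \<open>nsets A r\<close> is the set of \<open>r\<close>-element subsets of \<open>A\<close>.
\<close>

type_synonym graph = "nat set set"

text \<open>Each element of the finite set \<open>E\<close> is kept independently with probability \<open>p\<close>.\<close>

definition random_subset :: "'a set \<Rightarrow> real \<Rightarrow> 'a set pmf" where
  "random_subset E p =
     map_pmf (\<lambda>h. {e \<in> E. h e}) (Pi_pmf E False (\<lambda>_. bernoulli_pmf p))"

definition ER :: "nat \<Rightarrow> real \<Rightarrow> graph pmf" where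
  "ER n p = random_subset (nsets {..<n} 2) p"

definition RGT :: "nat \<Rightarrow> real \<Rightarrow> real \<Rightarrow> graph pmf" where
  "RGT n p p' = do {
     G \<leftarrow> ER n p;
     T \<leftarrow> random_subset (nsets {..<n} 3) p';
     return_pmf (G \<union> (\<Union>t\<in>T. nsets t 2)) }"

definition plant :: "nat \<Rightarrow> nat \<Rightarrow> real \<Rightarrow> graph pmf \<Rightarrow> graph pmf" where
  "plant n k q \<mu> = do {
     G \<leftarrow> \<mu>;
     S \<leftarrow> pmf_of_set (nsets {..<n} k);
     H \<leftarrow> random_subset (nsets S 2) q;
     return_pmf ((G - nsets S 2) \<union> H) }"

definition planted_ER :: "nat \<Rightarrow> real \<Rightarrow> nat \<Rightarrow> real \<Rightarrow> graph pmf" where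
  "planted_ER n p k q = plant n k q (ER n p)"

definition planted_RGT :: "nat \<Rightarrow> real \<Rightarrow> real \<Rightarrow> nat \<Rightarrow> real \<Rightarrow> graph pmf" where
  "planted_RGT n p p' k q = plant n k q (RGT n p p')"

definition d_TV :: "'a pmf \<Rightarrow> 'a pmf \<Rightarrow> real" where
  "d_TV \<mu> \<nu> = (SUP A. \<bar>measure_pmf.prob \<mu> A - measure_pmf.prob \<nu> A\<bar>)"

text \<open>
  The model of computation is a structured random access machine with fair coin flips. Memory
  cells hold natural numbers, and one step executes one assignment, coin flip or branching.
  Addition and truncated subtraction are the only arithmetic: in \<open>t\<close> steps the bit lengths of the
  values grow by \<open>O(t)\<close> only, so that, unlike for machines with unit-cost multiplication,
  polynomial time agrees with polynomial time on probabilistic Turing machines.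
\<close>

type_synonym memory = "nat \<Rightarrow> nat"

datatype expr =
    Lit nat
  | Read expr
  | Add expr expr
  | Sub expr expr

fun eval_expr :: "expr \<Rightarrow> memory \<Rightarrow> nat" where
  "eval_expr (Lit c) m = c"
| "eval_expr (Read a) m = m (eval_expr a m)"
| "eval_expr (Add a b) m = eval_expr a m + eval_expr b m"
| "eval_expr (Sub a b) m = eval_expr a m - eval_expr b m"

text \<open>
  The first argument of \<open>Assign\<close> and of \<open>Flip\<close> is the address written to. The tests of
  \<open>Cond\<close> and \<open>While\<close> ask whether an expression is nonzero.
\<close>

datatype prog =
    Skip
  | Assign expr expr
  | Flip expr
  | Seq prog prog
  | Cond expr prog prog
  | While expr prog

fun step :: "prog \<times> memory \<Rightarrow> (prog \<times> memory) pmf" where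
  "step (Skip, m) = return_pmf (Skip, m)"
| "step (Assign a b, m) = return_pmf (Skip, m(eval_expr a m := eval_expr b m))"
| "step (Flip a, m) =
     map_pmf (\<lambda>b. (Skip, m(eval_expr a m := of_bool b))) (bernoulli_pmf (1/2))"
| "step (Seq c d, m) =
     (if c = Skip then return_pmf (d, m)
      else map_pmf (\<lambda>(c', m'). (Seq c' d, m')) (step (c, m)))"
| "step (Cond b c d, m) = return_pmf (if eval_expr b m \<noteq> 0 then c else d, m)"
| "step (While b c, m) =
     return_pmf (if eval_expr b m \<noteq> 0 then Seq c (While b c) else Skip, m)"

primrec run :: "nat \<Rightarrow> prog \<times> memory \<Rightarrow> (prog \<times> memory) pmf" where
  "run 0 x = return_pmf x"
| "run (Suc t) x = bind_pmf (step x) (run t)"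

text \<open>Binary digits of \<open>x \<in> [0,1]\<close>: the integer part followed by \<open>r\<close> fractional digits.\<close>

definition binary_digits :: "nat \<Rightarrow> real \<Rightarrow> nat list" where
  "binary_digits r x = map (\<lambda>i. nat (\<lfloor>x * 2 ^ i\<rfloor> mod 2)) [0..<Suc r]"

definition adjacency_list :: "nat \<Rightarrow> graph \<Rightarrow> nat list" where
  "adjacency_list n G =
     concat (map (\<lambda>i. map (\<lambda>j. of_bool ({i, j} \<in> G)) [0..<n]) [0..<n])"

text \<open>
  Besides the graph, the machine is given \<open>n\<close>, \<open>k\<close> and the real parameters \<open>\<theta>\<close>, the latter
  with \<open>r\<close> binary digits after the point. All remaining cells are \<open>0\<close>.
\<close>

definition input_memory :: "nat \<Rightarrow> nat \<Rightarrow> real list \<Rightarrow> nat \<Rightarrow> graph \<Rightarrow> memory" where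
  "input_memory n k \<theta> r G =
     (let xs = [n, k, r] @ adjacency_list n G @ concat (map (binary_digits r) \<theta>)
      in (\<lambda>i. if i < length xs then xs ! i else 0))"

text \<open>The output replaces the input matrix; only entries above the diagonal are read.\<close>

definition output_graph :: "nat \<Rightarrow> memory \<Rightarrow> graph" where
  "output_graph n m = {{i, j} | i j. i < j \<and> j < n \<and> m (3 + i * n + j) \<noteq> 0}"

text \<open>
  A randomized algorithm on graphs is a family of Markov kernels \<open>A n\<close>. It is efficient, given the
  parameters \<open>k n\<close> and \<open>\<theta> n\<close>, if a single program that sees the real parameters to polynomially
  many digits realises it, halting for all coin flips within a number of steps polynomial in \<open>n\<close>.
\<close>

definition efficient ::
    "(nat \<Rightarrow> nat) \<Rightarrow> (nat \<Rightarrow> real list) \<Rightarrow> (nat \<Rightarrow> graph \<Rightarrow> graph pmf) \<Rightarrow> bool" where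
  "efficient k \<theta> A \<longleftrightarrow>
     (\<exists>(c :: prog) (r :: nat poly) (t :: nat poly). \<forall>n. \<forall>G \<subseteq> nsets {..<n} 2.
        (let \<rho> = run (poly t n) (c, input_memory n (k n) (\<theta> n) (poly r n) G)
         in (\<forall>x \<in> set_pmf \<rho>. fst x = Skip) \<and>
            A n G = map_pmf (\<lambda>x. output_graph n (snd x)) \<rho>))"

end

theory Submission
  imports Defs "HOL-Real_Asymp.Real_Asymp"
begin

text \<open>
  Given the graph inside the planted set \<open>S\<close>, the added triangles act on an edge inside \<open>S\<close> and,
  through the two other edges of each triangle on it, on the edges leaving \<open>S\<close>. The latter effect
  is hidden in the noise: by a second moment computation it changes the law of the outer edges by
  \<open>O(p' sqrt n)\<close> in total variation for each of the \<open>O(k^2)\<close> edges inside \<open>S\<close>. Hence adding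
  triangles turns the density \<open>q\<close> into \<open>1 - (1 - q) (1 - p')^(n - k)\<close>, with independent edges.

  The reverse map is the Bayes inverse of adding triangles to the unplanted graph. Up to triangles
  inside \<open>S\<close>, the observed graph shows which edges inside \<open>S\<close> are present, so the same kernel
  inverts the conditional laws given these edges, and acts correctly when they are planted with
  another density. It samples the added triangles from their posterior, a Gibbs measure with weak
  interaction since \<open>n p' = o(1)\<close>, by Glauber dynamics, and then resamples the edges they cover.

  The machine only sees \<open>n\<close> binary digits of the parameters, so both maps run with truncated
  parameters, at an exponentially small cost in total variation.
\<close>

subsection \<open>Total variation distance\<close>

text \<open>The size of \<open>k\<close> enters through the wedges. Fewer than \<open>k ^ 2\<close>
  inner edges, each at a cost of order \<open>p' * sqrt n\<close>, hence at most of order 1 / (sqrt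
  n ln n), leave a total error of order 1 / ln n once \<open>k ^ 4\<close> is at most
  \<open>n\<close>. Bounding the distance by the expected number of wedges, about
  \<open>n * p'\<close> for each inner edge, would give only \<open>k ^ 2\<close> / ln n. The
  inverse may not depend on the hidden set \<open>S\<close>. A triangle inside \<open>S\<close>
  would tie the final states of three inner edges together; removing such triangles costs a term of
  order \<open>k ^ 3 * p'\<close>. The inverse keeps a present inner edge with a probability fitted
  to the ambient density \<open>p\<close>, not to \<open>q\<close>. So \<open>f\<close> and
  \<open>g\<close> are not mutually inverse for fixed \<open>n\<close>; both tend to the identity
  because \<open>n * p'\<close> tends to 0. The machine cannot divide, so exact heat-bath
  probabilities are out of reach. They are approximated by repeated reversible moves built from
  coins of the given biases. The posterior is exactly stationary for each such move, so that only
  the speed of mixing has to be estimated.\<close>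

lemma d_TV_bdd: "bdd_above (range (\<lambda>A. \<bar>measure_pmf.prob \<mu> A - measure_pmf.prob \<nu> A\<bar>))"
proof (rule bdd_aboveI2)
  fix A show "\<bar>measure_pmf.prob \<mu> A - measure_pmf.prob \<nu> A\<bar> \<le> 1"
    using measure_pmf.prob_le_1[of \<mu> A] measure_pmf.prob_le_1[of \<nu> A]
      measure_nonneg[of \<mu> A] measure_nonneg[of \<nu> A] by linarith
qed

lemma abs_prob_diff_le_d_TV:
  "\<bar>measure_pmf.prob \<mu> A - measure_pmf.prob \<nu> A\<bar> \<le> d_TV \<mu> \<nu>"
  unfolding d_TV_def by (rule cSUP_upper[OF _ d_TV_bdd]) simp

lemma d_TV_nonneg: "0 \<le> d_TV \<mu> \<nu>"
  using abs_prob_diff_le_d_TV[of \<mu> "{}" \<nu>] by simp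

text \<open>Passing to the complement of \<open>A\<close> flips the sign of the difference, so the
  one-sided bound already controls the absolute value.\<close>

lemma d_TV_leI:
  assumes "\<And>A. measure_pmf.prob \<mu> A - measure_pmf.prob \<nu> A \<le> \<epsilon>"
  shows "d_TV \<mu> \<nu> \<le> \<epsilon>"
  unfolding d_TV_def
proof (rule cSUP_least)
  fix A
  have "measure_pmf.prob \<mu> (-A) - measure_pmf.prob \<nu> (-A) \<le> \<epsilon>" by (rule assms)
  then have "measure_pmf.prob \<nu> A - measure_pmf.prob \<mu> A \<le> \<epsilon>"
    using measure_pmf.prob_compl[of A \<mu>] measure_pmf.prob_compl[of A \<nu>]
    by (simp add: Compl_eq_Diff_UNIV)
  then show "\<bar>measure_pmf.prob \<mu> A - measure_pmf.prob \<nu> A\<bar> \<le> \<epsilon>" using assms[of A] by linarith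
qed simp

lemma d_TV_self [simp]: "d_TV \<mu> \<mu> = 0"
  by (rule antisym[OF d_TV_leI d_TV_nonneg]) simp

lemma d_TV_commute: "d_TV \<mu> \<nu> = d_TV \<nu> \<mu>"
  by (simp add: d_TV_def abs_minus_commute)

lemma d_TV_triangle: "d_TV \<mu> \<nu> \<le> d_TV \<mu> \<rho> + d_TV \<rho> \<nu>"
proof (rule d_TV_leI)
  fix A show "measure_pmf.prob \<mu> A - measure_pmf.prob \<nu> A \<le> d_TV \<mu> \<rho> + d_TV \<rho> \<nu>"
    using abs_prob_diff_le_d_TV[of \<mu> A \<rho>] abs_prob_diff_le_d_TV[of \<rho> A \<nu>] by linarith
qed

lemma integrable_pmf_bounded:
  fixes f :: "'a \<Rightarrow> real"
  assumes "\<And>x. \<bar>f x\<bar> \<le> B"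
  shows "integrable (measure_pmf \<mu>) f"
  by (rule measure_pmf.integrable_const_bound[where B = B]) (use assms in auto)

text \<open>Pointwise, (\<open>pmf \<mu> x\<close> - \<open>pmf \<nu> x\<close>) \<open>f x\<close>
  is largest when \<open>f\<close> is the indicator of the set where \<mu> dominates \<nu>. This is
  what makes every Markov kernel a contraction for \<open>d_TV\<close>.\<close>

lemma expectation_diff_le_d_TV:
  fixes f :: "'a \<Rightarrow> real"
  assumes f: "\<And>x. 0 \<le> f x" "\<And>x. f x \<le> 1"
  shows "measure_pmf.expectation \<mu> f - measure_pmf.expectation \<nu> f \<le> d_TV \<mu> \<nu>"
proof -
  define A where "A = {x. pmf \<nu> x \<le> pmf \<mu> x}"
  have int: "integrable (count_space UNIV) (\<lambda>x. pmf \<rho> x * h x)"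
    if "\<And>x. \<bar>h x\<bar> \<le> 1" for \<rho> :: "'a pmf" and h :: "'a \<Rightarrow> real"
  proof (rule Bochner_Integration.integrable_bound[OF integrable_pmf[of UNIV \<rho>]])
    show "AE x in count_space UNIV. norm (pmf \<rho> x * h x) \<le> norm (pmf \<rho> x)"
      by (auto simp: abs_mult intro!: mult_left_le that)
  qed simp
  have E: "measure_pmf.expectation \<rho> h = (\<integral>x. pmf \<rho> x * h x \<partial>count_space UNIV)"
    for \<rho> :: "'a pmf" and h :: "'a \<Rightarrow> real"
    unfolding measure_pmf_eq_density by (subst integral_density) simp_all
  have P: "measure_pmf.prob \<rho> A = measure_pmf.expectation \<rho> (indicator A)" for \<rho> :: "'a pmf"
    by simp
  have ind: "\<bar>indicator A x :: real\<bar> \<le> 1" "\<bar>f x\<bar> \<le> 1" for x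
    using f[of x] by (auto simp: indicator_def)
  have "measure_pmf.expectation \<mu> f - measure_pmf.expectation \<nu> f
      = (\<integral>x. pmf \<mu> x * f x - pmf \<nu> x * f x \<partial>count_space UNIV)"
    unfolding E by (subst Bochner_Integration.integral_diff) (auto intro!: int ind)
  also have "\<dots> \<le> (\<integral>x. pmf \<mu> x * indicator A x - pmf \<nu> x * indicator A x \<partial>count_space UNIV)"
  proof (rule integral_mono)
    fix x
    have "(pmf \<mu> x - pmf \<nu> x) * f x \<le> (pmf \<mu> x - pmf \<nu> x) * indicator A x"
    proof (cases "x \<in> A")
      case True
      then show ?thesis using f[of x] by (auto simp: A_def intro!: mult_left_le)
    next
      case False
      then show ?thesis using f[of x] by (auto simp: A_def mult_nonpos_nonneg)
    qed
    then show "pmf \<mu> x * f x - pmf \<nu> x * f x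
        \<le> pmf \<mu> x * indicator A x - pmf \<nu> x * indicator A x" by (simp add: algebra_simps)
  qed (auto intro!: int ind Bochner_Integration.integrable_diff)
  also have "\<dots> = measure_pmf.prob \<mu> A - measure_pmf.prob \<nu> A"
    unfolding P E by (subst Bochner_Integration.integral_diff) (auto intro!: int ind)
  also have "\<dots> \<le> d_TV \<mu> \<nu>" using abs_prob_diff_le_d_TV[of \<mu> A \<nu>] by linarith
  finally show ?thesis .
qed

lemma prob_bind_pmf:
  "measure_pmf.prob (bind_pmf \<mu> f) A = measure_pmf.expectation \<mu> (\<lambda>x. measure_pmf.prob (f x) A)"
proof -
  have "ennreal (measure_pmf.prob (bind_pmf \<mu> f) A) = emeasure (bind_pmf \<mu> f) A"
    by (simp add: measure_pmf.emeasure_eq_measure)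
  also have "\<dots> = (\<integral>\<^sup>+x. emeasure (f x) A \<partial>measure_pmf \<mu>)"
    by (rule emeasure_bind_pmf)
  also have "\<dots> = (\<integral>\<^sup>+x. ennreal (measure_pmf.prob (f x) A) \<partial>measure_pmf \<mu>)"
    by (simp add: measure_pmf.emeasure_eq_measure)
  also have "\<dots> = ennreal (measure_pmf.expectation \<mu> (\<lambda>x. measure_pmf.prob (f x) A))"
    by (intro nn_integral_eq_integral integrable_pmf_bounded[where B = 1]) auto
  finally show ?thesis by (simp add: integral_nonneg_AE)
qed

lemma d_TV_bind_left: "d_TV (bind_pmf \<mu> f) (bind_pmf \<nu> f) \<le> d_TV \<mu> \<nu>"
  by (rule d_TV_leI) (auto simp: prob_bind_pmf intro!: expectation_diff_le_d_TV)

lemma d_TV_map_left: "d_TV (map_pmf f \<mu>) (map_pmf f \<nu>) \<le> d_TV \<mu> \<nu>"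
  unfolding map_pmf_def by (rule d_TV_bind_left)

lemma d_TV_bind_le_expectation:
  fixes e :: "'a \<Rightarrow> real"
  assumes "\<And>x. x \<in> set_pmf \<mu> \<Longrightarrow> d_TV (f x) (g x) \<le> e x" and "integrable \<mu> e"
  shows "d_TV (bind_pmf \<mu> f) (bind_pmf \<mu> g) \<le> measure_pmf.expectation \<mu> e"
proof (rule d_TV_leI)
  fix A
  have int: "integrable \<mu> (\<lambda>x. measure_pmf.prob (h x) A)" for h :: "'a \<Rightarrow> 'b pmf"
    by (rule integrable_pmf_bounded[where B = 1]) simp
  have "measure_pmf.prob (bind_pmf \<mu> f) A - measure_pmf.prob (bind_pmf \<mu> g) A
    = measure_pmf.expectation \<mu> (\<lambda>x. measure_pmf.prob (f x) A - measure_pmf.prob (g x) A)"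
    unfolding prob_bind_pmf by (subst Bochner_Integration.integral_diff) (auto intro: int)
  also have "\<dots> \<le> measure_pmf.expectation \<mu> e"
  proof (rule integral_mono_AE)
    show "AE x in \<mu>. measure_pmf.prob (f x) A - measure_pmf.prob (g x) A \<le> e x"
      unfolding AE_measure_pmf_iff using assms(1) abs_prob_diff_le_d_TV by (meson abs_le_D1 order_trans)
  qed (auto intro: int assms)
  finally show "measure_pmf.prob (bind_pmf \<mu> f) A - measure_pmf.prob (bind_pmf \<mu> g) A
    \<le> measure_pmf.expectation \<mu> e" .
qed

lemma d_TV_bind_right:
  assumes "\<And>x. x \<in> set_pmf \<mu> \<Longrightarrow> d_TV (f x) (g x) \<le> e"
  shows "d_TV (bind_pmf \<mu> f) (bind_pmf \<mu> g) \<le> e"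
  using d_TV_bind_le_expectation[of \<mu> f g "\<lambda>_. e"] assms by simp

lemma d_TV_le_1: "d_TV \<mu> \<nu> \<le> 1"
proof (rule d_TV_leI)
  fix A show "measure_pmf.prob \<mu> A - measure_pmf.prob \<nu> A \<le> 1"
    using measure_pmf.prob_le_1[of \<mu> A] measure_nonneg[of \<nu> A] by linarith
qed

text \<open>Both kernels are run from the same sample \<open>x\<close>, and the trivial bound 1 is
  paid only where they differ.\<close>

lemma d_TV_bind_disagree:
  "d_TV (bind_pmf \<mu> f) (bind_pmf \<mu> g) \<le> measure_pmf.prob \<mu> {x. f x \<noteq> g x}"
proof -
  have "d_TV (bind_pmf \<mu> f) (bind_pmf \<mu> g)
      \<le> measure_pmf.expectation \<mu> (indicator {x. f x \<noteq> g x})"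
    by (rule d_TV_bind_le_expectation)
      (auto simp: indicator_def d_TV_le_1 intro!: integrable_pmf_bounded[where B = 1])
  then show ?thesis by simp
qed

text \<open>Dividing by the mass of \<open>E\<close> only increases probabilities inside
  \<open>E\<close>, so all that \<mu> can have in excess lies outside \<open>E\<close>.\<close>

lemma d_TV_cond_pmf:
  assumes ne: "set_pmf \<mu> \<inter> E \<noteq> {}"
  shows "d_TV \<mu> (cond_pmf \<mu> E) \<le> measure_pmf.prob \<mu> (- E)"
proof (rule d_TV_leI)
  fix A
  define a where "a = measure_pmf.prob \<mu> E"
  have a: "0 < a" using ne by (auto simp: a_def measure_measure_pmf_not_zero zero_less_measure_iff)
  have "measure_pmf.prob (cond_pmf \<mu> E) A = measure_pmf.prob \<mu> (A \<inter> E) / a"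
    unfolding a_def cond_pmf.rep_eq[OF ne] using a
    by (subst measure_uniform_measure) (auto simp: a_def Int_commute measure_pmf.emeasure_eq_measure)
  moreover have "measure_pmf.prob \<mu> (A \<inter> E) / a \<ge> measure_pmf.prob \<mu> (A \<inter> E)"
    using a measure_pmf.prob_le_1[of \<mu> E]
    by (simp add: a_def[symmetric] le_divide_eq mult_left_le)
  moreover have "measure_pmf.prob \<mu> A \<le> measure_pmf.prob \<mu> (A \<inter> E) + measure_pmf.prob \<mu> (- E)"
    using measure_pmf.finite_measure_mono[of A "(A \<inter> E) \<union> - E" \<mu>]
      measure_Un_le[of "A \<inter> E" \<mu> "- E"] by (auto intro: order_trans)
  ultimately show "measure_pmf.prob \<mu> A - measure_pmf.prob (cond_pmf \<mu> E) A
      \<le> measure_pmf.prob \<mu> (- E)" by linarith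
qed

lemma d_TV_bernoulli:
  assumes "p \<in> {0..1}" "q \<in> {0..1}"
  shows "d_TV (bernoulli_pmf p) (bernoulli_pmf q) \<le> \<bar>p - q\<bar>"
proof (rule d_TV_leI)
  fix A :: "bool set"
  have *: "measure_pmf.prob (bernoulli_pmf r) A = (if True \<in> A then r else 0) + (if False \<in> A then 1 - r else 0)"
    if "r \<in> {0..1}" for r
  proof -
    have "measure_pmf.prob (bernoulli_pmf r) A = (\<Sum>b\<in>A. pmf (bernoulli_pmf r) b)"
      by (rule measure_measure_pmf_finite) simp
    also have "\<dots> = (\<Sum>b\<in>UNIV. if b \<in> A then pmf (bernoulli_pmf r) b else 0)"
      by (simp add: sum.If_cases)
    finally show ?thesis using that by (auto simp: UNIV_bool)
  qed
  show "measure_pmf.prob (bernoulli_pmf p) A - measure_pmf.prob (bernoulli_pmf q) A \<le> \<bar>p - q\<bar>"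
    using assms by (auto simp: * abs_if)
qed

text \<open>Summation forces \<open>c = 1\<close>. Conditional laws can then be identified without
  evaluating their normalising constants.\<close>

lemma pmf_eq_if_proportional:
  assumes "\<And>x. pmf \<mu> x = c * pmf \<nu> x"
  shows "\<mu> = \<nu>"
proof -
  have "(\<integral>x. pmf \<mu> x \<partial>count_space UNIV) = c * (\<integral>x. pmf \<nu> x \<partial>count_space UNIV)"
    unfolding assms by simp
  then have "c = 1" by (simp add: integral_pmf)
  then show ?thesis using assms by (simp add: pmf_eq_iff)
qed

subsection \<open>Random subsets\<close>

text \<open>The bits outside \<open>E\<close> default to \<open>False\<close>. The random set is
  therefore the image of the bit vector under the injective map \<open>Collect\<close>, which
  transports point masses.\<close>

lemma random_subset_eq_Collect:
  assumes "finite E"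
  shows "random_subset E p = map_pmf Collect (Pi_pmf E False (\<lambda>_. bernoulli_pmf p))"
  unfolding random_subset_def
proof (rule map_pmf_cong[OF refl])
  fix h assume "h \<in> set_pmf (Pi_pmf E False (\<lambda>_. bernoulli_pmf p))"
  then have "\<forall>e. e \<notin> E \<longrightarrow> \<not> h e" using set_Pi_pmf_subset[OF assms] by fastforce
  then show "{e \<in> E. h e} = Collect h" by auto
qed

lemma pmf_random_subset:
  assumes "finite E" "p \<in> {0..1}"
  shows "pmf (random_subset E p) X = (if X \<subseteq> E then p ^ card X * (1 - p) ^ card (E - X) else 0)"
proof -
  have "pmf (random_subset E p) X = pmf (map_pmf Collect (Pi_pmf E False (\<lambda>_. bernoulli_pmf p))) (Collect (\<lambda>e. e \<in> X))"
    using assms by (simp add: random_subset_eq_Collect)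
  also have "\<dots> = pmf (Pi_pmf E False (\<lambda>_. bernoulli_pmf p)) (\<lambda>e. e \<in> X)"
    by (rule pmf_map_inj') (auto simp: inj_def fun_eq_iff set_eq_iff)
  also have "\<dots> = (if X \<subseteq> E then \<Prod>e\<in>E. pmf (bernoulli_pmf p) (e \<in> X) else 0)"
    using assms by (subst pmf_Pi) auto
  finally have *: "pmf (random_subset E p) X
    = (if X \<subseteq> E then \<Prod>e\<in>E. pmf (bernoulli_pmf p) (e \<in> X) else 0)" .
  have "(\<Prod>e\<in>E. pmf (bernoulli_pmf p) (e \<in> X)) = p ^ card X * (1 - p) ^ card (E - X)" if "X \<subseteq> E"
  proof -
    have "(\<Prod>e\<in>E. pmf (bernoulli_pmf p) (e \<in> X))
      = (\<Prod>e\<in>X. pmf (bernoulli_pmf p) (e \<in> X)) * (\<Prod>e\<in>E - X. pmf (bernoulli_pmf p) (e \<in> X))"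
      using that assms by (metis prod.subset_diff mult.commute)
    also have "\<dots> = (\<Prod>e\<in>X. p) * (\<Prod>e\<in>E - X. 1 - p)"
      using assms by (intro arg_cong2[where f = "(*)"] prod.cong) auto
    finally show ?thesis by simp
  qed
  then show ?thesis unfolding * by simp
qed

lemma set_pmf_random_subset: "set_pmf (random_subset E p) \<subseteq> Pow E"
  by (auto simp: random_subset_def)

lemma random_subset_subsetD: "X \<in> set_pmf (random_subset E p) \<Longrightarrow> X \<subseteq> E"
  using set_pmf_random_subset by blast

lemma finite_set_pmf_random_subset: "finite E \<Longrightarrow> finite (set_pmf (random_subset E p))"
  by (rule finite_subset[OF set_pmf_random_subset]) simp

lemma random_subset_empty [simp]: "random_subset {} p = return_pmf {}"
  by (simp add: random_subset_def)

lemma set_pmf_random_subset_eq: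
  assumes "finite E" "0 < p" "p < 1"
  shows "set_pmf (random_subset E p) = Pow E"
  using assms by (auto simp: set_pmf_eq pmf_random_subset split: if_splits)

lemma random_subset_union:
  assumes "finite A" "finite B" "A \<inter> B = {}"
  shows "random_subset (A \<union> B) p
    = bind_pmf (random_subset A p) (\<lambda>X. map_pmf (\<lambda>Y. X \<union> Y) (random_subset B p))"
proof -
  have *: "{e \<in> A \<union> B. if e \<in> A then f e else g e} = {e \<in> A. f e} \<union> {e \<in> B. g e}" for f g
    using assms by auto
  show ?thesis
    unfolding random_subset_def Pi_pmf_union[OF assms] pair_pmf_def map_pmf_def bind_assoc_pmf
      bind_return_pmf case_prod_unfold fst_conv snd_conv * ..
qed

lemma random_subset_insert:
  assumes "finite A" "a \<notin> A"
  shows "random_subset (insert a A) p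
    = bind_pmf (bernoulli_pmf p) (\<lambda>b. map_pmf (\<lambda>X. if b then insert a X else X) (random_subset A p))"
proof -
  have *: "{e \<in> insert a A. (f(a := b)) e} = (if b then insert a {e \<in> A. f e} else {e \<in> A. f e})" for f b
    using assms by auto
  show ?thesis
    unfolding random_subset_def Pi_pmf_insert'[OF assms] map_pmf_def bind_assoc_pmf
      bind_return_pmf * ..
qed

lemma random_subset_image:
  assumes "finite A" "inj_on f A"
  shows "random_subset (f ` A) p = map_pmf ((`) f) (random_subset A p)"
  using assms
proof (induction A rule: finite_induct)
  case (insert a A)
  then have "f a \<notin> f ` A" by auto
  then show ?case using insert
    by (simp add: random_subset_insert map_pmf_def bind_assoc_pmf bind_return_pmf if_distrib cong: if_cong)
      (intro bind_pmf_cong refl, auto simp: bind_return_pmf)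
qed simp

lemma prob_subset_random_subset:
  assumes "finite E" "p \<in> {0..1}" "B \<subseteq> E"
  shows "measure_pmf.prob (random_subset E p) {X. B \<subseteq> X} = p ^ card B"
proof -
  have fin: "finite B" using assms finite_subset by blast
  have "measure_pmf.prob (random_subset E p) {X. B \<subseteq> X}
    = measure_pmf.prob (Pi_pmf E False (\<lambda>_. bernoulli_pmf p)) (Pi E (\<lambda>e. if e \<in> B then {True} else UNIV))"
    using assms unfolding random_subset_def
    by (auto simp: Pi_iff intro!: arg_cong2[where f = measure] split: if_splits)
  also have "\<dots> = (\<Prod>e\<in>E. measure_pmf.prob (bernoulli_pmf p) (if e \<in> B then {True} else UNIV))"
    using assms(1) by (rule measure_Pi_pmf_Pi)
  also have "\<dots> = (\<Prod>e\<in>E. if e \<in> B then p else 1)"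
    using assms by (intro prod.cong) (auto simp: measure_pmf_single)
  also have "\<dots> = (\<Prod>e\<in>B. p)"
    using assms by (simp add: prod.If_cases Int_absorb1)
  finally show ?thesis by simp
qed

lemma prob_random_subset_meets:
  fixes p :: real
  assumes "finite E" "p \<in> {0..1}" "B \<subseteq> E"
  shows "measure_pmf.prob (random_subset E p) {X. X \<inter> B \<noteq> {}} \<le> card B * p"
proof -
  have fin: "finite B" using assms finite_subset by blast
  have "measure_pmf.prob (random_subset E p) {X. X \<inter> B \<noteq> {}}
    = measure_pmf.prob (random_subset E p) (\<Union>b\<in>B. {X. {b} \<subseteq> X})"
    by (rule arg_cong2[where f = measure]) auto
  also have "\<dots> \<le> (\<Sum>b\<in>B. measure_pmf.prob (random_subset E p) {X. {b} \<subseteq> X})"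
    using fin by (intro measure_pmf.finite_measure_subadditive_finite) auto
  also have "\<dots> = (\<Sum>b\<in>B. p)"
  proof (intro sum.cong refl)
    fix b assume "b \<in> B"
    then have "{b} \<subseteq> E" using assms by auto
    then show "measure_pmf.prob (random_subset E p) {X. {b} \<subseteq> X} = p"
      using prob_subset_random_subset[OF assms(1,2), of "{b}"] by simp
  qed
  finally show ?thesis by simp
qed

lemma d_TV_random_subset:
  fixes p q :: real
  assumes "finite E" "p \<in> {0..1}" "q \<in> {0..1}"
  shows "d_TV (random_subset E p) (random_subset E q) \<le> card E * \<bar>p - q\<bar>"
  using assms(1)
proof (induction E rule: finite_induct)
  case (insert a A)
  let ?f = "\<lambda>r b. map_pmf (\<lambda>X. if b then insert a X else X) (random_subset A r)"
  have "d_TV (random_subset (insert a A) p) (random_subset (insert a A) q)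
      \<le> d_TV (bind_pmf (bernoulli_pmf p) (?f p)) (bind_pmf (bernoulli_pmf p) (?f q))
       + d_TV (bind_pmf (bernoulli_pmf p) (?f q)) (bind_pmf (bernoulli_pmf q) (?f q))"
    using insert.hyps by (simp add: random_subset_insert d_TV_triangle)
  also have "\<dots> \<le> card A * \<bar>p - q\<bar> + \<bar>p - q\<bar>"
    using assms
    by (intro add_mono d_TV_bind_right order_trans[OF d_TV_bind_left] order_trans[OF d_TV_map_left]
        d_TV_bernoulli insert.IH) auto
  finally show ?case using insert.hyps by (simp add: algebra_simps)
qed simp

text \<open>The union forgets the bits in \<open>B\<close>, so the law is that of \<open>B\<close>
  joined with a random subset of \<open>E - B\<close>; compared with the full product, the factor
  \<open>p ^ card B\<close> is missing. This likelihood ratio drives both the second moment method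
  and the posterior of the triangles.\<close>

lemma pmf_random_subset_Un:
  assumes "finite E" "p \<in> {0<..1}" "B \<subseteq> E"
  shows "pmf (map_pmf (\<lambda>X. X \<union> B) (random_subset E p)) Y
    = (if B \<subseteq> Y then pmf (random_subset E p) Y / p ^ card B else 0)"
proof -
  have fin: "finite B" using assms finite_subset by blast
  have "random_subset E p = random_subset (B \<union> (E - B)) p" using assms by (simp add: Un_absorb1)
  also have "\<dots> = bind_pmf (random_subset B p) (\<lambda>X. map_pmf (\<lambda>Y. X \<union> Y) (random_subset (E - B) p))"
    using fin assms by (intro random_subset_union) auto
  finally have "map_pmf (\<lambda>X. X \<union> B) (random_subset E p)
      = bind_pmf (random_subset B p) (\<lambda>X. map_pmf (\<lambda>Y. (X \<union> Y) \<union> B) (random_subset (E - B) p))"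
    by (simp add: map_bind_pmf pmf.map_comp o_def)
  also have "\<dots> = bind_pmf (random_subset B p) (\<lambda>X. map_pmf (\<lambda>Y. Y \<union> B) (random_subset (E - B) p))"
    by (intro bind_pmf_cong refl map_pmf_cong) (auto dest: random_subset_subsetD)
  finally have eq: "map_pmf (\<lambda>X. X \<union> B) (random_subset E p) = map_pmf (\<lambda>Y. Y \<union> B) (random_subset (E - B) p)"
    by simp
  show ?thesis
  proof (cases "B \<subseteq> Y \<and> Y \<subseteq> E")
    case True
    have inj: "inj_on (\<lambda>Y. Y \<union> B) (Pow (E - B))" by (auto simp: inj_on_def)
    have "pmf (map_pmf (\<lambda>Y. Y \<union> B) (random_subset (E - B) p)) Y
      = measure_pmf.prob (random_subset (E - B) p) ((\<lambda>Y. Y \<union> B) -` {Y})" by (simp add: pmf_map)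
    also have "\<dots> = measure_pmf.prob (random_subset (E - B) p) {Y - B}"
    proof (rule measure_pmf.finite_measure_eq_AE)
      show "AE x in random_subset (E - B) p. (x \<in> (\<lambda>Y. Y \<union> B) -` {Y}) = (x \<in> {Y - B})"
        using True by (auto simp: AE_measure_pmf_iff dest!: random_subset_subsetD)
    qed auto
    also have "\<dots> = p ^ card (Y - B) * (1 - p) ^ card (E - Y)"
      using True assms by (auto simp: measure_pmf_single pmf_random_subset Diff_Diff_Int
          Int_absorb1 intro!: arg_cong[where f = card] arg_cong[where f = "\<lambda>k. (1 - p) ^ k"])
    also have "p ^ card (Y - B) = p ^ card Y / p ^ card B"
      using True fin assms by (subst card_Diff_subset) (auto simp: power_diff card_mono finite_subset)
    finally show ?thesis using True assms unfolding eq by (simp add: pmf_random_subset)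
  next
    case False
    then have "Y \<notin> set_pmf (map_pmf (\<lambda>Y. Y \<union> B) (random_subset (E - B) p))"
      using assms(3) by (auto dest!: random_subset_subsetD)
    then have "pmf (map_pmf (\<lambda>X. X \<union> B) (random_subset E p)) Y = 0"
      unfolding eq by (simp add: set_pmf_eq)
    then show ?thesis using False assms by (auto simp: pmf_random_subset)
  qed
qed

lemma sum_power_card_Pow:
  fixes c :: "'b::comm_ring_1"
  assumes "finite A"
  shows "(\<Sum>X\<in>Pow A. c ^ card X) = (1 + c) ^ card A"
  using prod_add[OF assms, of "\<lambda>_. c" "\<lambda>_. 1"] by (simp add: add.commute)

subsection \<open>Hiding wedges in noise\<close>

text \<open>
  Adding the blocks \<open>w i\<close>, \<open>i \<in> V\<close>, to a random edge set \<open>X\<close> has density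
  \<open>Y \<mapsto> \<Sum>V. Q V [\<Union>(w ` V) \<subseteq> Y] p^(-2|V|)\<close> with respect to the law of \<open>X\<close>; its second
  moment is \<open>E p^(-2|V \<inter> V'|)\<close> for an independent copy \<open>V'\<close> of \<open>V\<close>.
\<close>

lemma d_TV_random_blocks:
  fixes w :: "'i \<Rightarrow> 'a set" and Q :: "'i set pmf"
  assumes E: "finite E" and p: "p \<in> {0<..1}" and I: "finite I"
    and w: "\<And>i. i \<in> I \<Longrightarrow> w i \<subseteq> E" "\<And>i. i \<in> I \<Longrightarrow> card (w i) = 2"
      "\<And>i j. i \<in> I \<Longrightarrow> j \<in> I \<Longrightarrow> i \<noteq> j \<Longrightarrow> w i \<inter> w j = {}"
    and Q: "set_pmf Q \<subseteq> Pow I"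
    and C: "0 \<le> C" "0 \<le> a"
      "\<And>A. A \<subseteq> I \<Longrightarrow> A \<noteq> {} \<Longrightarrow> measure_pmf.prob Q {V. A \<subseteq> V} \<le> C * a ^ card A"
  shows "d_TV (bind_pmf Q (\<lambda>V. map_pmf (\<lambda>X. X \<union> (\<Union>i\<in>V. w i)) (random_subset E p))) (random_subset E p)
    \<le> C * sqrt ((1 + (1 / p\<^sup>2 - 1) * a\<^sup>2) ^ card I - 1)"
proof -
  define \<pi> where "\<pi> = random_subset E p"
  define W where "W V = (\<Union>i\<in>V. w i)" for V
  define c where "c = 1 / p\<^sup>2 - 1"
  define h where "h Y = (\<Sum>V\<in>Pow I. pmf Q V * (if W V \<subseteq> Y then 1 / p ^ card (W V) else 0))" for Y
  define L where "L = bind_pmf Q (\<lambda>V. map_pmf (\<lambda>X. X \<union> W V) \<pi>)"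
  have p': "p \<in> {0..1}" "0 < p" using p by auto
  have c0: "0 \<le> c" using p by (auto simp: c_def power_le_one)
  have fin: "finite (Pow I)" "finite (Pow E)" using I E by auto
  have W: "W V \<subseteq> E" "finite (W V)" "card (W V) = 2 * card V" if "V \<subseteq> I" for V
  proof -
    show "W V \<subseteq> E" using that w by (auto simp: W_def)
    then show "finite (W V)" using E finite_subset by blast
    have "card (W V) = (\<Sum>i\<in>V. card (w i))" unfolding W_def
    proof (rule card_UN_disjoint)
      show "finite V" using that I finite_subset by blast
      show "\<forall>i\<in>V. finite (w i)" using that w(1) E finite_subset by blast
      show "\<forall>i\<in>V. \<forall>j\<in>V. i \<noteq> j \<longrightarrow> w i \<inter> w j = {}" using that w(3) by blast
    qed
    also have "\<dots> = (\<Sum>i\<in>V. 2)" using that w by (intro sum.cong) auto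
    finally show "card (W V) = 2 * card V" by simp
  qed
  have fin\<pi>: "finite (set_pmf \<pi>)" unfolding \<pi>_def by (rule finite_set_pmf_random_subset[OF E])
  have int: "integrable \<pi> f" for f :: "_ \<Rightarrow> real" by (rule integrable_measure_pmf_finite[OF fin\<pi>])
  have sumQ: "(\<Sum>V\<in>Pow I. pmf Q V) = 1" by (rule sum_pmf_eq_1[OF fin(1) Q])
  have pmfL: "pmf L Y = h Y * pmf \<pi> Y" for Y
  proof -
    have "pmf L Y = (\<Sum>V\<in>Pow I. pmf Q V * pmf (map_pmf (\<lambda>X. X \<union> W V) \<pi>) Y)"
      unfolding L_def pmf_bind using Q by (subst integral_measure_pmf_real[OF fin(1)]) (auto simp: mult.commute)
    also have "\<dots> = (\<Sum>V\<in>Pow I. pmf Q V * (if W V \<subseteq> Y then 1 / p ^ card (W V) else 0) * pmf \<pi> Y)"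
      unfolding \<pi>_def using E p W by (intro sum.cong refl) (simp add: pmf_random_subset_Un)
    finally show ?thesis by (simp add: h_def sum_distrib_right)
  qed
  have E\<pi>: "measure_pmf.expectation \<pi> f = (\<Sum>Y\<in>Pow E. f Y * pmf \<pi> Y)" for f :: "_ \<Rightarrow> real"
    using fin set_pmf_random_subset unfolding \<pi>_def by (intro integral_measure_pmf_real) auto
  have probL: "measure_pmf.prob L A = measure_pmf.expectation \<pi> (\<lambda>Y. h Y * indicator A Y)" for A
  proof -
    have "measure_pmf.prob L A = (\<Sum>Y\<in>Pow E. indicator A Y * pmf L Y)"
    proof -
      have "measure_pmf.prob L A = measure_pmf.expectation L (indicator A)" by simp
      also have "\<dots> = (\<Sum>Y\<in>Pow E. indicator A Y * pmf L Y)"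
      proof (rule integral_measure_pmf_real[OF fin(2)])
        fix Y assume "Y \<in> set_pmf L"
        then obtain V X where "V \<in> set_pmf Q" "X \<in> set_pmf \<pi>" "Y = X \<union> W V"
          by (auto simp: L_def)
        then show "Y \<in> Pow E"
          using Q W(1)[of V] by (auto simp: \<pi>_def dest!: random_subset_subsetD)
      qed
      finally show ?thesis .
    qed
    then show ?thesis by (simp add: E\<pi> pmfL mult_ac)
  qed
  have prob\<pi>: "measure_pmf.prob \<pi> A = measure_pmf.expectation \<pi> (indicator A)" for A by simp
  have Eh: "measure_pmf.expectation \<pi> h = 1"
    using probL[of UNIV] by (simp add: measure_pmf.prob_space)
  have Eh2: "measure_pmf.expectation \<pi> (\<lambda>Y. (h Y)\<^sup>2) \<le> 1 + C\<^sup>2 * ((1 + c * a\<^sup>2) ^ card I - 1)"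
  proof -
    \<comment> \<open>The overlap weight is \<open>(1 + c) ^ card (V \<inter> V')\<close>. Expanding
      it over the subsets \<open>A\<close> of the intersection separates \<open>V\<close> from
      \<open>V'\<close>, and after averaging over the two independent copies each \<open>A\<close>
      contributes the square of the probability that \<open>A \<subseteq> V\<close>.\<close>
    have ov: "1 / p ^ card (W V) * (1 / p ^ card (W V')) * p ^ card (W V \<union> W V')
        = (\<Sum>A\<in>Pow I. c ^ card A * (indicator {V. A \<subseteq> V} V * indicator {V. A \<subseteq> V} V'))"
      if "V \<subseteq> I" "V' \<subseteq> I" for V V'
    proof -
      have fV: "finite V" "finite V'" using that I finite_subset by auto
      have "W V \<union> W V' = W (V \<union> V')" by (auto simp: W_def)
      then have "card (W V \<union> W V') = 2 * card (V \<union> V')" using that W(3)[of "V \<union> V'"] by simp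
      moreover have "card (V \<union> V') + card (V \<inter> V') = card V + card V'"
        using card_Un_Int[OF fV] by simp
      ultimately have "card (W V \<union> W V') + 2 * card (V \<inter> V') = card (W V) + card (W V')"
        using W(3) that by simp
      then have "p ^ card (W V \<union> W V') * p ^ (2 * card (V \<inter> V')) = p ^ card (W V) * p ^ card (W V')"
        by (metis power_add)
      then have "1 / p ^ card (W V) * (1 / p ^ card (W V')) * p ^ card (W V \<union> W V')
          = (1 / p\<^sup>2) ^ card (V \<inter> V')"
        using p' by (simp add: field_simps power_mult power_divide)
      also have "\<dots> = (1 + c) ^ card (V \<inter> V')" by (simp add: c_def)
      also have "\<dots> = (\<Sum>A\<in>Pow (V \<inter> V'). c ^ card A)"
        using fV by (intro sum_power_card_Pow[symmetric]) auto
      also have "\<dots> = (\<Sum>A\<in>Pow I. c ^ card A * (indicator {V. A \<subseteq> V} V * indicator {V. A \<subseteq> V} V'))"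
        using that I by (intro sum.mono_neutral_cong_left) (auto simp: indicator_def)
      finally show ?thesis .
    qed
    have PW: "measure_pmf.expectation \<pi> (\<lambda>Y. (if W V \<subseteq> Y then x else 0) * (if W V' \<subseteq> Y then y else 0))
        = x * y * p ^ card (W V \<union> W V')" if "V \<subseteq> I" "V' \<subseteq> I" for V V' x y
    proof -
      have "(\<lambda>Y. (if W V \<subseteq> Y then x else 0) * (if W V' \<subseteq> Y then y else 0))
          = (\<lambda>Y. (x * y) * indicator {Y. W V \<union> W V' \<subseteq> Y} Y)" by (auto simp: indicator_def)
      then show ?thesis
        using prob_subset_random_subset[OF E p'(1), of "W V \<union> W V'"] W that by (simp add: \<pi>_def)
    qed
    have "measure_pmf.expectation \<pi> (\<lambda>Y. (h Y)\<^sup>2)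
      = (\<Sum>V\<in>Pow I. \<Sum>V'\<in>Pow I. pmf Q V * pmf Q V' * measure_pmf.expectation \<pi>
          (\<lambda>Y. (if W V \<subseteq> Y then 1 / p ^ card (W V) else 0) * (if W V' \<subseteq> Y then 1 / p ^ card (W V') else 0)))"
      unfolding h_def power2_eq_square sum_product
      by (subst Bochner_Integration.integral_sum, rule int, intro sum.cong refl)
        (subst Bochner_Integration.integral_sum, rule int, intro sum.cong refl,
          subst integral_mult_right_zero[symmetric], intro Bochner_Integration.integral_cong refl, simp add: mult_ac)
    also have "\<dots> = (\<Sum>V\<in>Pow I. \<Sum>V'\<in>Pow I. pmf Q V * pmf Q V' *
        (\<Sum>A\<in>Pow I. c ^ card A * (indicator {V. A \<subseteq> V} V * indicator {V. A \<subseteq> V} V')))"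
      by (intro sum.cong refl) (subst PW, simp, simp, subst ov, auto)
    also have "\<dots> = (\<Sum>V\<in>Pow I. \<Sum>V'\<in>Pow I. \<Sum>A\<in>Pow I. pmf Q V * pmf Q V' *
        (c ^ card A * (indicator {V. A \<subseteq> V} V * indicator {V. A \<subseteq> V} V')))"
      by (simp add: sum_distrib_left)
    also have "\<dots> = (\<Sum>V\<in>Pow I. \<Sum>A\<in>Pow I. \<Sum>V'\<in>Pow I. pmf Q V * pmf Q V' *
        (c ^ card A * (indicator {V. A \<subseteq> V} V * indicator {V. A \<subseteq> V} V')))"
      by (intro sum.cong refl sum.swap)
    also have "\<dots> = (\<Sum>A\<in>Pow I. \<Sum>V\<in>Pow I. \<Sum>V'\<in>Pow I. pmf Q V * pmf Q V' *
        (c ^ card A * (indicator {V. A \<subseteq> V} V * indicator {V. A \<subseteq> V} V')))"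
      by (rule sum.swap)
    also have "\<dots> = (\<Sum>A\<in>Pow I. c ^ card A *
        ((\<Sum>V\<in>Pow I. pmf Q V * indicator {V. A \<subseteq> V} V) * (\<Sum>V\<in>Pow I. pmf Q V * indicator {V. A \<subseteq> V} V)))"
      by (intro sum.cong refl) (simp only: sum_product, simp add: sum_distrib_left mult_ac)
    also have "\<dots> = (\<Sum>A\<in>Pow I. c ^ card A * (measure_pmf.prob Q {V. A \<subseteq> V})\<^sup>2)"
    proof (intro sum.cong refl)
      fix A
      have "measure_pmf.prob Q {V. A \<subseteq> V} = measure_pmf.expectation Q (indicator {V. A \<subseteq> V})" by simp
      also have "\<dots> = (\<Sum>V\<in>Pow I. indicator {V. A \<subseteq> V} V * pmf Q V)"
        using fin Q by (intro integral_measure_pmf_real) auto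
      finally show "c ^ card A * ((\<Sum>V\<in>Pow I. pmf Q V * indicator {V. A \<subseteq> V} V) *
          (\<Sum>V\<in>Pow I. pmf Q V * indicator {V. A \<subseteq> V} V)) = c ^ card A * (measure_pmf.prob Q {V. A \<subseteq> V})\<^sup>2"
        by (simp add: power2_eq_square mult.commute)
    qed
    \<comment> \<open>The empty set carries the squared mean of \<open>h\<close> and is split off
      first; the factor \<open>C\<close> then multiplies only the small remainder.\<close>
    also have "\<dots> = 1 + (\<Sum>A\<in>Pow I - {{}}. c ^ card A * (measure_pmf.prob Q {V. A \<subseteq> V})\<^sup>2)"
    proof -
      have "Collect ((\<subseteq>) {}) = (UNIV :: 'i set set)" by auto
      then have "measure_pmf.prob Q (Collect ((\<subseteq>) {})) = 1"
        using measure_pmf.prob_space[of Q] by simp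
      then show ?thesis using fin by (subst sum.remove[of _ "{}"]) auto
    qed
    also have "\<dots> \<le> 1 + (\<Sum>A\<in>Pow I - {{}}. c ^ card A * (C * a ^ card A)\<^sup>2)"
      using c0 C by (intro add_left_mono sum_mono mult_left_mono power_mono) auto
    also have "\<dots> = 1 + C\<^sup>2 * (\<Sum>A\<in>Pow I - {{}}. (c * a\<^sup>2) ^ card A)"
      by (simp add: sum_distrib_left power_mult_distrib mult_ac power2_eq_square)
    also have "(\<Sum>A\<in>Pow I - {{}}. (c * a\<^sup>2) ^ card A) = (1 + c * a\<^sup>2) ^ card I - 1"
      using sum_power_card_Pow[OF I, of "c * a\<^sup>2"] fin by (subst (asm) sum.remove[of _ "{}"]) auto
    finally show ?thesis .
  qed
  \<comment> \<open>Cauchy-Schwarz in the form that the variance of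
    \<open>\<bar>h Y - 1\<bar>\<close> is nonnegative; the mean of \<open>h\<close> is 1, so the
    second moment of \<open>h - 1\<close> is that of \<open>h\<close> minus 1.\<close>
  have dev: "(measure_pmf.expectation \<pi> (\<lambda>Y. \<bar>h Y - 1\<bar>))\<^sup>2 \<le> C\<^sup>2 * ((1 + c * a\<^sup>2) ^ card I - 1)"
  proof -
    let ?X = "\<lambda>Y. \<bar>h Y - 1\<bar>"
    have "0 \<le> measure_pmf.variance \<pi> ?X" by (rule measure_pmf.variance_positive)
    then have "(measure_pmf.expectation \<pi> ?X)\<^sup>2 \<le> measure_pmf.expectation \<pi> (\<lambda>Y. (?X Y)\<^sup>2)"
      by (subst (asm) measure_pmf.variance_eq) (auto intro: int)
    also have "(\<lambda>Y. (?X Y)\<^sup>2) = (\<lambda>Y. (h Y)\<^sup>2 - 2 * h Y + 1)"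
      by (rule ext) (simp add: power2_diff)
    also have "measure_pmf.expectation \<pi> \<dots> = measure_pmf.expectation \<pi> (\<lambda>Y. (h Y)\<^sup>2) - 2 * 1 + 1"
      unfolding Eh[symmetric] by (simp add: int measure_pmf.prob_space Eh)
    finally show ?thesis using Eh2 by linarith
  qed
  have "d_TV L \<pi> \<le> measure_pmf.expectation \<pi> (\<lambda>Y. \<bar>h Y - 1\<bar>)"
  proof (rule d_TV_leI)
    fix A
    have "measure_pmf.prob L A - measure_pmf.prob \<pi> A
        = measure_pmf.expectation \<pi> (\<lambda>Y. h Y * indicator A Y - indicator A Y)"
      unfolding probL prob\<pi> by (subst Bochner_Integration.integral_diff) (auto intro: int)
    also have "\<dots> \<le> measure_pmf.expectation \<pi> (\<lambda>Y. \<bar>h Y - 1\<bar>)"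
      by (rule integral_mono) (auto intro: int simp: indicator_def)
    finally show "measure_pmf.prob L A - measure_pmf.prob \<pi> A \<le> measure_pmf.expectation \<pi> (\<lambda>Y. \<bar>h Y - 1\<bar>)" .
  qed
  also have "\<dots> \<le> sqrt (C\<^sup>2 * ((1 + c * a\<^sup>2) ^ card I - 1))"
    using dev by (rule real_le_rsqrt)
  also have "\<dots> = C * sqrt ((1 + c * a\<^sup>2) ^ card I - 1)"
    using C by (simp add: real_sqrt_mult)
  finally show ?thesis by (simp add: L_def W_def \<pi>_def c_def)
qed

text \<open>Intended for the triangles with exactly two vertices in \<open>S\<close>: they are
  indexed by base and apex, so a random set of them is an independent family of random apex sets,
  one for each base.\<close>

lemma random_subset_UN_image:
  assumes "finite I" "finite A" "\<And>i. i \<in> I \<Longrightarrow> inj_on (f i) A"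
    and "\<And>i j. i \<in> I \<Longrightarrow> j \<in> I \<Longrightarrow> i \<noteq> j \<Longrightarrow> f i ` A \<inter> f j ` A = {}"
  shows "random_subset (\<Union>i\<in>I. f i ` A) p
    = map_pmf (\<lambda>h. \<Union>i\<in>I. f i ` h i) (Pi_pmf I {} (\<lambda>_. random_subset A p))"
  using assms
proof (induction I rule: finite_induct)
  case (insert i I)
  have "random_subset (\<Union>j\<in>insert i I. f j ` A) p = random_subset (f i ` A \<union> (\<Union>j\<in>I. f j ` A)) p"
    by simp
  also have "\<dots> = bind_pmf (random_subset (f i ` A) p)
      (\<lambda>X. map_pmf (\<lambda>Y. X \<union> Y) (random_subset (\<Union>j\<in>I. f j ` A) p))"
  proof (rule random_subset_union)
    show "f i ` A \<inter> (\<Union>j\<in>I. f j ` A) = {}" using insert.prems(3) insert.hyps by blast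
  qed (use insert in auto)
  also have "random_subset (f i ` A) p = map_pmf ((`) (f i)) (random_subset A p)"
    using insert.prems by (intro random_subset_image) auto
  also have "random_subset (\<Union>j\<in>I. f j ` A) p
      = map_pmf (\<lambda>h. \<Union>j\<in>I. f j ` h j) (Pi_pmf I {} (\<lambda>_. random_subset A p))"
    using insert.prems by (intro insert.IH) auto
  finally show ?case
    using insert.hyps
    by (simp add: Pi_pmf_insert' map_bind_pmf bind_map_pmf pmf.map_comp o_def map_pmf_def[symmetric])
      (intro bind_pmf_cong refl map_pmf_cong, auto split: if_splits)
qed simp

subsection \<open>Triangles relative to a vertex set\<close>

definition cover :: "nat set set \<Rightarrow> graph" where
  "cover T = (\<Union>t\<in>T. nsets t 2)"

definition plant_at :: "nat set \<Rightarrow> real \<Rightarrow> graph \<Rightarrow> graph pmf" where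
  "plant_at S q G = map_pmf (\<lambda>H. (G - nsets S 2) \<union> H) (random_subset (nsets S 2) q)"

definition add_triangles :: "nat \<Rightarrow> real \<Rightarrow> graph \<Rightarrow> graph pmf" where
  "add_triangles n p' G = map_pmf (\<lambda>T. G \<union> cover T) (random_subset (nsets {..<n} 3) p')"

lemma cover_Un: "cover (A \<union> B) = cover A \<union> cover B"
  by (auto simp: cover_def)

lemma finite_cover: "finite T \<Longrightarrow> T \<subseteq> nsets A r \<Longrightarrow> finite (cover T)"
  by (auto simp: cover_def nsets_def intro!: finite_imp_finite_nsets)

lemma cover_subset: "T \<subseteq> nsets A r \<Longrightarrow> cover T \<subseteq> nsets A 2"
  by (auto simp: cover_def nsets_def)

lemma RGT_eq_add_triangles: "RGT n p p' = bind_pmf (ER n p) (add_triangles n p')"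
  by (simp add: RGT_def add_triangles_def[abs_def] cover_def map_pmf_def)

lemma plant_eq_plant_at:
  "plant n k q \<mu> = bind_pmf (pmf_of_set (nsets {..<n} k)) (\<lambda>S. bind_pmf \<mu> (plant_at S q))"
  unfolding plant_def plant_at_def map_pmf_def by (rule bind_commute_pmf)

locale noisy_graph =
  fixes n :: nat and p p' :: real
  assumes p: "0 < p" "p < 1" and p': "0 \<le> p'" "p' < 1"

locale planted = noisy_graph +
  fixes S :: "nat set"
  assumes S: "S \<subseteq> {..<n}"
begin

abbreviation "In \<equiv> nsets S 2"
definition "Out = nsets {..<n} 2 - In"
definition "Ap = {..<n} - S"
text \<open>Triangles are sorted by the number of their sides inside \<open>S\<close>: none in
  \<open>TO\<close>, one in \<open>TS\<close>, three in \<open>Int3\<close>. A triangle of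
  \<open>TS\<close> is determined by that side and its apex outside \<open>S\<close>; its two other
  sides form the \<open>wedge\<close>.\<close>

definition "TO = {t \<in> nsets {..<n} 3. card (t \<inter> S) \<le> 1}"
definition "TS = (\<Union>e\<in>In. (\<lambda>v. insert v e) ` Ap)"
abbreviation "Int3 \<equiv> nsets S 3"
definition "TSof h = (\<Union>e\<in>In. (\<lambda>v. insert v e) ` h e)"
definition wedge :: "nat set \<Rightarrow> nat \<Rightarrow> graph" where "wedge e v = (\<lambda>x. {x, v}) ` e"
definition "wedges h = (\<Union>e\<in>In. \<Union>v\<in>h e. wedge e v)"

lemma finS: "finite S" using S finite_subset by blast

lemma fin [simp]: "finite In" "finite Out" "finite Ap" "finite TO" "finite TS" "finite Int3"
  using finS by (auto simp: Out_def Ap_def TO_def TS_def intro!: finite_imp_finite_nsets)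

lemma InD: assumes "e \<in> In" shows "e \<subseteq> S" "finite e" "card e = 2"
  using assms by (auto simp: nsets_def)

lemma wedge_props:
  assumes e: "e \<in> In" and v: "v \<in> Ap"
  shows "wedge e v \<subseteq> Out" "card (wedge e v) = 2"
    and "\<And>u. u \<in> Ap \<Longrightarrow> u \<noteq> v \<Longrightarrow> wedge e u \<inter> wedge e v = {}"
    and "nsets (insert v e) 2 = insert e (wedge e v)"
proof -
  obtain x y where xy: "e = {x, y}" "x \<noteq> y" using e by (auto simp: nsets_def card_2_iff)
  have mem: "x \<in> S" "y \<in> S" "v \<notin> S" "v < n" using e v xy by (auto simp: nsets_def Ap_def)
  show "wedge e v \<subseteq> Out"
    using mem S xy by (auto simp: wedge_def Out_def)
  have "v \<noteq> x" "v \<noteq> y" using mem by auto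
  then show "card (wedge e v) = 2" "nsets (insert v e) 2 = insert e (wedge e v)"
    using xy mem by (auto simp: wedge_def doubleton_eq_iff nsets_2_eq)
  show "wedge e u \<inter> wedge e v = {}" if "u \<in> Ap" "u \<noteq> v" for u
    using that v mem xy by (auto simp: wedge_def doubleton_eq_iff Ap_def)
qed

lemma cover_TSof:
  assumes "\<And>e. e \<in> In \<Longrightarrow> h e \<subseteq> Ap"
  shows "cover (TSof h) = {e \<in> In. h e \<noteq> {}} \<union> wedges h"
proof -
  have "cover (TSof h) = (\<Union>e\<in>In. \<Union>v\<in>h e. nsets (insert v e) 2)"
    by (auto simp: cover_def TSof_def)
  also have "\<dots> = (\<Union>e\<in>In. \<Union>v\<in>h e. insert e (wedge e v))"
    using assms by (intro SUP_cong refl wedge_props(4)) auto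
  also have "\<dots> = {e \<in> In. h e \<noteq> {}} \<union> wedges h" by (auto simp: wedges_def)
  finally show ?thesis .
qed

lemma wedges_subset: "(\<And>e. e \<in> In \<Longrightarrow> h e \<subseteq> Ap) \<Longrightarrow> wedges h \<subseteq> Out"
  using wedge_props(1) unfolding wedges_def by blast

lemma cover_TO: "T \<subseteq> TO \<Longrightarrow> cover T \<subseteq> Out"
proof
  fix d assume T: "T \<subseteq> TO" and "d \<in> cover T"
  then obtain t where t: "t \<in> TO" "d \<in> nsets t 2" by (auto simp: cover_def)
  have "d \<notin> In"
  proof
    assume "d \<in> In"
    then have "d \<subseteq> t \<inter> S" "card d = 2" using t by (auto simp: nsets_def)
    moreover have "finite (t \<inter> S)" using finS by auto
    ultimately have "2 \<le> card (t \<inter> S)" by (metis card_mono)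
    then show False using t by (auto simp: TO_def)
  qed
  then show "d \<in> Out" using t by (auto simp: Out_def TO_def nsets_def)
qed

lemma cover_Int: "T \<subseteq> Int3 \<Longrightarrow> cover T \<subseteq> In"
  by (rule cover_subset)

lemma triangles_split: "nsets {..<n} 3 = Int3 \<union> (TS \<union> TO)" "Int3 \<inter> (TS \<union> TO) = {}" "TS \<inter> TO = {}"
proof -
  have TS: "t \<in> TS \<longleftrightarrow> t \<in> nsets {..<n} 3 \<and> card (t \<inter> S) = 2" for t
  proof
    assume "t \<in> TS"
    then obtain e v where ev: "e \<in> In" "v \<in> Ap" "t = insert v e" by (auto simp: TS_def)
    then have *: "t \<inter> S = e" "v \<notin> e" "t \<subseteq> {..<n}" using InD[of e] S by (auto simp: Ap_def)
    moreover have "finite t" "card t = 3" using ev InD[of e] * by simp_all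
    ultimately show "t \<in> nsets {..<n} 3 \<and> card (t \<inter> S) = 2"
      using InD(3)[OF ev(1)] by (simp add: nsets_def)
  next
    assume t: "t \<in> nsets {..<n} 3 \<and> card (t \<inter> S) = 2"
    have "card (t - S) = 1" using t finS card_Diff_subset_Int[of t S] by (auto simp: nsets_def)
    then obtain v where v: "t - S = {v}" by (auto simp: card_1_singleton_iff)
    then have "t = insert v (t \<inter> S)" "v \<in> Ap" "t \<inter> S \<in> In"
      using t finS by (auto simp: nsets_def Ap_def)
    then show "t \<in> TS" unfolding TS_def by blast
  qed
  have I: "t \<in> Int3 \<longleftrightarrow> t \<in> nsets {..<n} 3 \<and> card (t \<inter> S) = 3" for t
  proof
    assume "t \<in> Int3"
    moreover from this have "t \<inter> S = t" by (auto simp: nsets_def)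
    ultimately show "t \<in> nsets {..<n} 3 \<and> card (t \<inter> S) = 3" using S by (auto simp: nsets_def)
  next
    assume t: "t \<in> nsets {..<n} 3 \<and> card (t \<inter> S) = 3"
    then have "t \<inter> S = t" by (intro card_subset_eq) (auto simp: nsets_def)
    then show "t \<in> Int3" using t by (auto simp: nsets_def)
  qed
  have le: "card (t \<inter> S) \<le> 3" if "t \<in> nsets {..<n} 3" for t
    using that card_mono[of t "t \<inter> S"] by (auto simp: nsets_def)
  show "nsets {..<n} 3 = Int3 \<union> (TS \<union> TO)"
  proof (intro equalityI subsetI)
    fix t assume t: "t \<in> nsets {..<n} 3"
    then have "card (t \<inter> S) \<le> 1 \<or> card (t \<inter> S) = 2 \<or> card (t \<inter> S) = 3" using le[of t] by linarith
    then show "t \<in> Int3 \<union> (TS \<union> TO)" using t by (auto simp: TS I TO_def)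
  qed (auto simp: TS I TO_def)
  show "Int3 \<inter> (TS \<union> TO) = {}" "TS \<inter> TO = {}" by (auto simp: TS I TO_def)
qed

lemma random_subset_TS:
  "random_subset TS r = map_pmf TSof (Pi_pmf In {} (\<lambda>_. random_subset Ap r))"
  unfolding TS_def TSof_def
proof (rule random_subset_UN_image)
  show "inj_on (\<lambda>v. insert v e) Ap" if "e \<in> In" for e
    using InD[OF that] by (auto simp: inj_on_def Ap_def)
  show "(\<lambda>v. insert v e) ` Ap \<inter> (\<lambda>v. insert v d) ` Ap = {}" if "e \<in> In" "d \<in> In" "e \<noteq> d" for e d
  proof -
    have "insert v e \<inter> S = e" "insert v d \<inter> S = d" if "v \<in> Ap" for v
      using that InD \<open>e \<in> In\<close> \<open>d \<in> In\<close> by (auto simp: Ap_def)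
    then show ?thesis using that by auto metis+
  qed
qed simp_all

lemma random_subset_TS_TO:
  "random_subset (TS \<union> TO) r = bind_pmf (Pi_pmf In {} (\<lambda>_. random_subset Ap r))
     (\<lambda>h. map_pmf (\<lambda>T. TSof h \<union> T) (random_subset TO r))"
  using triangles_split by (simp add: random_subset_union random_subset_TS bind_map_pmf)

lemma random_subset_triangles:
  "random_subset (nsets {..<n} 3) r = bind_pmf (random_subset Int3 r) (\<lambda>TI.
     map_pmf (\<lambda>T. TI \<union> T) (random_subset (TS \<union> TO) r))"
  using triangles_split by (simp add: random_subset_union)

lemma ER_split: "ER n r = bind_pmf (random_subset In r) (\<lambda>s. map_pmf (\<lambda>X. s \<union> X) (random_subset Out r))"
proof -
  have "nsets {..<n} 2 = In \<union> Out" using nsets_mono[OF S] by (auto simp: Out_def)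
  then have "ER n r = random_subset (In \<union> Out) r" by (simp add: ER_def)
  also have "\<dots> = bind_pmf (random_subset In r) (\<lambda>s. map_pmf (\<lambda>X. s \<union> X) (random_subset Out r))"
    by (rule random_subset_union) (simp, simp, auto simp: Out_def)
  finally show ?thesis .
qed

lemma Pi_Ap: "h \<in> set_pmf (Pi_pmf In {} Q) \<Longrightarrow> (\<And>e. e \<in> In \<Longrightarrow> set_pmf (Q e) \<subseteq> Pow Ap) \<Longrightarrow> e \<in> In \<Longrightarrow> h e \<subseteq> Ap"
  by (auto simp: set_Pi_pmf PiE_dflt_def)

text \<open>The bound of \<open>d_TV_random_blocks\<close> for independent apexes of probability
  \<open>p'\<close>, where \<open>C = 1\<close>, with \<open>n\<close> in place of
  \<open>card Ap\<close>. It is of order \<open>p' * sqrt n\<close> when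
  \<open>n * p'\<^sup>2\<close> is small.\<close>

definition "gap = sqrt ((1 + (1 / p\<^sup>2 - 1) * p'\<^sup>2) ^ n - 1)"

text \<open>Wedges over one base are disjoint, but wedges over two bases that share a vertex can
  share an edge, so \<open>d_TV_random_blocks\<close> is applied to one base at a time. Adding the
  wedges of the next base does not increase the distance accumulated so far, and the errors add up
  over the bases.\<close>

lemma d_TV_wedges:
  assumes Q: "\<And>e. e \<in> In \<Longrightarrow> set_pmf (Q e) \<subseteq> Pow Ap" and C: "0 \<le> C"
    and dom: "\<And>e A. e \<in> In \<Longrightarrow> A \<subseteq> Ap \<Longrightarrow> A \<noteq> {} \<Longrightarrow> measure_pmf.prob (Q e) {V. A \<subseteq> V} \<le> C * p' ^ card A"
  shows "d_TV (bind_pmf (Pi_pmf In {} Q) (\<lambda>h. map_pmf (\<lambda>X. X \<union> wedges h) (random_subset Out p)))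
      (random_subset Out p) \<le> card In * (C * gap)"
proof -
  define \<pi> where "\<pi> = random_subset Out p"
  define W where "W I h = (\<Union>e\<in>I. \<Union>v\<in>h e. wedge e v)" for I and h :: "nat set \<Rightarrow> nat set"
  have one: "d_TV (bind_pmf (Q e) (\<lambda>V. map_pmf (\<lambda>X. X \<union> (\<Union>v\<in>V. wedge e v)) \<pi>)) \<pi> \<le> C * gap"
    if e: "e \<in> In" for e
  proof -
    have c0: "0 \<le> (1 / p\<^sup>2 - 1) * p'\<^sup>2" using p by (simp add: power_le_one)
    have "d_TV (bind_pmf (Q e) (\<lambda>V. map_pmf (\<lambda>X. X \<union> (\<Union>v\<in>V. wedge e v)) \<pi>)) \<pi>
       \<le> C * sqrt ((1 + (1 / p\<^sup>2 - 1) * p'\<^sup>2) ^ card Ap - 1)"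
      unfolding \<pi>_def using p p' C dom[OF e] Q[OF e] wedge_props[OF e]
      by (intro d_TV_random_blocks) auto
    also have "\<dots> \<le> C * gap"
    proof -
      have "card Ap \<le> n" using card_mono[of "{..<n}" Ap] by (simp add: Ap_def)
      then show ?thesis unfolding gap_def using c0 C
        by (intro mult_left_mono real_sqrt_le_mono diff_right_mono power_increasing) auto
    qed
    finally show ?thesis .
  qed
  have "d_TV (bind_pmf (Pi_pmf I {} Q) (\<lambda>h. map_pmf (\<lambda>X. X \<union> W I h) \<pi>)) \<pi> \<le> card I * (C * gap)"
    if "finite I" "I \<subseteq> In" for I
    using that
  proof (induction I rule: finite_induct)
    case empty
    then show ?case by (simp add: W_def bind_return_pmf)
  next
    case (insert e I)
    let ?f = "\<lambda>V Y. Y \<union> (\<Union>v\<in>V. wedge e v)"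
    let ?\<mu> = "bind_pmf (Pi_pmf I {} Q) (\<lambda>h. map_pmf (\<lambda>X. X \<union> W I h) \<pi>)"
    have *: "W (insert e I) (h(e := V)) = W I h \<union> (\<Union>v\<in>V. wedge e v)" for h V
    proof -
      have "W I (h(e := V)) = W I h"
        unfolding W_def using insert.hyps by (intro SUP_cong refl) auto
      then show ?thesis by (auto simp: W_def)
    qed
    have "bind_pmf (Pi_pmf (insert e I) {} Q) (\<lambda>h. map_pmf (\<lambda>X. X \<union> W (insert e I) h) \<pi>)
        = bind_pmf (Q e) (\<lambda>V. map_pmf (?f V) ?\<mu>)"
      using insert.hyps by (simp add: Pi_pmf_insert' bind_assoc_pmf bind_return_pmf map_bind_pmf
          pmf.map_comp o_def * Un_assoc del: fun_upd_apply)
    then have "d_TV (bind_pmf (Pi_pmf (insert e I) {} Q) (\<lambda>h. map_pmf (\<lambda>X. X \<union> W (insert e I) h) \<pi>)) \<pi>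
      \<le> d_TV (bind_pmf (Q e) (\<lambda>V. map_pmf (?f V) ?\<mu>)) (bind_pmf (Q e) (\<lambda>V. map_pmf (?f V) \<pi>))
        + d_TV (bind_pmf (Q e) (\<lambda>V. map_pmf (?f V) \<pi>)) \<pi>"
      using d_TV_triangle by simp
    also have "\<dots> \<le> card I * (C * gap) + C * gap"
      using insert.prems
      by (intro add_mono d_TV_bind_right order_trans[OF d_TV_map_left] insert.IH one) auto
    finally show ?case using insert.hyps by (simp add: algebra_simps)
  qed
  from this[of In] show ?thesis by (simp add: W_def wedges_def \<pi>_def)
qed

end

subsection \<open>Conditioning and Bayes inverses\<close>

text \<open>Disintegration: resampling \<open>x\<close> given its image restores the law of
  \<open>x\<close>. In this form the posterior recovers the prior from the observation.\<close>

lemma bind_map_cond_pmf: "bind_pmf (map_pmf f \<mu>) (\<lambda>y. cond_pmf \<mu> {x. f x = y}) = \<mu>"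
proof (rule bind_cond_pmf_cancel)
  fix y x assume "f x = y"
  then show "measure_pmf.prob \<mu> {x. f x = y} = measure_pmf.prob (map_pmf f \<mu>) {y. f x = y}"
    by (auto intro!: arg_cong2[where f = measure])
qed auto

lemma pmf_bind_disjoint:
  assumes "\<And>t. t \<in> set_pmf \<alpha> \<Longrightarrow> t \<noteq> s \<Longrightarrow> \<omega> \<notin> set_pmf (E t)"
  shows "pmf (bind_pmf \<alpha> E) \<omega> = pmf \<alpha> s * pmf (E s) \<omega>"
proof -
  have "pmf (bind_pmf \<alpha> E) \<omega> = measure_pmf.expectation \<alpha> (\<lambda>t. pmf (E t) \<omega>)" by (rule pmf_bind)
  also have "\<dots> = measure_pmf.expectation \<alpha> (\<lambda>t. indicator {s} t * pmf (E s) \<omega>)"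
    by (rule integral_cong_AE)
      (use assms in \<open>auto simp: AE_measure_pmf_iff indicator_def set_pmf_iff\<close>)
  also have "\<dots> = pmf \<alpha> s * pmf (E s) \<omega>" by (simp add: measure_pmf_single)
  finally show ?thesis .
qed

text \<open>
  If the observation \<open>\<phi> \<omega>\<close> determines the component \<open>s\<close> of a mixture, then the Bayes inverse of
  the mixture also inverts each component. This lets one kernel, which does not know \<open>s\<close> nor the
  law of \<open>s\<close>, act correctly under any other mixing law.
\<close>

lemma bind_cond_pmf_component:
  assumes s: "s \<in> set_pmf \<alpha>"
    and l: "\<And>t \<omega>. t \<in> set_pmf \<alpha> \<Longrightarrow> \<omega> \<in> set_pmf (E t) \<Longrightarrow> l (\<phi> \<omega>) = t"
  shows "bind_pmf (map_pmf \<phi> (E s)) (\<lambda>g. cond_pmf (bind_pmf \<alpha> E) {\<omega>. \<phi> \<omega> = g}) = E s"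
proof -
  let ?J = "bind_pmf \<alpha> E"
  have "cond_pmf ?J {\<omega>. \<phi> \<omega> = g} = cond_pmf (E s) {\<omega>. \<phi> \<omega> = g}"
    if g: "g \<in> set_pmf (map_pmf \<phi> (E s))" for g
  proof -
    have ne: "set_pmf (E s) \<inter> {\<omega>. \<phi> \<omega> = g} \<noteq> {}" using g by auto
    then have neJ: "set_pmf ?J \<inter> {\<omega>. \<phi> \<omega> = g} \<noteq> {}" using s by auto
    have lg: "l g = s" using g l[OF s] by auto
    have *: "pmf ?J \<omega> = pmf \<alpha> s * pmf (E s) \<omega>" if "\<phi> \<omega> = g" for \<omega>
      by (rule pmf_bind_disjoint) (use that l lg in auto)
    show ?thesis
      by (rule pmf_eq_if_proportional[where c = "pmf \<alpha> s * measure_pmf.prob (E s) {\<omega>. \<phi> \<omega> = g}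
            / measure_pmf.prob ?J {\<omega>. \<phi> \<omega> = g}"])
        (use measure_measure_pmf_not_zero[OF ne] in \<open>simp add: pmf_cond[OF ne] pmf_cond[OF neJ] *\<close>)
  qed
  then have "bind_pmf (map_pmf \<phi> (E s)) (\<lambda>g. cond_pmf ?J {\<omega>. \<phi> \<omega> = g})
    = bind_pmf (map_pmf \<phi> (E s)) (\<lambda>g. cond_pmf (E s) {\<omega>. \<phi> \<omega> = g})"
    by (intro bind_pmf_cong refl) auto
  then show ?thesis by (simp add: bind_map_cond_pmf)
qed

lemma pmf_bool_False: "pmf \<mu> False = 1 - pmf \<mu> True"
proof -
  have "(\<Sum>b\<in>{False, True}. pmf \<mu> b) = 1" by (rule sum_pmf_eq_1) auto
  then show ?thesis by simp
qed

lemma bernoulli_eqI: "pmf \<mu> True = r \<Longrightarrow> \<mu> = bernoulli_pmf r"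
proof (rule pmf_eqI)
  fix b assume "pmf \<mu> True = r"
  moreover from this have "0 \<le> r" "r \<le> 1" using pmf_nonneg pmf_le_1 by metis+
  ultimately show "pmf \<mu> b = pmf (bernoulli_pmf r) b"
    by (cases b) (auto simp: pmf_bool_False)
qed

lemma Pi_pmf_pair:
  assumes "finite A"
  shows "Pi_pmf A (d, d') (\<lambda>x. pair_pmf (f x) (g x))
    = bind_pmf (Pi_pmf A d f) (\<lambda>a. map_pmf (\<lambda>b x. (a x, b x)) (Pi_pmf A d' g))"
proof -
  have "Pi_pmf A (d, d') (\<lambda>x. pair_pmf (f x) (g x))
    = bind_pmf (Pi_pmf A d f) (\<lambda>a. Pi_pmf A (d, d') (\<lambda>x. bind_pmf (g x) (\<lambda>y. return_pmf (a x, y))))"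
    unfolding pair_pmf_def by (rule Pi_pmf_bind[OF assms])
  also have "\<dots> = bind_pmf (Pi_pmf A d f) (\<lambda>a. bind_pmf (Pi_pmf A d' g)
      (\<lambda>b. Pi_pmf A (d, d') (\<lambda>x. return_pmf (a x, b x))))"
    by (intro bind_pmf_cong refl Pi_pmf_bind assms)
  also have "\<dots> = bind_pmf (Pi_pmf A d f) (\<lambda>a. map_pmf (\<lambda>b x. (a x, b x)) (Pi_pmf A d' g))"
    unfolding map_pmf_def
  proof (intro bind_pmf_cong refl)
    fix a b assume "a \<in> set_pmf (Pi_pmf A d f)" "b \<in> set_pmf (Pi_pmf A d' g)"
    then have "\<forall>x. x \<notin> A \<longrightarrow> a x = d" "\<forall>x. x \<notin> A \<longrightarrow> b x = d'"
      using set_Pi_pmf_subset[OF assms] by fast+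
    then show "Pi_pmf A (d, d') (\<lambda>x. return_pmf (a x, b x)) = return_pmf (\<lambda>x. (a x, b x))"
      using assms by (auto simp: fun_eq_iff)
  qed
  finally show ?thesis .
qed

subsection \<open>Planted graphs before and after adding triangles\<close>

context planted begin

text \<open>
  An edge slot inside \<open>S\<close> carries its initial bit together with the set of apexes of the
  triangles through it; \<open>M \<theta> b\<close> is the law of this pair given that the final bit is \<open>b\<close>.
\<close>

definition "D \<theta> = pair_pmf (bernoulli_pmf \<theta>) (random_subset Ap p')"
definition obs :: "bool \<times> nat set \<Rightarrow> bool" where "obs x \<longleftrightarrow> fst x \<or> snd x \<noteq> {}"
definition "dens \<theta> = 1 - (1 - \<theta>) * (1 - p') ^ card Ap"
definition "M \<theta> b = cond_pmf (D \<theta>) {x. obs x = b}"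

lemma dens_bounds:
  assumes "0 < \<theta>" "\<theta> < 1"
  shows "\<theta> \<le> dens \<theta>" "dens \<theta> < 1" "0 < dens \<theta>"
proof -
  have c: "(1 - p') ^ card Ap \<le> 1" "0 < (1 - p') ^ card Ap" using p' by (auto simp: power_le_one)
  have "(1 - \<theta>) * (1 - p') ^ card Ap \<le> 1 - \<theta>" using assms c by (intro mult_left_le) auto
  moreover have "0 < (1 - \<theta>) * (1 - p') ^ card Ap" using assms c by simp
  moreover obtain x where x: "(1 - \<theta>) * (1 - p') ^ card Ap = x" by blast
  ultimately show "\<theta> \<le> dens \<theta>" "dens \<theta> < 1" "0 < dens \<theta>"
    using assms unfolding dens_def x by auto
qed

lemma map_obs_D:
  assumes "0 < \<theta>" "\<theta> < 1"
  shows "map_pmf obs (D \<theta>) = bernoulli_pmf (dens \<theta>)"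
proof (rule bernoulli_eqI)
  have "obs x = False \<longleftrightarrow> x = (False, {})" for x by (cases x) (simp add: obs_def)
  then have "obs -` {False} = {(False, {})}" unfolding vimage_def by simp
  then have "pmf (map_pmf obs (D \<theta>)) False = measure_pmf.prob (D \<theta>) {(False, {})}"
    by (simp only: pmf_map)
  also have "\<dots> = (1 - \<theta>) * (1 - p') ^ card Ap"
    using assms p' by (simp add: measure_pmf_single D_def pmf_pair pmf_random_subset)
  finally show "pmf (map_pmf obs (D \<theta>)) True = dens \<theta>" by (simp add: dens_def pmf_bool_False)
qed

lemma set_pmf_D:
  assumes "0 < \<theta>" "\<theta> < 1"
  shows "set_pmf (D \<theta>) \<inter> {x. obs x = b} \<noteq> {}"
proof -
  have "pmf (random_subset Ap p') {} \<noteq> 0" using p' by (simp add: pmf_random_subset)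
  then have "(b, {}) \<in> set_pmf (D \<theta>)" using assms by (simp add: D_def set_pmf_iff)
  then show ?thesis by (auto simp: obs_def)
qed

lemma set_pmf_M:
  assumes "0 < \<theta>" "\<theta> < 1" "x \<in> set_pmf (M \<theta> b)"
  shows "obs x = b" "snd x \<subseteq> Ap"
  using assms set_pmf_D[OF assms(1,2), of b]
  by (auto simp: M_def D_def dest!: random_subset_subsetD)

lemma bind_M:
  assumes "0 < \<theta>" "\<theta> < 1"
  shows "bind_pmf (bernoulli_pmf (dens \<theta>)) (M \<theta>) = D \<theta>"
  using bind_map_cond_pmf[of obs "D \<theta>"] map_obs_D[OF assms] by (simp add: M_def[abs_def])

text \<open>An absent final bit forces an absent initial bit, and a present one was there initially
  with probability \<open>\<theta> / dens \<theta>\<close>. With \<theta> the ambient density this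
  thinning is the map \<open>g\<close>.\<close>

lemma map_fst_M:
  assumes "0 < \<theta>" "\<theta> < 1"
  shows "map_pmf fst (M \<theta> b) = (if b then bernoulli_pmf (\<theta> / dens \<theta>) else return_pmf False)"
proof (cases b)
  case True
  have "pmf (map_pmf fst (M \<theta> b)) True = measure_pmf.prob (D \<theta>) {x. obs x \<and> fst x} / measure_pmf.prob (D \<theta>) {x. obs x}"
    unfolding pmf_map M_def cond_pmf.rep_eq[OF set_pmf_D[OF assms]]
    using True measure_measure_pmf_not_zero[OF set_pmf_D[OF assms, of True]]
    by (subst measure_uniform_measure)
      (auto simp: measure_pmf.emeasure_eq_measure vimage_def intro!: arg_cong2[where f = measure] arg_cong2[where f = "(/)"])
  also have "measure_pmf.prob (D \<theta>) {x. obs x} = pmf (map_pmf obs (D \<theta>)) True"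
    by (simp add: pmf_map vimage_def)
  also have "\<dots> = dens \<theta>" using dens_bounds[OF assms] by (simp add: map_obs_D[OF assms])
  also have "measure_pmf.prob (D \<theta>) {x. obs x \<and> fst x} = pmf (map_pmf fst (D \<theta>)) True"
    unfolding pmf_map by (rule arg_cong2[where f = measure]) (auto simp: obs_def)
  also have "\<dots> = \<theta>" using assms by (simp add: D_def map_fst_pair_pmf)
  finally show ?thesis using True by (simp add: bernoulli_eqI)
next
  case False
  have "map_pmf fst (M \<theta> b) = map_pmf (\<lambda>_. False) (M \<theta> b)"
    by (rule map_pmf_cong) (use False in \<open>auto dest!: set_pmf_M(1)[OF assms] simp: obs_def\<close>)
  then show ?thesis using False by simp
qed

text \<open>A nonempty apex set already makes the edge present, so conditioning on presence only
  divides by \<open>dens \<theta>\<close>, which is at least \<theta>; given absence there are no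
  apexes at all. This is the domination required by \<open>d_TV_wedges\<close>, with
  \<open>C = 1 / \<theta>\<close>.\<close>

lemma prob_snd_M:
  assumes "0 < \<theta>" "\<theta> < 1" "A \<subseteq> Ap" "A \<noteq> {}"
  shows "measure_pmf.prob (map_pmf snd (M \<theta> b)) {V. A \<subseteq> V} \<le> 1 / \<theta> * p' ^ card A"
proof (cases b)
  case True
  have "measure_pmf.prob (map_pmf snd (M \<theta> b)) {V. A \<subseteq> V}
      = measure_pmf.prob (D \<theta>) {x. obs x \<and> A \<subseteq> snd x} / measure_pmf.prob (D \<theta>) {x. obs x}"
    unfolding M_def measure_map_pmf cond_pmf.rep_eq[OF set_pmf_D[OF assms(1,2)]]
    using True measure_measure_pmf_not_zero[OF set_pmf_D[OF assms(1,2), of True]]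
    by (subst measure_uniform_measure)
      (auto simp: measure_pmf.emeasure_eq_measure vimage_def intro!: arg_cong2[where f = measure] arg_cong2[where f = "(/)"])
  also have "measure_pmf.prob (D \<theta>) {x. obs x} = pmf (map_pmf obs (D \<theta>)) True"
    by (simp add: pmf_map vimage_def)
  also have "\<dots> = dens \<theta>" using dens_bounds[OF assms(1,2)] by (simp add: map_obs_D[OF assms(1,2)])
  also have "measure_pmf.prob (D \<theta>) {x. obs x \<and> A \<subseteq> snd x} = measure_pmf.prob (map_pmf snd (D \<theta>)) {V. A \<subseteq> V}"
    unfolding measure_map_pmf by (rule arg_cong2[where f = measure]) (use assms in \<open>auto simp: obs_def\<close>)
  also have "\<dots> = p' ^ card A" using assms p'
    by (simp add: D_def map_snd_pair_pmf prob_subset_random_subset)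
  also have "p' ^ card A / dens \<theta> \<le> p' ^ card A / \<theta>"
    using assms p' dens_bounds[OF assms(1,2)] by (intro divide_left_mono) auto
  finally show ?thesis by simp
next
  case False
  have "measure_pmf.prob (map_pmf snd (M \<theta> b)) {V. A \<subseteq> V} = 0"
    using assms False by (auto simp: measure_pmf_zero_iff obs_def dest!: set_pmf_M(1)[OF assms(1,2)])
  then show ?thesis using assms p' by simp
qed

lemma map_snd_Pi: "map_pmf (\<lambda>z e. snd (z e)) (Pi_pmf In (False, {}) Q) = Pi_pmf In {} (\<lambda>e. map_pmf snd (Q e))"
  using Pi_pmf_map[of In snd "(False, {})" "{}" Q] by (simp add: o_def)

definition "rest s Y = map_pmf (\<lambda>T. s \<union> Y \<union> cover T) (random_subset TO p')"
text \<open>The reference law with which both planted models are compared: of the added triangles,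
  only those without a side inside \<open>S\<close> remain, so the inner edges are independent of
  all others.\<close>

definition "base r = bind_pmf (random_subset In r) (\<lambda>s. bind_pmf (random_subset Out p) (rest s))"

text \<open>Planting erases everything that the triangles did inside \<open>S\<close>. The triangles
  of \<open>TS\<close> then act only through their wedges, with independent apex sets, and those of
  \<open>Int3\<close> not at all.\<close>

lemma plant_RGT_base: "d_TV (bind_pmf (RGT n p p') (plant_at S r)) (base r) \<le> card In * gap"
proof -
  let ?Q = "Pi_pmf In {} (\<lambda>_. random_subset Ap p')"
  let ?L = "bind_pmf ?Q (\<lambda>h. map_pmf (\<lambda>X. X \<union> wedges h) (random_subset Out p))"
  have "bind_pmf (RGT n p p') (plant_at S r)
      = bind_pmf (random_subset In p) (\<lambda>s0. bind_pmf (random_subset Out p) (\<lambda>X.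
         bind_pmf (random_subset Int3 p') (\<lambda>TI. bind_pmf ?Q (\<lambda>h. bind_pmf (random_subset TO p') (\<lambda>T.
         bind_pmf (random_subset In r) (\<lambda>H. return_pmf (((s0 \<union> X \<union> cover (TI \<union> (TSof h \<union> T))) - In) \<union> H)))))))"
    unfolding RGT_eq_add_triangles add_triangles_def ER_split random_subset_triangles
      random_subset_TS_TO plant_at_def
    by (simp add: bind_assoc_pmf bind_map_pmf map_bind_pmf pmf.map_comp o_def)
      (simp add: map_pmf_def)
  also have "\<dots> = bind_pmf (random_subset In p) (\<lambda>s0. bind_pmf (random_subset Out p) (\<lambda>X.
         bind_pmf (random_subset Int3 p') (\<lambda>TI. bind_pmf ?Q (\<lambda>h. bind_pmf (random_subset TO p') (\<lambda>T.
         bind_pmf (random_subset In r) (\<lambda>H. return_pmf (H \<union> (X \<union> wedges h) \<union> cover T)))))))"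
  proof (intro bind_pmf_cong refl arg_cong[where f = return_pmf], goal_cases)
    case (1 s0 X TI h T H)
    have h: "h e \<subseteq> Ap" if "e \<in> In" for e
      by (rule Pi_Ap[OF 1(4) _ that]) (rule set_pmf_random_subset)
    have "cover (TI \<union> (TSof h \<union> T)) - In = wedges h \<union> cover T"
      using cover_TSof[of h, OF h] wedges_subset[of h, OF h] cover_TO[OF random_subset_subsetD[OF 1(5)]]
        cover_Int[OF random_subset_subsetD[OF 1(3)]]
      by (auto simp: cover_Un Out_def)
    moreover have "s0 \<subseteq> In" by (rule random_subset_subsetD[OF 1(1)])
    moreover have "X \<inter> In = {}" using random_subset_subsetD[OF 1(2)] by (auto simp: Out_def)
    ultimately show ?case by auto
  qed
  also have "\<dots> = bind_pmf (random_subset Out p) (\<lambda>X. bind_pmf ?Q (\<lambda>h. bind_pmf (random_subset TO p') (\<lambda>T.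
         bind_pmf (random_subset In r) (\<lambda>H. return_pmf (H \<union> (X \<union> wedges h) \<union> cover T)))))"
    by simp
  also have "\<dots> = bind_pmf (random_subset In r) (\<lambda>H. bind_pmf ?L (rest H))"
    unfolding bind_commute_pmf[of "random_subset TO p'" "random_subset In r"]
      bind_commute_pmf[of ?Q "random_subset In r"]
      bind_commute_pmf[of "random_subset Out p" "random_subset In r"]
      bind_commute_pmf[of "random_subset Out p" ?Q]
    by (simp add: rest_def bind_assoc_pmf bind_map_pmf map_pmf_def bind_return_pmf)
  finally have "d_TV (bind_pmf (RGT n p p') (plant_at S r)) (base r)
      \<le> d_TV ?L (random_subset Out p)"
    unfolding base_def by (auto intro!: d_TV_bind_right d_TV_bind_left)
  also have "\<dots> \<le> card In * (1 * gap)"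
    using p' set_pmf_random_subset by (intro d_TV_wedges) (auto simp: prob_subset_random_subset)
  finally show ?thesis by simp
qed

definition "slots \<theta> s = Pi_pmf In (False, {}) (\<lambda>e. M \<theta> (s e))"

text \<open>The law of the final graph, without triangles inside \<open>S\<close>, given that the
  final inner edges are \<open>s\<close> and that the inner edges initially had density
  \<theta>.\<close>

definition "blend \<theta> s = bind_pmf (slots \<theta> s) (\<lambda>z. bind_pmf (random_subset Out p)
  (\<lambda>X. rest {e \<in> In. obs (z e)} (X \<union> wedges (\<lambda>e. snd (z e)))))"

lemma slots_props:
  assumes "0 < \<theta>" "\<theta> < 1" "z \<in> set_pmf (slots \<theta> s)" "e \<in> In"
  shows "obs (z e) = s e" "snd (z e) \<subseteq> Ap"
proof -
  have "z e \<in> set_pmf (M \<theta> (s e))" using assms by (auto simp: slots_def set_Pi_pmf PiE_dflt_def)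
  then show "obs (z e) = s e" "snd (z e) \<subseteq> Ap" using set_pmf_M[OF assms(1,2)] by auto
qed

text \<open>For a fixed pattern \<open>s\<close> the inner edges agree in both laws and only the
  wedges have to be hidden. As this works for each \<open>s\<close>, the density \<open>r\<close> of
  the final pattern is independent of \<theta>: adding triangles takes \<open>\<theta> = q\<close>
  and \<open>r = dens q\<close>, whereas the inverse takes \<open>\<theta> = p\<close> and
  \<open>r = q\<close>.\<close>

lemma d_TV_blend:
  assumes "0 < \<theta>" "\<theta> < 1"
  shows "d_TV (bind_pmf (Pi_pmf In False (\<lambda>_. bernoulli_pmf r)) (blend \<theta>)) (base r) \<le> card In * (gap / \<theta>)"
proof -
  have base: "base r = bind_pmf (Pi_pmf In False (\<lambda>_. bernoulli_pmf r))
      (\<lambda>s. bind_pmf (random_subset Out p) (rest {e \<in> In. s e}))"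
    by (simp add: base_def random_subset_def[of In] bind_map_pmf)
  have "d_TV (blend \<theta> s) (bind_pmf (random_subset Out p) (rest {e \<in> In. s e})) \<le> card In * (1 / \<theta> * gap)" for s
  proof -
    let ?Q = "Pi_pmf In {} (\<lambda>e. map_pmf snd (M \<theta> (s e)))"
    have "blend \<theta> s = bind_pmf (slots \<theta> s) (\<lambda>z. bind_pmf (random_subset Out p)
        (\<lambda>X. rest {e \<in> In. s e} (X \<union> wedges (\<lambda>e. snd (z e)))))"
      unfolding blend_def
      by (intro bind_pmf_cong refl arg_cong2[where f = rest] Collect_cong conj_cong)
        (auto simp: slots_props[OF assms])
    also have "\<dots> = bind_pmf (map_pmf (\<lambda>z e. snd (z e)) (slots \<theta> s)) (\<lambda>h. bind_pmf (random_subset Out p)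
        (\<lambda>X. rest {e \<in> In. s e} (X \<union> wedges h)))"
      by (simp add: bind_map_pmf)
    also have "\<dots> = bind_pmf (bind_pmf ?Q (\<lambda>h. map_pmf (\<lambda>X. X \<union> wedges h) (random_subset Out p)))
        (rest {e \<in> In. s e})"
      by (simp add: slots_def map_snd_Pi bind_assoc_pmf bind_map_pmf)
    finally have "d_TV (blend \<theta> s) (bind_pmf (random_subset Out p) (rest {e \<in> In. s e}))
      \<le> d_TV (bind_pmf ?Q (\<lambda>h. map_pmf (\<lambda>X. X \<union> wedges h) (random_subset Out p))) (random_subset Out p)"
      by (simp add: d_TV_bind_left)
    also have "\<dots> \<le> card In * (1 / \<theta> * gap)"
    proof (rule d_TV_wedges)
      show "set_pmf (map_pmf snd (M \<theta> (s e))) \<subseteq> Pow Ap" for e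
        using set_pmf_M(2)[OF assms] by auto
    qed (use assms prob_snd_M in auto)
    finally show ?thesis .
  qed
  then show ?thesis unfolding base by (intro d_TV_bind_right) simp
qed

lemma bind_slots:
  assumes "0 < \<theta>" "\<theta> < 1"
  shows "bind_pmf (Pi_pmf In False (\<lambda>_. bernoulli_pmf (dens \<theta>))) (slots \<theta>)
    = Pi_pmf In (False, {}) (\<lambda>_. D \<theta>)"
  unfolding slots_def bind_M[OF assms, symmetric] by (rule Pi_pmf_bind[symmetric]) simp

lemma bind_slots_D:
  "bind_pmf (Pi_pmf In (False, {}) (\<lambda>_. D \<theta>)) f = bind_pmf (random_subset In \<theta>) (\<lambda>s0.
     bind_pmf (Pi_pmf In {} (\<lambda>_. random_subset Ap p')) (\<lambda>h. f (\<lambda>e. (e \<in> s0, h e))))"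
proof -
  have "bind_pmf (Pi_pmf In (False, {}) (\<lambda>_. D \<theta>)) f
    = bind_pmf (Pi_pmf In False (\<lambda>_. bernoulli_pmf \<theta>)) (\<lambda>a.
       bind_pmf (Pi_pmf In {} (\<lambda>_. random_subset Ap p')) (\<lambda>h. f (\<lambda>e. (a e, h e))))"
    unfolding D_def by (simp add: Pi_pmf_pair bind_assoc_pmf bind_map_pmf)
  also have "\<dots> = bind_pmf (random_subset In \<theta>) (\<lambda>s0.
     bind_pmf (Pi_pmf In {} (\<lambda>_. random_subset Ap p')) (\<lambda>h. f (\<lambda>e. (e \<in> s0, h e))))"
    unfolding random_subset_eq_Collect[OF fin(1)] by (simp add: bind_map_pmf)
  finally show ?thesis .
qed

lemma bind_ER_plant_at:
  "bind_pmf (ER n p) (plant_at S q)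
    = bind_pmf (random_subset In q) (\<lambda>H. map_pmf (\<lambda>X. H \<union> X) (random_subset Out p))"
proof -
  have "bind_pmf (ER n p) (plant_at S q) = bind_pmf (random_subset In p) (\<lambda>s. bind_pmf (random_subset Out p) (\<lambda>X.
      bind_pmf (random_subset In q) (\<lambda>H. return_pmf (((s \<union> X) - In) \<union> H))))"
    by (simp add: ER_split plant_at_def map_pmf_def bind_assoc_pmf bind_return_pmf)
  also have "\<dots> = bind_pmf (random_subset In p) (\<lambda>s. bind_pmf (random_subset Out p) (\<lambda>X.
      bind_pmf (random_subset In q) (\<lambda>H. return_pmf (H \<union> X))))"
  proof (intro bind_pmf_cong refl arg_cong[where f = return_pmf], goal_cases)
    case (1 s X H)
    then show ?case using random_subset_subsetD[OF 1(1)] random_subset_subsetD[OF 1(2)]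
      by (auto simp: Out_def)
  qed
  also have "\<dots> = bind_pmf (random_subset In q) (\<lambda>H. bind_pmf (random_subset Out p) (\<lambda>X. return_pmf (H \<union> X)))"
    by (simp add: bind_commute_pmf[of "random_subset Out p" "random_subset In q"])
  finally show ?thesis by (simp add: map_pmf_def)
qed

text \<open>The first error term removes the triangles inside \<open>S\<close>. Afterwards the slots
  are independent with law \<open>D q\<close>; drawing the final bits first, with density
  \<open>dens q\<close>, turns the graph into a mixture of the laws
  \<open>blend q s\<close>.\<close>

lemma add_triangles_base:
  assumes "0 < q" "q < 1"
  shows "d_TV (bind_pmf (bind_pmf (ER n p) (plant_at S q)) (add_triangles n p')) (base (dens q))
    \<le> card Int3 * p' + card In * (gap / q)"
proof -
  let ?Q = "Pi_pmf In {} (\<lambda>_. random_subset Ap p')"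
  let ?G = "bind_pmf (ER n p) (plant_at S q)"
  have "d_TV (bind_pmf ?G (add_triangles n p')) (bind_pmf ?G (\<lambda>G. map_pmf (\<lambda>T. G \<union> cover T) (random_subset (TS \<union> TO) p')))
      \<le> card Int3 * p'"
  proof (rule d_TV_bind_right)
    fix G
    let ?f = "\<lambda>TI. map_pmf (\<lambda>T. G \<union> cover (TI \<union> T)) (random_subset (TS \<union> TO) p')"
    have "add_triangles n p' G = bind_pmf (random_subset Int3 p') ?f"
      by (simp add: add_triangles_def random_subset_triangles map_bind_pmf pmf.map_comp o_def)
    moreover have "map_pmf (\<lambda>T. G \<union> cover T) (random_subset (TS \<union> TO) p')
        = bind_pmf (random_subset Int3 p') (\<lambda>TI. ?f {})"
      by simp
    ultimately have "d_TV (add_triangles n p' G) (map_pmf (\<lambda>T. G \<union> cover T) (random_subset (TS \<union> TO) p'))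
      \<le> measure_pmf.prob (random_subset Int3 p') {TI. ?f TI \<noteq> ?f {}}"
      using d_TV_bind_disagree[of "random_subset Int3 p'" ?f "\<lambda>TI. ?f {}"] by simp
    also have "\<dots> \<le> measure_pmf.prob (random_subset Int3 p') {TI. TI \<inter> Int3 \<noteq> {}}"
    proof (rule measure_pmf.finite_measure_mono_AE)
      have "TI = {}" if "TI \<in> set_pmf (random_subset Int3 p')" "TI \<inter> Int3 = {}" for TI
        using that random_subset_subsetD by blast
      then show "AE TI in random_subset Int3 p'. TI \<in> {TI. ?f TI \<noteq> ?f {}} \<longrightarrow> TI \<in> {TI. TI \<inter> Int3 \<noteq> {}}"
        unfolding AE_measure_pmf_iff by blast
    qed simp
    also have "\<dots> \<le> card Int3 * p'" using p' by (intro prob_random_subset_meets) auto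
    finally show "d_TV (add_triangles n p' G) (map_pmf (\<lambda>T. G \<union> cover T) (random_subset (TS \<union> TO) p')) \<le> card Int3 * p'" .
  qed
  moreover have "bind_pmf ?G (\<lambda>G. map_pmf (\<lambda>T. G \<union> cover T) (random_subset (TS \<union> TO) p'))
      = bind_pmf (Pi_pmf In False (\<lambda>_. bernoulli_pmf (dens q))) (blend q)"
  proof -
    have "bind_pmf ?G (\<lambda>G. map_pmf (\<lambda>T. G \<union> cover T) (random_subset (TS \<union> TO) p'))
      = bind_pmf (random_subset In q) (\<lambda>s0. bind_pmf (random_subset Out p) (\<lambda>X. bind_pmf ?Q (\<lambda>h.
         bind_pmf (random_subset TO p') (\<lambda>T. return_pmf (s0 \<union> X \<union> cover (TSof h \<union> T))))))"
      unfolding bind_ER_plant_at random_subset_TS_TO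
      by (simp add: map_pmf_def bind_assoc_pmf bind_return_pmf)
    also have "\<dots> = bind_pmf (random_subset In q) (\<lambda>s0. bind_pmf ?Q (\<lambda>h. bind_pmf (random_subset Out p) (\<lambda>X.
         bind_pmf (random_subset TO p') (\<lambda>T. return_pmf (s0 \<union> X \<union> cover (TSof h \<union> T))))))"
      by (simp only: bind_commute_pmf[of "random_subset Out p" ?Q])
    also have "\<dots> = bind_pmf (random_subset In q) (\<lambda>s0. bind_pmf ?Q (\<lambda>h. bind_pmf (random_subset Out p) (\<lambda>X.
         bind_pmf (random_subset TO p') (\<lambda>T. return_pmf ({e \<in> In. obs (e \<in> s0, h e)} \<union> (X \<union> wedges h) \<union> cover T)))))"
    proof (intro bind_pmf_cong refl arg_cong[where f = return_pmf], goal_cases)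
      case (1 s0 h X T)
      have h: "h e \<subseteq> Ap" if "e \<in> In" for e
        by (rule Pi_Ap[OF 1(2) _ that]) (rule set_pmf_random_subset)
      have "s0 \<subseteq> In" using 1(1) by (rule random_subset_subsetD)
      then show ?case using cover_TSof[of h, OF h] by (auto simp: cover_Un obs_def)
    qed
    also have "\<dots> = bind_pmf (Pi_pmf In (False, {}) (\<lambda>_. D q)) (\<lambda>z. bind_pmf (random_subset Out p)
        (\<lambda>X. rest {e \<in> In. obs (z e)} (X \<union> wedges (\<lambda>e. snd (z e)))))"
      unfolding bind_slots_D by (simp add: rest_def map_pmf_def)
    also have "\<dots> = bind_pmf (Pi_pmf In False (\<lambda>_. bernoulli_pmf (dens q))) (blend q)"
      unfolding bind_slots[OF assms, symmetric] blend_def[abs_def] by (simp add: bind_assoc_pmf)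
    finally show ?thesis .
  qed
  ultimately show ?thesis
    using d_TV_blend[OF assms, of "dens q"] d_TV_triangle[of "bind_pmf ?G (add_triangles n p')" "base (dens q)"
        "bind_pmf (Pi_pmf In False (\<lambda>_. bernoulli_pmf (dens q))) (blend q)"] by simp
qed

theorem d_TV_add_triangles_plant:
  assumes "0 < q" "q < 1"
  shows "d_TV (bind_pmf (bind_pmf (ER n p) (plant_at S q)) (add_triangles n p'))
      (bind_pmf (RGT n p p') (plant_at S (dens q)))
    \<le> card Int3 * p' + card In * (gap / q) + card In * gap"
  using add_triangles_base[OF assms] plant_RGT_base[of "dens q"]
    d_TV_triangle[of "bind_pmf (bind_pmf (ER n p) (plant_at S q)) (add_triangles n p')"
      "bind_pmf (RGT n p p') (plant_at S (dens q))" "base (dens q)"]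
  unfolding d_TV_commute[of "base (dens q)"] by linarith

text \<open>Without the triangles of \<open>Int3\<close> the final state of an inner edge is a
  function of its own slot and is visible in \<open>G\<close>. It can therefore serve as the label
  of the component in \<open>bind_cond_pmf_component\<close>.\<close>

definition "inverse_kernel G = map_pmf fst (cond_pmf (pair_pmf (ER n p) (random_subset (TS \<union> TO) p'))
  {x. fst x \<union> cover (snd x) = G})"

theorem d_TV_inverse_kernel_plant:
  assumes "0 < q" "q < 1"
  shows "d_TV (bind_pmf (bind_pmf (RGT n p p') (plant_at S q)) inverse_kernel)
      (bind_pmf (ER n p) (plant_at S (q * (p / dens p))))
    \<le> card In * gap + card In * (gap / p)"
proof -
  define \<alpha> where "\<alpha> r = Pi_pmf In False (\<lambda>_. bernoulli_pmf r)" for r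
  define E where "E s = bind_pmf (slots p s) (\<lambda>z. bind_pmf (random_subset Out p)
    (\<lambda>X. map_pmf (\<lambda>T. (z, X, T)) (random_subset TO p')))" for s
  define \<gamma> where "\<gamma> = (\<lambda>(z, X, T). ({e \<in> In. fst (z e)} \<union> X, TSof (\<lambda>e. snd (z e)) \<union> T))"
  define \<phi> where "\<phi> \<omega> = fst (\<gamma> \<omega>) \<union> cover (snd (\<gamma> \<omega>))" for \<omega>
  let ?\<beta> = "dens p"
  have \<phi>: "\<phi> (z, X, T) = {e \<in> In. obs (z e)} \<union> (X \<union> wedges (\<lambda>e. snd (z e))) \<union> cover T"
    if "z \<in> set_pmf (slots p s)" for z X T s
  proof -
    have "cover (TSof (\<lambda>e. snd (z e))) = {e \<in> In. snd (z e) \<noteq> {}} \<union> wedges (\<lambda>e. snd (z e))"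
      by (rule cover_TSof) (rule slots_props(2)[OF p that])
    then show ?thesis by (auto simp: \<phi>_def \<gamma>_def cover_Un obs_def)
  qed
  have blend: "map_pmf \<phi> (E s) = blend p s" for s
    unfolding E_def blend_def rest_def map_bind_pmf pmf.map_comp o_def
    by (intro bind_pmf_cong refl map_pmf_cong) (simp add: \<phi>)
  \<comment> \<open>Wedges, noise and the triangles of \<open>TO\<close> stay in \<open>Out\<close>,
    so the trace of the observed graph on \<open>In\<close> is exactly the pattern
    \<open>s\<close>.\<close>
  have label: "(\<lambda>e. e \<in> In \<and> e \<in> \<phi> \<omega>) = s"
    if s: "s \<in> set_pmf (\<alpha> r)" and \<omega>: "\<omega> \<in> set_pmf (E s)" for r s \<omega>
  proof -
    obtain z X T where zXT: "\<omega> = (z, X, T)" "z \<in> set_pmf (slots p s)" "X \<subseteq> Out" "T \<subseteq> TO"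
      using \<omega> by (auto simp: E_def dest!: random_subset_subsetD)
    have "wedges (\<lambda>e. snd (z e)) \<subseteq> Out"
      using wedges_subset[of "\<lambda>e. snd (z e)"] slots_props(2)[OF p zXT(2)] by blast
    moreover have "cover T \<subseteq> Out" by (rule cover_TO[OF zXT(4)])
    ultimately have "e \<in> In \<and> e \<in> \<phi> \<omega> \<longleftrightarrow> e \<in> In \<and> s e" for e
      using \<phi>[OF zXT(2)] zXT slots_props(1)[OF p zXT(2)] by (auto simp: Out_def)
    moreover have "\<not> s e" if "e \<notin> In" for e
      using s that set_Pi_pmf_subset[OF fin(1)] by (fastforce simp: \<alpha>_def)
    ultimately show ?thesis by (auto simp: fun_eq_iff)
  qed
  \<comment> \<open>The component lemma asks only that a pattern has positive probability under the
    ambient mixture. Every pattern has, as \<open>dens p\<close> lies strictly between 0 and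
    1.\<close>
  have \<alpha>: "set_pmf (\<alpha> q) \<subseteq> set_pmf (\<alpha> ?\<beta>)"
    using dens_bounds[OF p] assms by (auto simp: \<alpha>_def set_Pi_pmf PiE_dflt_def)
  \<comment> \<open>With final density \<open>dens p\<close> the mixture is the unplanted model
    itself, so the conditioning inside \<open>inverse_kernel\<close> is the conditioning of the
    mixture.\<close>
  have joint: "map_pmf \<gamma> (bind_pmf (\<alpha> ?\<beta>) E) = pair_pmf (ER n p) (random_subset (TS \<union> TO) p')"
  proof -
    let ?Q = "Pi_pmf In {} (\<lambda>_. random_subset Ap p')"
    have "map_pmf \<gamma> (bind_pmf (\<alpha> ?\<beta>) E) = bind_pmf (Pi_pmf In (False, {}) (\<lambda>_. D p)) (\<lambda>z.
        bind_pmf (random_subset Out p) (\<lambda>X. bind_pmf (random_subset TO p') (\<lambda>T. return_pmf (\<gamma> (z, X, T)))))"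
      unfolding bind_slots[OF p, symmetric] \<alpha>_def E_def
      by (simp add: bind_assoc_pmf map_bind_pmf map_pmf_def bind_return_pmf)
    also have "\<dots> = bind_pmf (random_subset In p) (\<lambda>s. bind_pmf ?Q (\<lambda>h. bind_pmf (random_subset Out p) (\<lambda>X.
        bind_pmf (random_subset TO p') (\<lambda>T. return_pmf ({e \<in> In. e \<in> s} \<union> X, TSof h \<union> T)))))"
      unfolding bind_slots_D by (simp add: \<gamma>_def)
    also have "\<dots> = bind_pmf (random_subset In p) (\<lambda>s. bind_pmf ?Q (\<lambda>h. bind_pmf (random_subset Out p) (\<lambda>X.
        bind_pmf (random_subset TO p') (\<lambda>T. return_pmf (s \<union> X, TSof h \<union> T)))))"
    proof (intro bind_pmf_cong refl, goal_cases)
      case (1 s h X T)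
      have "{e \<in> In. e \<in> s} = s" using random_subset_subsetD[OF 1(1)] by auto
      then show ?case by simp
    qed
    also have "\<dots> = pair_pmf (ER n p) (random_subset (TS \<union> TO) p')"
      unfolding bind_commute_pmf[of ?Q "random_subset Out p"]
      by (simp add: pair_pmf_def ER_split random_subset_TS_TO map_pmf_def bind_assoc_pmf bind_return_pmf)
    finally show ?thesis .
  qed
  have K: "inverse_kernel G = map_pmf (fst \<circ> \<gamma>) (cond_pmf (bind_pmf (\<alpha> ?\<beta>) E) {\<omega>. \<phi> \<omega> = G})"
    if "G \<in> set_pmf (map_pmf \<phi> (E s))" "s \<in> set_pmf (\<alpha> ?\<beta>)" for G s
  proof -
    have "set_pmf (bind_pmf (\<alpha> ?\<beta>) E) \<inter> {\<omega>. \<phi> \<omega> = G} \<noteq> {}" using that by auto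
    then show ?thesis
      unfolding inverse_kernel_def joint[symmetric]
      by (subst cond_map_pmf) (simp_all add: \<phi>_def pmf.map_comp)
  qed
  have inv: "bind_pmf (blend p s) inverse_kernel = map_pmf (fst \<circ> \<gamma>) (E s)" if s: "s \<in> set_pmf (\<alpha> q)" for s
  proof -
    have s': "s \<in> set_pmf (\<alpha> ?\<beta>)" using s \<alpha> by auto
    have "bind_pmf (blend p s) inverse_kernel
      = map_pmf (fst \<circ> \<gamma>) (bind_pmf (map_pmf \<phi> (E s)) (\<lambda>g. cond_pmf (bind_pmf (\<alpha> ?\<beta>) E) {\<omega>. \<phi> \<omega> = g}))"
      unfolding blend[symmetric] map_bind_pmf using K[OF _ s'] by (intro bind_pmf_cong refl) auto
    also have "bind_pmf (map_pmf \<phi> (E s)) (\<lambda>g. cond_pmf (bind_pmf (\<alpha> ?\<beta>) E) {\<omega>. \<phi> \<omega> = g}) = E s"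
      by (rule bind_cond_pmf_component[where l = "\<lambda>G e. e \<in> In \<and> e \<in> G"]) (use s' label in auto)
    finally show ?thesis .
  qed
  have "bind_pmf (bind_pmf (\<alpha> q) (blend p)) inverse_kernel
      = bind_pmf (\<alpha> q) (\<lambda>s. map_pmf (fst \<circ> \<gamma>) (E s))"
    by (simp add: bind_assoc_pmf inv cong: bind_pmf_cong)
  also have "\<dots> = bind_pmf (map_pmf (\<lambda>z e. fst (z e)) (bind_pmf (\<alpha> q) (slots p)))
      (\<lambda>b. map_pmf (\<lambda>X. {e \<in> In. b e} \<union> X) (random_subset Out p))"
    by (simp add: E_def \<gamma>_def map_bind_pmf bind_assoc_pmf bind_map_pmf pmf.map_comp o_def)
      (simp add: map_pmf_def)
  also have "map_pmf (\<lambda>z e. fst (z e)) (bind_pmf (\<alpha> q) (slots p))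
      = Pi_pmf In False (\<lambda>_. bernoulli_pmf (q * (p / ?\<beta>)))"
  proof -
    have "map_pmf (\<lambda>z e. fst (z e)) (slots p s) = Pi_pmf In False (\<lambda>e. map_pmf fst (M p (s e)))" for s
      unfolding slots_def using Pi_pmf_map[of In fst "(False, {})" False "\<lambda>e. M p (s e)"] by (simp add: o_def)
    then have "map_pmf (\<lambda>z e. fst (z e)) (bind_pmf (\<alpha> q) (slots p))
      = Pi_pmf In False (\<lambda>_. bind_pmf (bernoulli_pmf q) (\<lambda>b. map_pmf fst (M p b)))"
      unfolding map_bind_pmf \<alpha>_def by (simp add: Pi_pmf_bind[OF fin(1), where d' = False])
    moreover have "bind_pmf (bernoulli_pmf q) (\<lambda>b. map_pmf fst (M p b)) = bernoulli_pmf (q * (p / ?\<beta>))"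
    proof (rule bernoulli_eqI)
      have "0 \<le> p / ?\<beta>" "p / ?\<beta> \<le> 1" using dens_bounds[OF p] p by auto
      then show "pmf (bind_pmf (bernoulli_pmf q) (\<lambda>b. map_pmf fst (M p b))) True = q * (p / ?\<beta>)"
        using assms by (simp add: pmf_bind map_fst_M[OF p])
    qed
    ultimately show ?thesis by simp
  qed
  also have "bind_pmf \<dots> (\<lambda>b. map_pmf (\<lambda>X. {e \<in> In. b e} \<union> X) (random_subset Out p))
      = bind_pmf (ER n p) (plant_at S (q * (p / ?\<beta>)))"
    unfolding bind_ER_plant_at by (simp add: random_subset_def[of In] bind_map_pmf)
  finally have "d_TV (bind_pmf (bind_pmf (RGT n p p') (plant_at S q)) inverse_kernel)
      (bind_pmf (ER n p) (plant_at S (q * (p / ?\<beta>))))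
    \<le> d_TV (bind_pmf (RGT n p p') (plant_at S q)) (bind_pmf (\<alpha> q) (blend p))"
    using d_TV_bind_left by metis
  also have "\<dots> \<le> card In * gap + card In * (gap / p)"
    using plant_RGT_base[of q] d_TV_blend[OF p, of q]
      d_TV_triangle[of "bind_pmf (RGT n p p') (plant_at S q)" "bind_pmf (\<alpha> q) (blend p)" "base q"]
    unfolding d_TV_commute[of "base q"] \<alpha>_def by linarith
  finally show ?thesis .
qed

end

subsection \<open>The posterior of the added triangles\<close>

definition resample :: "real \<Rightarrow> graph \<Rightarrow> graph \<Rightarrow> graph pmf" where
  "resample p U G = map_pmf (\<lambda>H. (G - U) \<union> H) (random_subset U p)"

lemma pmf_resample:
  assumes "finite U" "p \<in> {0..1}" "U \<subseteq> G"
  shows "pmf (resample p U G) G0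
    = (if G0 \<union> U = G then p ^ card (G0 \<inter> U) * (1 - p) ^ card (U - G0) else 0)"
proof -
  have "pmf (resample p U G) G0 = measure_pmf.prob (random_subset U p) {H. (G - U) \<union> H = G0}"
    by (simp add: resample_def pmf_map vimage_def)
  also have "\<dots> = measure_pmf.prob (random_subset U p) (if G0 \<union> U = G then {G0 \<inter> U} else {})"
  proof (rule measure_pmf.finite_measure_eq_AE)
    show "AE H in random_subset U p. (H \<in> {H. (G - U) \<union> H = G0})
        = (H \<in> (if G0 \<union> U = G then {G0 \<inter> U} else {}))"
      unfolding AE_measure_pmf_iff
    proof
      fix H assume "H \<in> set_pmf (random_subset U p)"
      then have "H \<subseteq> U" by (rule random_subset_subsetD)
      then have "(G - U) \<union> H = G0 \<longleftrightarrow> G0 \<union> U = G \<and> H = G0 \<inter> U"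
        using assms(3) by blast
      then show "(H \<in> {H. (G - U) \<union> H = G0}) = (H \<in> (if G0 \<union> U = G then {G0 \<inter> U} else {}))"
        by simp
    qed
  qed auto
  also have "\<dots> = (if G0 \<union> U = G then p ^ card (G0 \<inter> U) * (1 - p) ^ card (U - G0) else 0)"
  proof -
    have "U - G0 \<inter> U = U - G0" by blast
    then show ?thesis using assms by (simp add: measure_pmf_single pmf_random_subset)
  qed
  finally show ?thesis .
qed

lemma pmf_bind_map_Pair: "pmf (bind_pmf \<mu> (\<lambda>x. map_pmf (Pair x) (f x))) (x, y) = pmf \<mu> x * pmf (f x) y"
proof -
  have "pmf (bind_pmf \<mu> (\<lambda>x. map_pmf (Pair x) (f x))) (x, y) = pmf \<mu> x * pmf (map_pmf (Pair x) (f x)) (x, y)"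
    by (rule pmf_bind_disjoint) auto
  also have "pmf (map_pmf (Pair x) (f x)) (x, y) = pmf (f x) y"
    by (rule pmf_map_inj') (auto simp: inj_def)
  finally show ?thesis .
qed

context noisy_graph begin

abbreviation "pairs \<equiv> nsets {..<n} 2"
abbreviation "triples \<equiv> nsets {..<n} 3"

definition "posterior \<Omega> G = cond_pmf (pair_pmf (ER n p) (random_subset \<Omega> p')) {x. fst x \<union> cover (snd x) = G}"
definition "triangle_law \<Omega> G = map_pmf snd (posterior \<Omega> G)"
text \<open>Posterior weight of \<open>T\<close> up to normalisation. The prior gives the power of
  the odds \<open>p' / (1 - p')\<close>; the likelihood gains \<open>1 / p\<close> for each covered
  edge, which the initial graph no longer has to contain.\<close>

definition "gibbs_weight G T = (if cover T \<subseteq> G then (p' / (1 - p')) ^ card T / p ^ card (cover T) else 0)"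

lemma finite_triples: "\<Omega> \<subseteq> triples \<Longrightarrow> finite \<Omega>"
  by (rule finite_subset) (auto intro: finite_imp_finite_nsets)

lemma finite_pairs: "G \<subseteq> pairs \<Longrightarrow> finite G"
  by (rule finite_subset) (auto intro: finite_imp_finite_nsets)

lemma posterior_support:
  assumes "\<Omega> \<subseteq> triples" "G \<subseteq> pairs"
  shows "set_pmf (pair_pmf (ER n p) (random_subset \<Omega> p')) \<inter> {x. fst x \<union> cover (snd x) = G} \<noteq> {}"
proof -
  have "G \<in> set_pmf (ER n p)"
    unfolding ER_def using p assms by (subst set_pmf_random_subset_eq) (auto intro: finite_imp_finite_nsets)
  moreover have "{} \<in> set_pmf (random_subset \<Omega> p')"
    using p' finite_triples[OF assms(1)] by (simp add: set_pmf_iff pmf_random_subset)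
  ultimately have "(G, {}) \<in> set_pmf (pair_pmf (ER n p) (random_subset \<Omega> p')) \<inter> {x. fst x \<union> cover (snd x) = G}"
    by (simp add: cover_def)
  then show ?thesis by blast
qed

lemma pmf_triangle_law':
  assumes "\<Omega> \<subseteq> triples" "G \<subseteq> pairs"
  shows "pmf (triangle_law \<Omega> G) T = pmf (random_subset \<Omega> p') T *
    (if cover T \<subseteq> G then pmf (ER n p) G / p ^ card (cover T) else 0)
    / measure_pmf.prob (pair_pmf (ER n p) (random_subset \<Omega> p')) {x. fst x \<union> cover (snd x) = G}"
proof -
  let ?J = "pair_pmf (ER n p) (random_subset \<Omega> p')" and ?B = "{x. fst x \<union> cover (snd x) = G}"
  note ne = posterior_support[OF assms]
  have J: "map_pmf (\<lambda>x. (snd x, fst x \<union> cover (snd x))) ?J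
      = bind_pmf (random_subset \<Omega> p') (\<lambda>T. map_pmf (Pair T) (map_pmf (\<lambda>G0. G0 \<union> cover T) (ER n p)))"
    unfolding pair_pmf_def map_bind_pmf pmf.map_comp
    by (subst bind_commute_pmf) (simp add: map_pmf_def bind_return_pmf)
  have "measure_pmf.prob ?J ({x. snd x = T} \<inter> ?B)
      = pmf (map_pmf (\<lambda>x. (snd x, fst x \<union> cover (snd x))) ?J) (T, G)"
    unfolding pmf_map by (rule arg_cong2[where f = measure]) auto
  also have "\<dots> = pmf (random_subset \<Omega> p') T * pmf (map_pmf (\<lambda>G0. G0 \<union> cover T) (ER n p)) G"
    unfolding J by (rule pmf_bind_map_Pair)
  also have "\<dots> = pmf (random_subset \<Omega> p') T *
      (if cover T \<subseteq> G then pmf (ER n p) G / p ^ card (cover T) else 0)"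
  proof (cases "T \<subseteq> \<Omega>")
    case True
    then have "cover T \<subseteq> pairs" using assms cover_subset by blast
    then show ?thesis using p unfolding ER_def
      by (subst pmf_random_subset_Un) (auto intro: finite_imp_finite_nsets)
  next
    case False
    then show ?thesis using p' finite_triples[OF assms(1)] by (simp add: pmf_random_subset)
  qed
  finally have num: "measure_pmf.prob ?J ({x. snd x = T} \<inter> ?B) = \<dots>" .
  have "pmf (triangle_law \<Omega> G) T = measure (cond_pmf ?J ?B) {x. snd x = T}"
    by (simp add: triangle_law_def posterior_def pmf_map vimage_def)
  also have "\<dots> = measure_pmf.prob ?J ({x. snd x = T} \<inter> ?B) / measure_pmf.prob ?J ?B"
    unfolding cond_pmf.rep_eq[OF ne] using measure_measure_pmf_not_zero[OF ne]
    by (subst measure_uniform_measure) (auto simp: measure_pmf.emeasure_eq_measure Int_commute)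
  finally show ?thesis using num by simp
qed

lemma pmf_triangle_law:
  assumes "\<Omega> \<subseteq> triples" "G \<subseteq> pairs"
  obtains c where "0 < c" "\<And>T. pmf (triangle_law \<Omega> G) T = (if T \<subseteq> \<Omega> then c * gibbs_weight G T else 0)"
proof
  let ?Z = "measure_pmf.prob (pair_pmf (ER n p) (random_subset \<Omega> p')) {x. fst x \<union> cover (snd x) = G}"
  let ?c = "(1 - p') ^ card \<Omega> * pmf (ER n p) G / ?Z"
  note ne = posterior_support[OF assms]
  have "0 < ?Z" using ne measure_measure_pmf_not_zero[OF ne] by (simp add: zero_less_measure_iff)
  moreover have "0 < pmf (ER n p) G"
    using p assms(2) finite_pairs[of pairs] unfolding ER_def by (simp add: pmf_random_subset)
  ultimately show "0 < ?c" using p' by simp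
  show "pmf (triangle_law \<Omega> G) T = (if T \<subseteq> \<Omega> then ?c * gibbs_weight G T else 0)" for T
  proof (cases "T \<subseteq> \<Omega>")
    case True
    have fin: "finite \<Omega>" "finite T" using True finite_triples[OF assms(1)] finite_subset by auto
    have "p' ^ card T * (1 - p') ^ card (\<Omega> - T) = (1 - p') ^ card \<Omega> * (p' / (1 - p')) ^ card T"
    proof -
      have "(1 - p') ^ card \<Omega> = (1 - p') ^ card (\<Omega> - T) * (1 - p') ^ card T"
        using True fin card_mono[OF fin(1) True] by (simp add: card_Diff_subset flip: power_add)
      then show ?thesis using p' by (simp add: power_divide)
    qed
    then show ?thesis using True fin p'
      by (simp add: pmf_triangle_law'[OF assms] pmf_random_subset gibbs_weight_def)
  qed (use p' finite_triples[OF assms(1)] in \<open>simp add: pmf_triangle_law'[OF assms] pmf_random_subset\<close>)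
qed

text \<open>Given \<open>T\<close>, the edges outside \<open>cover T\<close> are read off from
  \<open>G\<close>, and the covered ones keep their independent prior law because \<open>G\<close>
  says nothing about them.\<close>

lemma posterior_eq:
  assumes "\<Omega> \<subseteq> triples" "G \<subseteq> pairs"
  shows "posterior \<Omega> G = bind_pmf (triangle_law \<Omega> G) (\<lambda>T. map_pmf (\<lambda>G0. (G0, T)) (resample p (cover T) G))"
proof (rule pmf_eqI)
  fix x :: "graph \<times> nat set set"
  obtain G0 T where x: "x = (G0, T)" by (cases x)
  let ?J = "pair_pmf (ER n p) (random_subset \<Omega> p')" and ?B = "{x. fst x \<union> cover (snd x) = G}"
  note ne = posterior_support[OF assms]
  have "pmf (bind_pmf (triangle_law \<Omega> G) (\<lambda>T. map_pmf (\<lambda>G0. (G0, T)) (resample p (cover T) G))) (G0, T)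
      = pmf (triangle_law \<Omega> G) T * pmf (map_pmf (\<lambda>G0. (G0, T)) (resample p (cover T) G)) (G0, T)"
    by (rule pmf_bind_disjoint) auto
  also have "pmf (map_pmf (\<lambda>G0. (G0, T)) (resample p (cover T) G)) (G0, T) = pmf (resample p (cover T) G) G0"
    by (rule pmf_map_inj') (auto simp: inj_def)
  finally have rhs: "pmf (bind_pmf (triangle_law \<Omega> G) (\<lambda>T. map_pmf (\<lambda>G0. (G0, T)) (resample p (cover T) G))) (G0, T)
      = pmf (triangle_law \<Omega> G) T * pmf (resample p (cover T) G) G0" .
  have lhs: "pmf (posterior \<Omega> G) (G0, T)
      = (if G0 \<union> cover T = G then pmf (ER n p) G0 * pmf (random_subset \<Omega> p') T / measure_pmf.prob ?J ?B else 0)"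
    by (simp add: posterior_def pmf_cond[OF ne] pmf_pair)
  show "pmf (posterior \<Omega> G) x
      = pmf (bind_pmf (triangle_law \<Omega> G) (\<lambda>T. map_pmf (\<lambda>G0. (G0, T)) (resample p (cover T) G))) x"
  proof (cases "T \<subseteq> \<Omega>")
    case False
    then have "pmf (random_subset \<Omega> p') T = 0" using p' finite_triples[OF assms(1)] by (simp add: pmf_random_subset)
    then show ?thesis unfolding x lhs rhs by (simp add: pmf_triangle_law'[OF assms])
  next
    case T: True
    let ?U = "cover T"
    show ?thesis
    proof (cases "G0 \<union> ?U = G")
      case True
      have fin: "finite G" "finite ?U" "finite G0" using True finite_pairs[OF assms(2)] by auto
      have P: "finite pairs" by (rule finite_pairs) simp
      have 1: "card G = card (G0 - ?U) + card ?U" "card G0 = card (G0 - ?U) + card (G0 \<inter> ?U)"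
      proof -
        have "G = (G0 - ?U) \<union> ?U" "(G0 - ?U) \<inter> ?U = {}" using True by blast+
        then show "card G = card (G0 - ?U) + card ?U" using fin card_Un_disjoint[of "G0 - ?U" ?U] by simp
        have "G0 = (G0 - ?U) \<union> (G0 \<inter> ?U)" "(G0 - ?U) \<inter> (G0 \<inter> ?U) = {}" by blast+
        then show "card G0 = card (G0 - ?U) + card (G0 \<inter> ?U)"
          using fin card_Un_disjoint[of "G0 - ?U" "G0 \<inter> ?U"] by simp
      qed
      have 2: "card (pairs - G0) = card (pairs - G) + card (?U - G0)"
      proof -
        have "pairs - G0 = (pairs - G) \<union> (?U - G0)" using True assms(2) by blast
        moreover have "(pairs - G) \<inter> (?U - G0) = {}" using True by blast
        ultimately show ?thesis using P fin by (simp add: card_Un_disjoint)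
      qed
      have eq: "pmf (ER n p) G / p ^ card ?U * (p ^ card (G0 \<inter> ?U) * (1 - p) ^ card (?U - G0)) = pmf (ER n p) G0"
        using True assms(2) P p unfolding ER_def
        by (subst (1 2) pmf_random_subset) (auto simp: 1 2 power_add)
      have "?U \<subseteq> G" using True by blast
      then show ?thesis
        using True p fin unfolding x lhs rhs
        by (simp add: pmf_triangle_law'[OF assms] pmf_resample) (simp add: eq[symmetric] mult_ac)
    next
      case False
      then show ?thesis
      proof (cases "?U \<subseteq> G")
        case True
        have "finite ?U" using True finite_pairs[OF assms(2)] finite_subset by blast
        then show ?thesis using False True p unfolding x lhs rhs by (simp add: pmf_resample)
      next
        case Uf: False
        then show ?thesis using False unfolding x lhs rhs by (simp add: pmf_triangle_law'[OF assms])
      qed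
    qed
  qed
qed

text \<open>Inserting \<open>t\<close> is injective on sets avoiding \<open>t\<close> and multiplies
  the weight by at most the bound: one factor of odds, and at most three newly covered
  edges.\<close>

lemma prob_triangle_law_mem:
  assumes "\<Omega> \<subseteq> triples" "G \<subseteq> pairs" and t: "t \<in> \<Omega>"
  shows "measure_pmf.prob (triangle_law \<Omega> G) {T. t \<in> T} \<le> p' / (1 - p') / p ^ 3"
proof -
  obtain c where c: "0 < c" "\<And>T. pmf (triangle_law \<Omega> G) T = (if T \<subseteq> \<Omega> then c * gibbs_weight G T else 0)"
    using pmf_triangle_law[OF assms(1,2)] by blast
  let ?\<epsilon> = "p' / (1 - p') / p ^ 3"
  have fin: "finite \<Omega>" by (rule finite_triples[OF assms(1)])
  have e0: "0 \<le> ?\<epsilon>" using p p' by simp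
  have w: "gibbs_weight G (insert t T) \<le> ?\<epsilon> * gibbs_weight G T" if T: "T \<subseteq> \<Omega>" "t \<notin> T" for T
  proof (cases "cover (insert t T) \<subseteq> G")
    case True
    have ct: "cover (insert t T) = nsets t 2 \<union> cover T" by (auto simp: cover_def)
    have "finite T" using T fin finite_subset by blast
    have ft: "finite t" "card t = 3" using t assms(1) by (auto simp: nsets_def)
    have fG: "finite (cover (insert t T))" using True finite_pairs[OF assms(2)] finite_subset by blast
    have "card (nsets t 2) = 3"
    proof -
      have "card (nsets t 2) = card t choose 2" unfolding nsets_def using n_subsets[OF ft(1), of 2] ft(1)
        by (metis (mono_tags, lifting) Collect_cong finite_subset)
      also have "\<dots> = 3" using ft by (simp add: choose_two)
      finally show ?thesis .
    qed
    then have "card (cover (insert t T)) \<le> card (cover T) + 3"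
      unfolding ct using card_Un_le[of "nsets t 2" "cover T"] by simp
    then have "p ^ (card (cover T) + 3) \<le> p ^ card (cover (insert t T))"
      using p by (intro power_decreasing) auto
    then have "1 / p ^ card (cover (insert t T)) \<le> 1 / (p ^ 3 * p ^ card (cover T))"
      using p by (intro divide_left_mono) (auto simp: power_add mult.commute)
    then have "(p' / (1 - p')) ^ Suc (card T) * (1 / p ^ card (cover (insert t T)))
        \<le> (p' / (1 - p')) ^ Suc (card T) * (1 / (p ^ 3 * p ^ card (cover T)))"
      using p' by (intro mult_left_mono) auto
    then show ?thesis using True ct T \<open>finite T\<close> by (simp add: gibbs_weight_def field_simps)
  next
    case False
    then show ?thesis using e0 p p' by (simp add: gibbs_weight_def)
  qed
  let ?\<pi> = "triangle_law \<Omega> G"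
  have sub: "{T \<in> Pow \<Omega>. t \<in> T} = insert t ` Pow (\<Omega> - {t})"
  proof (intro equalityI subsetI)
    fix T assume "T \<in> {T \<in> Pow \<Omega>. t \<in> T}"
    then show "T \<in> insert t ` Pow (\<Omega> - {t})" by (intro image_eqI[of _ _ "T - {t}"]) auto
  qed (use t in auto)
  have supp: "set_pmf ?\<pi> \<subseteq> Pow \<Omega>" by (auto simp: set_pmf_iff c(2) split: if_splits)
  have "measure_pmf.prob ?\<pi> {T. t \<in> T} = measure_pmf.prob ?\<pi> {T \<in> Pow \<Omega>. t \<in> T}"
    using supp by (intro measure_pmf.finite_measure_eq_AE) (auto simp: AE_measure_pmf_iff)
  also have "\<dots> = (\<Sum>T\<in>insert t ` Pow (\<Omega> - {t}). pmf ?\<pi> T)"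
    unfolding sub using fin by (intro measure_measure_pmf_finite) auto
  also have "\<dots> = (\<Sum>T\<in>Pow (\<Omega> - {t}). pmf ?\<pi> (insert t T))"
    by (rule sum.reindex_cong[OF _ refl refl]) (auto simp: inj_on_def)
  also have "\<dots> \<le> (\<Sum>T\<in>Pow (\<Omega> - {t}). ?\<epsilon> * pmf ?\<pi> T)"
  proof (rule sum_mono)
    fix T assume "T \<in> Pow (\<Omega> - {t})"
    then have T: "T \<subseteq> \<Omega>" "t \<notin> T" "insert t T \<subseteq> \<Omega>" using t by auto
    have "c * gibbs_weight G (insert t T) \<le> c * (?\<epsilon> * gibbs_weight G T)"
      using c(1) w[OF T(1,2)] by (intro mult_left_mono) auto
    then show "pmf ?\<pi> (insert t T) \<le> ?\<epsilon> * pmf ?\<pi> T" using T by (simp add: c(2) mult_ac)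
  qed
  also have "\<dots> = ?\<epsilon> * measure_pmf.prob ?\<pi> (Pow (\<Omega> - {t}))"
    using fin by (simp add: measure_measure_pmf_finite sum_distrib_left)
  also have "\<dots> \<le> ?\<epsilon> * 1" using e0 by (intro mult_left_mono) auto
  finally show ?thesis by simp
qed

text \<open>Forbidding the triangles of \<open>B\<close> a priori is the same as conditioning the
  posterior on containing none of them, so the cost is a union bound over \<open>B\<close>.\<close>

lemma d_TV_posterior_Diff:
  assumes "\<Omega> \<subseteq> triples" "G \<subseteq> pairs" "B \<subseteq> \<Omega>"
  shows "d_TV (posterior \<Omega> G) (posterior (\<Omega> - B) G) \<le> card B * (p' / (1 - p') / p ^ 3)"
proof -
  let ?E = "{x. snd x \<inter> B = {}} :: (graph \<times> nat set set) set" and ?B = "{x. fst x \<union> cover (snd x) = G}"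
  let ?J = "\<lambda>\<Omega>. pair_pmf (ER n p) (random_subset \<Omega> p')"
  have fin: "finite \<Omega>" "finite B" using assms finite_triples by (auto intro: finite_subset)
  have sub: "\<Omega> - B \<subseteq> triples" using assms by auto
  note ne = posterior_support[OF assms(1,2)] and ne' = posterior_support[OF sub assms(2)]
  have \<kappa>: "pmf (random_subset (\<Omega> - B) p') T * (1 - p') ^ card B
      = (if T \<inter> B = {} then pmf (random_subset \<Omega> p') T else 0)" for T
  proof (cases "T \<subseteq> \<Omega> - B")
    case True
    then have "\<Omega> - T = (\<Omega> - B - T) \<union> B" using assms(3) by blast
    moreover have "(\<Omega> - B - T) \<inter> B = {}" by blast
    ultimately have "card (\<Omega> - T) = card (\<Omega> - B - T) + card B"
      using fin card_Un_disjoint[of "\<Omega> - B - T" B] by simp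
    moreover have "T \<subseteq> \<Omega>" "T \<inter> B = {}" using True by auto
    ultimately show ?thesis using True fin p' by (simp add: pmf_random_subset power_add)
  next
    case False
    then show ?thesis using fin p' by (auto simp: pmf_random_subset)
  qed
  have neE: "set_pmf (posterior \<Omega> G) \<inter> ?E \<noteq> {}"
  proof -
    have "(G, {}) \<in> set_pmf (?J \<Omega>)"
      using p p' assms(2) fin finite_pairs[of pairs]
      by (simp add: ER_def set_pmf_iff pmf_random_subset pmf_pair)
    moreover have "cover {} = {}" by (simp add: cover_def)
    ultimately have "(G, {}) \<in> set_pmf (posterior \<Omega> G) \<inter> ?E"
      unfolding posterior_def set_cond_pmf[OF ne] by simp
    then show ?thesis by blast
  qed
  have "cond_pmf (posterior \<Omega> G) ?E = posterior (\<Omega> - B) G"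
  proof (rule pmf_eq_if_proportional)
    fix x
    let ?Z = "measure_pmf.prob (?J \<Omega>) ?B" and ?Z' = "measure_pmf.prob (?J (\<Omega> - B)) ?B"
      and ?Y = "measure_pmf.prob (posterior \<Omega> G) ?E" and ?k = "(1 - p') ^ card B"
    have J: "pmf (?J (\<Omega> - B)) x * ?k = (if x \<in> ?E then pmf (?J \<Omega>) x else 0)"
    proof -
      have "pmf (?J (\<Omega> - B)) x * ?k = pmf (ER n p) (fst x) * (pmf (random_subset (\<Omega> - B) p') (snd x) * ?k)"
        by (cases x) (simp add: pmf_pair)
      also have "\<dots> = (if x \<in> ?E then pmf (?J \<Omega>) x else 0)"
        unfolding \<kappa> by (cases x) (simp add: pmf_pair)
      finally show ?thesis .
    qed
    have Z': "?Z' \<noteq> 0" by (rule measure_measure_pmf_not_zero[OF ne'])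
    have "pmf (cond_pmf (posterior \<Omega> G) ?E) x = (if x \<in> ?E \<and> x \<in> ?B then pmf (?J \<Omega>) x / ?Z / ?Y else 0)"
      unfolding pmf_cond[OF neE] by (simp add: posterior_def pmf_cond[OF ne])
    also have "\<dots> = (if x \<in> ?B then pmf (?J (\<Omega> - B)) x * ?k / ?Z / ?Y else 0)"
      unfolding J by auto
    also have "\<dots> = (?k * ?Z' / ?Z / ?Y) * (if x \<in> ?B then pmf (?J (\<Omega> - B)) x / ?Z' else 0)"
      using Z' by simp
    also have "\<dots> = (?k * ?Z' / ?Z / ?Y) * pmf (posterior (\<Omega> - B) G) x"
      unfolding posterior_def pmf_cond[OF ne'] ..
    finally show "pmf (cond_pmf (posterior \<Omega> G) ?E) x = (?k * ?Z' / ?Z / ?Y) * pmf (posterior (\<Omega> - B) G) x" .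
  qed
  then have "d_TV (posterior \<Omega> G) (posterior (\<Omega> - B) G) \<le> measure_pmf.prob (posterior \<Omega> G) (- ?E)"
    using d_TV_cond_pmf[OF neE] by simp
  also have "\<dots> = measure_pmf.prob (triangle_law \<Omega> G) (\<Union>t\<in>B. {T. t \<in> T})"
    unfolding triangle_law_def measure_map_pmf by (rule arg_cong2[where f = measure]) auto
  also have "\<dots> \<le> (\<Sum>t\<in>B. measure_pmf.prob (triangle_law \<Omega> G) {T. t \<in> T})"
    using fin by (intro measure_pmf.finite_measure_subadditive_finite) auto
  also have "\<dots> \<le> (\<Sum>t\<in>B. p' / (1 - p') / p ^ 3)"
    using assms by (intro sum_mono prob_triangle_law_mem) auto
  finally show ?thesis by simp
qed

section \<open>The Bayes inverse of adding triangles\<close>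

definition "exact_inverse G = bind_pmf (triangle_law triples G) (\<lambda>T. resample p (cover T) G)"

lemma exact_inverse_eq: "G \<subseteq> pairs \<Longrightarrow> exact_inverse G = map_pmf fst (posterior triples G)"
  by (simp add: exact_inverse_def posterior_eq map_bind_pmf pmf.map_comp o_def)

lemma RGT_subset:
  assumes "G \<in> set_pmf (RGT n p p')"
  shows "G \<subseteq> pairs"
proof -
  obtain G0 T where *: "G0 \<in> set_pmf (random_subset pairs p)" "T \<in> set_pmf (random_subset triples p')"
    "G = G0 \<union> cover T"
    using assms by (auto simp: RGT_eq_add_triangles add_triangles_def ER_def)
  then show ?thesis
    using random_subset_subsetD[OF *(1)] cover_subset[OF random_subset_subsetD[OF *(2)]] by blast
qed

lemma bind_RGT_exact_inverse: "bind_pmf (RGT n p p') exact_inverse = ER n p"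
proof -
  let ?J = "pair_pmf (ER n p) (random_subset triples p')"
  have RGT: "RGT n p p' = map_pmf (\<lambda>x. fst x \<union> cover (snd x)) ?J"
    by (simp add: RGT_def pair_pmf_def map_bind_pmf cover_def)
  have "bind_pmf (RGT n p p') exact_inverse = bind_pmf (RGT n p p') (\<lambda>G. map_pmf fst (posterior triples G))"
    by (intro bind_pmf_cong refl exact_inverse_eq RGT_subset)
  also have "\<dots> = map_pmf fst (bind_pmf (RGT n p p') (posterior triples))"
    by (simp add: map_bind_pmf)
  also have "bind_pmf (RGT n p p') (posterior triples) = ?J"
    unfolding RGT posterior_def[abs_def] by (rule bind_map_cond_pmf)
  finally show ?thesis by (simp add: map_fst_pair_pmf)
qed

end

text \<open>Links the kernel that can be run without knowledge of \<open>S\<close> to the one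
  analysed for a given \<open>S\<close>; they differ only by admitting the triangles inside
  \<open>S\<close>.\<close>

lemma (in planted) d_TV_exact_inverse_kernel:
  assumes "G \<subseteq> pairs"
  shows "d_TV (exact_inverse G) (inverse_kernel G) \<le> card Int3 * (p' / (1 - p') / p ^ 3)"
proof -
  have "TS \<union> TO = triples - Int3" using triangles_split by blast
  then have "inverse_kernel G = map_pmf fst (posterior (triples - Int3) G)"
    by (simp add: inverse_kernel_def posterior_def)
  then have "d_TV (exact_inverse G) (inverse_kernel G) \<le> d_TV (posterior triples G) (posterior (triples - Int3) G)"
    using exact_inverse_eq[OF assms] d_TV_map_left by metis
  also have "\<dots> \<le> card Int3 * (p' / (1 - p') / p ^ 3)"
    using assms triangles_split by (intro d_TV_posterior_Diff) auto
  finally show ?thesis .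
qed

section \<open>Iterated Markov kernels\<close>

primrec iter_pmf :: "('x \<Rightarrow> 's \<Rightarrow> 's pmf) \<Rightarrow> 'x list \<Rightarrow> 's \<Rightarrow> 's pmf" where
  "iter_pmf f [] s = return_pmf s"
| "iter_pmf f (x # xs) s = bind_pmf (f x s) (iter_pmf f xs)"

lemma iter_pmf_append: "iter_pmf f (xs @ ys) s = bind_pmf (iter_pmf f xs s) (iter_pmf f ys)"
proof (induction xs arbitrary: s)
  case (Cons x xs)
  then have "iter_pmf f (xs @ ys) = (\<lambda>s. bind_pmf (iter_pmf f xs s) (iter_pmf f ys))" by (rule ext)
  then show ?case by (simp add: bind_assoc_pmf)
qed (simp add: bind_return_pmf)

lemma iter_pmf_invariant:
  assumes "\<And>x s. P s \<Longrightarrow> \<forall>s'\<in>set_pmf (f x s). P s'" "P s" "s' \<in> set_pmf (iter_pmf f xs s)"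
  shows "P s'"
  using assms(2,3) by (induction xs arbitrary: s) (auto dest: assms(1))

lemma iter_pmf_stationary:
  assumes "\<And>x. x \<in> set xs \<Longrightarrow> bind_pmf \<pi> (f x) = \<pi>"
  shows "bind_pmf \<pi> (iter_pmf f xs) = \<pi>"
  using assms
proof (induction xs)
  case (Cons x xs)
  have "iter_pmf f (x # xs) = (\<lambda>s. bind_pmf (f x s) (iter_pmf f xs))" by (rule ext) simp
  then have "bind_pmf \<pi> (iter_pmf f (x # xs)) = bind_pmf (bind_pmf \<pi> (f x)) (iter_pmf f xs)"
    by (simp add: bind_assoc_pmf)
  then show ?case using Cons by (simp del: iter_pmf.simps)
next
  case Nil
  have "iter_pmf f [] = return_pmf" by (rule ext) simp
  then show ?case by (simp add: bind_return_pmf')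
qed

subsection \<open>Contraction of heat-bath dynamics\<close>

text \<open>
  Dobrushin's method: \<open>d s\<close> bounds the change of an observable when site \<open>s\<close> is flipped, and
  updating a site \<open>t\<close> moves the mass \<open>d t\<close> to the neighbours of \<open>t\<close>, shrinking it by \<open>\<alpha>\<close>.
\<close>

locale heat_bath =
  fixes \<Omega> :: "'a set" and r :: "'a \<Rightarrow> 'a set \<Rightarrow> real" and nb :: "'a \<Rightarrow> 'a set" and e \<alpha> :: real
  assumes fin\<Omega>: "finite \<Omega>"
    and r: "\<And>t T. r t T \<in> {0..1}"
    and influence: "\<And>s t T. s \<in> \<Omega> \<Longrightarrow> t \<in> \<Omega> \<Longrightarrow> T \<subseteq> \<Omega> \<Longrightarrow>
      \<bar>r t (insert s T) - r t (T - {s})\<bar> \<le> (if s \<in> nb t then e else 0)"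
    and e: "0 \<le> e"
    and \<alpha>: "\<And>t. t \<in> \<Omega> \<Longrightarrow> e * card (nb t \<inter> \<Omega>) \<le> \<alpha>" "0 \<le> \<alpha>" "\<alpha> \<le> 1"
begin

definition "upd t T = map_pmf (\<lambda>b. if b then insert t T else T - {t}) (bernoulli_pmf (r t T))"

definition osc :: "('a set \<Rightarrow> real) \<Rightarrow> ('a \<Rightarrow> real) \<Rightarrow> bool" where
  "osc f d \<longleftrightarrow> (\<forall>s. 0 \<le> d s) \<and> (\<forall>T \<subseteq> \<Omega>. \<forall>s \<in> \<Omega>. \<bar>f (insert s T) - f (T - {s})\<bar> \<le> d s)"

lemma prob_bind_upd:
  "measure_pmf.prob (bind_pmf (upd t T) \<kappa>) A
    = r t T * measure_pmf.prob (\<kappa> (insert t T)) A + (1 - r t T) * measure_pmf.prob (\<kappa> (T - {t})) A"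
  using r[of t T] by (simp add: upd_def prob_bind_pmf bind_map_pmf mult.commute)

text \<open>Flipping \<open>s\<close> before the update at \<open>t\<close> acts on the observable
  directly, by \<open>d s\<close> unless the update overwrites \<open>s = t\<close>, and through the
  update probability, by the influence times \<open>d t\<close>. A site may be its own neighbour,
  since the updates used later remember the old value slightly.\<close>

lemma osc_upd:
  assumes f: "osc f d" and t: "t \<in> \<Omega>"
  shows "osc (\<lambda>T. r t T * f (insert t T) + (1 - r t T) * f (T - {t}))
    (\<lambda>s. (if s = t then 0 else d s) + (if s \<in> nb t then e * d t else 0))"
  unfolding osc_def
proof (intro conjI allI impI ballI)
  fix s show "0 \<le> (if s = t then 0 else d s) + (if s \<in> nb t then e * d t else 0)"
    using f e by (auto simp: osc_def)
next
  fix T s assume T: "T \<subseteq> \<Omega>" and s: "s \<in> \<Omega>"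
  let ?r1 = "r t (insert s T)" and ?r0 = "r t (T - {s})"
  have d: "\<bar>f (insert u X) - f (X - {u})\<bar> \<le> d u" if "X \<subseteq> \<Omega>" "u \<in> \<Omega>" for X u
    using f that by (auto simp: osc_def)
  have d0: "0 \<le> d u" for u using f by (auto simp: osc_def)
  have infl: "\<bar>?r1 - ?r0\<bar> * d t \<le> (if s \<in> nb t then e * d t else 0)"
    using mult_right_mono[OF influence[OF s t T] d0[of t]] by (auto split: if_splits)
  show "\<bar>(?r1 * f (insert t (insert s T)) + (1 - ?r1) * f (insert s T - {t}))
      - (?r0 * f (insert t (T - {s})) + (1 - ?r0) * f (T - {s} - {t}))\<bar>
    \<le> (if s = t then 0 else d s) + (if s \<in> nb t then e * d t else 0)"
  proof (cases "s = t")
    case True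
    have "(?r1 * f (insert t (insert s T)) + (1 - ?r1) * f (insert s T - {t}))
        - (?r0 * f (insert t (T - {s})) + (1 - ?r0) * f (T - {s} - {t}))
        = (?r1 - ?r0) * (f (insert t T) - f (T - {t}))"
      using True by (simp add: algebra_simps insert_Diff_if)
    also have "\<bar>\<dots>\<bar> \<le> \<bar>?r1 - ?r0\<bar> * d t"
      unfolding abs_mult using d[OF T t] by (intro mult_left_mono) auto
    finally show ?thesis using infl True by simp
  next
    case False
    let ?A1 = "f (insert t (insert s T))" and ?A0 = "f (insert t (T - {s}))"
      and ?B1 = "f (insert s T - {t})" and ?B0 = "f (T - {s} - {t})"
    have A: "\<bar>?A1 - ?A0\<bar> \<le> d s"
    proof -
      have "insert t (insert s T) = insert s (insert t T)" "insert t (T - {s}) = insert t T - {s}"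
        using False by auto
      then show ?thesis using d[of "insert t T" s] T s t by simp
    qed
    have B: "\<bar>?B1 - ?B0\<bar> \<le> d s"
    proof -
      have "insert s T - {t} = insert s (T - {t})" "T - {s} - {t} = T - {t} - {s}"
        using False by auto
      then show ?thesis using d[of "T - {t}" s] T s by auto
    qed
    have C: "\<bar>?A0 - ?B0\<bar> \<le> d t"
      using d[of "T - {s}" t] T t by auto
    have "(?r1 * ?A1 + (1 - ?r1) * ?B1) - (?r0 * ?A0 + (1 - ?r0) * ?B0)
        = ?r1 * (?A1 - ?A0) + (1 - ?r1) * (?B1 - ?B0) + (?r1 - ?r0) * (?A0 - ?B0)"
      by (simp add: algebra_simps)
    also have "\<bar>\<dots>\<bar> \<le> \<bar>?r1 * (?A1 - ?A0)\<bar> + \<bar>(1 - ?r1) * (?B1 - ?B0)\<bar> + \<bar>(?r1 - ?r0) * (?A0 - ?B0)\<bar>"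
      by linarith
    also have "\<dots> \<le> ?r1 * d s + (1 - ?r1) * d s + \<bar>?r1 - ?r0\<bar> * d t"
      unfolding abs_mult using A B C r[of t "insert s T"]
      by (intro add_mono mult_mono) (auto simp: d0)
    also have "\<dots> = d s + \<bar>?r1 - ?r0\<bar> * d t" by (simp add: algebra_simps)
    finally show ?thesis using infl False by simp
  qed
qed

text \<open>The induction runs backwards from the last update. Until a site is reached its share of
  the mass can only have grown, which is the second conjunct; hence at its turn at least
  \<open>(1 - \<alpha>) * d s\<close> of the total disappears.\<close>

lemma osc_sweep:
  assumes "osc (\<lambda>T. measure_pmf.prob (\<kappa> T) A) d" and "set xs \<subseteq> \<Omega>"
  shows "\<exists>d'. osc (\<lambda>T. measure_pmf.prob (bind_pmf (iter_pmf upd xs T) \<kappa>) A) d' \<and>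
    (\<forall>s \<in> \<Omega> - set xs. d s \<le> d' s) \<and>
    (\<Sum>s\<in>\<Omega>. d' s) \<le> (\<Sum>s\<in>\<Omega>. d s) - (1 - \<alpha>) * (\<Sum>s\<in>set xs. d s)"
  using assms(2)
proof (induction xs)
  case Nil
  then show ?case using assms(1) by (intro exI[of _ d]) (simp add: bind_return_pmf)
next
  case (Cons t xs)
  then obtain d' where d': "osc (\<lambda>T. measure_pmf.prob (bind_pmf (iter_pmf upd xs T) \<kappa>) A) d'"
    "\<forall>s \<in> \<Omega> - set xs. d s \<le> d' s"
    "(\<Sum>s\<in>\<Omega>. d' s) \<le> (\<Sum>s\<in>\<Omega>. d s) - (1 - \<alpha>) * (\<Sum>s\<in>set xs. d s)" by auto
  have t: "t \<in> \<Omega>" using Cons.prems by simp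
  define d'' where "d'' s = (if s = t then 0 else d' s) + (if s \<in> nb t then e * d' t else 0)" for s
  have d0: "0 \<le> d' s" for s using d'(1) by (auto simp: osc_def)
  have "osc (\<lambda>T. measure_pmf.prob (bind_pmf (iter_pmf upd (t # xs) T) \<kappa>) A) d''"
    using osc_upd[OF d'(1) t] unfolding d''_def by (simp add: bind_assoc_pmf prob_bind_upd)
  moreover have "d s \<le> d'' s" if "s \<in> \<Omega> - set (t # xs)" for s
    using that d'(2) d0[of t] e by (auto simp: d''_def intro: order_trans)
  moreover have "(\<Sum>s\<in>\<Omega>. d'' s) \<le> (\<Sum>s\<in>\<Omega>. d s) - (1 - \<alpha>) * (\<Sum>s\<in>set (t # xs). d s)"
  proof -
    have "(\<Sum>s\<in>\<Omega>. d'' s) = (\<Sum>s\<in>\<Omega> - {t}. d' s) + e * d' t * card (nb t \<inter> \<Omega>)"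
    proof -
      have "(\<Sum>s\<in>\<Omega>. if s = t then 0 else d' s) = (\<Sum>s\<in>\<Omega> - {t}. d' s)"
        using fin\<Omega> t by (simp add: sum.remove[of \<Omega> t])
      moreover have "(\<Sum>s\<in>\<Omega>. if s \<in> nb t then e * d' t else 0) = e * d' t * card (nb t \<inter> \<Omega>)"
        using fin\<Omega> by (simp add: sum.If_cases Int_commute)
      ultimately show ?thesis by (simp add: d''_def sum.distrib)
    qed
    also have "\<dots> = (\<Sum>s\<in>\<Omega>. d' s) - d' t + (e * card (nb t \<inter> \<Omega>)) * d' t"
      using fin\<Omega> t by (simp add: sum.remove[of \<Omega> t])
    also have "\<dots> \<le> (\<Sum>s\<in>\<Omega>. d' s) - d' t + \<alpha> * d' t"
      using \<alpha>(1)[OF t] d0 by (intro add_left_mono mult_right_mono) auto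
    also have "\<dots> = (\<Sum>s\<in>\<Omega>. d' s) - (1 - \<alpha>) * d' t" by (simp add: algebra_simps)
    finally have *: "(\<Sum>s\<in>\<Omega>. d'' s) \<le> (\<Sum>s\<in>\<Omega>. d' s) - (1 - \<alpha>) * d' t" .
    show ?thesis
    proof (cases "t \<in> set xs")
      case True
      have "0 \<le> (1 - \<alpha>) * d' t" using \<alpha> d0 by simp
      then show ?thesis using True * d'(3) by (simp add: insert_absorb)
    next
      case False
      have "(1 - \<alpha>) * d t \<le> (1 - \<alpha>) * d' t" using \<alpha> d'(2) t False by (intro mult_left_mono) auto
      then show ?thesis using False * d'(3) by (simp add: algebra_simps)
    qed
  qed
  ultimately show ?case by blast
qed

lemma osc_sweeps:
  assumes "osc (\<lambda>T. measure_pmf.prob (\<kappa> T) A) d" and "set xs = \<Omega>"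
  shows "\<exists>d'. osc (\<lambda>T. measure_pmf.prob (bind_pmf (iter_pmf (\<lambda>_. iter_pmf upd xs) ys T) \<kappa>) A) d' \<and>
    (\<Sum>s\<in>\<Omega>. d' s) \<le> \<alpha> ^ length ys * (\<Sum>s\<in>\<Omega>. d s)"
proof (induction ys)
  case Nil
  then show ?case using assms(1) by (intro exI[of _ d]) (simp add: bind_return_pmf)
next
  case (Cons y ys)
  then obtain d' where d': "osc (\<lambda>T. measure_pmf.prob (bind_pmf (iter_pmf (\<lambda>_. iter_pmf upd xs) ys T) \<kappa>) A) d'"
    "(\<Sum>s\<in>\<Omega>. d' s) \<le> \<alpha> ^ length ys * (\<Sum>s\<in>\<Omega>. d s)" by blast
  obtain d'' where d'': "osc (\<lambda>T. measure_pmf.prob (bind_pmf (iter_pmf upd xs T)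
      (\<lambda>T. bind_pmf (iter_pmf (\<lambda>_. iter_pmf upd xs) ys T) \<kappa>)) A) d''"
    "(\<Sum>s\<in>\<Omega>. d'' s) \<le> (\<Sum>s\<in>\<Omega>. d' s) - (1 - \<alpha>) * (\<Sum>s\<in>\<Omega>. d' s)"
    using osc_sweep[OF d'(1), of xs] assms(2) by auto
  have "(\<Sum>s\<in>\<Omega>. d'' s) \<le> \<alpha> * (\<Sum>s\<in>\<Omega>. d' s)" using d''(2) by (simp add: algebra_simps)
  also have "\<dots> \<le> \<alpha> * (\<alpha> ^ length ys * (\<Sum>s\<in>\<Omega>. d s))" using \<alpha> d'(2) by (intro mult_left_mono) auto
  finally show ?case using d''(1) by (intro exI[of _ d'']) (simp add: bind_assoc_pmf)
qed

lemma osc_empty: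
  assumes "osc f d" "T \<subseteq> \<Omega>"
  shows "\<bar>f T - f {}\<bar> \<le> (\<Sum>s\<in>\<Omega>. d s)"
proof -
  have d0: "0 \<le> d s" for s using assms by (auto simp: osc_def)
  have "finite T" using assms fin\<Omega> finite_subset by blast
  then have "\<bar>f T - f {}\<bar> \<le> (\<Sum>s\<in>T. d s)" using assms(2)
  proof (induction T rule: finite_induct)
    case (insert s T)
    then have "\<bar>f (insert s T) - f (T - {s})\<bar> \<le> d s" using assms(1) unfolding osc_def by blast
    then have "\<bar>f (insert s T) - f T\<bar> \<le> d s" using insert.hyps by simp
    moreover have "\<bar>f T - f {}\<bar> \<le> (\<Sum>s\<in>T. d s)" using insert by simp
    ultimately show ?case using insert.hyps by simp
  qed simp
  also have "\<dots> \<le> (\<Sum>s\<in>\<Omega>. d s)" using assms fin\<Omega> d0 by (intro sum_mono2) auto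
  finally show ?thesis .
qed

theorem d_TV_sweeps:
  assumes xs: "set xs = \<Omega>" and \<pi>: "set_pmf \<pi> \<subseteq> Pow \<Omega>" "\<And>t. t \<in> \<Omega> \<Longrightarrow> bind_pmf \<pi> (upd t) = \<pi>"
  shows "d_TV (iter_pmf (\<lambda>_. iter_pmf upd xs) ys {}) \<pi> \<le> \<alpha> ^ length ys * card \<Omega>"
proof -
  let ?K = "iter_pmf (\<lambda>_. iter_pmf upd xs) ys"
  have "bind_pmf \<pi> (iter_pmf upd xs) = \<pi>" by (rule iter_pmf_stationary) (use \<pi>(2) xs in auto)
  then have stat: "bind_pmf \<pi> ?K = \<pi>" by (rule iter_pmf_stationary)
  have "d_TV (?K {}) (?K T) \<le> \<alpha> ^ length ys * card \<Omega>" if T: "T \<subseteq> \<Omega>" for T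
  proof (rule d_TV_leI)
    fix A
    have "osc (\<lambda>T. measure_pmf.prob (return_pmf T) A) (\<lambda>_. 1)"
      by (auto simp: osc_def indicator_def)
    from osc_sweeps[OF this xs, of ys] obtain d' where d':
      "osc (\<lambda>T. measure_pmf.prob (?K T) A) d'" "(\<Sum>s\<in>\<Omega>. d' s) \<le> \<alpha> ^ length ys * card \<Omega>"
      by (auto simp: bind_return_pmf')
    show "measure_pmf.prob (?K {}) A - measure_pmf.prob (?K T) A \<le> \<alpha> ^ length ys * card \<Omega>"
      using osc_empty[OF d'(1) T] d'(2) by linarith
  qed
  then have "d_TV (bind_pmf \<pi> (\<lambda>_. ?K {})) (bind_pmf \<pi> ?K) \<le> \<alpha> ^ length ys * card \<Omega>"
    using \<pi>(1) by (intro d_TV_bind_right) auto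
  then show ?thesis by (simp add: stat)
qed

end

lemma bind_reversible:
  assumes fin: "finite \<Omega>" and \<pi>: "set_pmf \<pi> \<subseteq> \<Omega>" and K: "\<And>x. x \<in> \<Omega> \<Longrightarrow> set_pmf (K x) \<subseteq> \<Omega>"
    and rev: "\<And>x y. x \<in> \<Omega> \<Longrightarrow> y \<in> \<Omega> \<Longrightarrow> pmf \<pi> x * pmf (K x) y = pmf \<pi> y * pmf (K y) x"
  shows "bind_pmf \<pi> K = \<pi>"
proof (rule pmf_eqI)
  fix y
  have "pmf (bind_pmf \<pi> K) y = (\<Sum>x\<in>\<Omega>. pmf (K x) y * pmf \<pi> x)"
    unfolding pmf_bind using \<pi> by (intro integral_measure_pmf_real fin) auto
  also have "\<dots> = pmf \<pi> y"
  proof (cases "y \<in> \<Omega>")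
    case True
    then have "(\<Sum>x\<in>\<Omega>. pmf (K x) y * pmf \<pi> x) = (\<Sum>x\<in>\<Omega>. pmf \<pi> y * pmf (K y) x)"
      by (intro sum.cong refl) (simp add: rev mult.commute)
    also have "\<dots> = pmf \<pi> y" using sum_pmf_eq_1[OF fin K[OF True]] by (simp flip: sum_distrib_left)
    finally show ?thesis .
  next
    case False
    then have "y \<notin> set_pmf (K x)" if "x \<in> \<Omega>" for x using K[OF that] by blast
    moreover have "y \<notin> set_pmf \<pi>" using False \<pi> by blast
    ultimately show ?thesis by (simp add: set_pmf_iff)
  qed
  finally show "pmf (bind_pmf \<pi> K) y = pmf \<pi> y" .
qed

subsection \<open>Sampling the posterior by Glauber dynamics\<close>

text \<open>
  An attempt proposes fresh values for the triangle \<open>t\<close> and for the edges of \<open>t\<close> that no other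
  triangle of \<open>T\<close> explains, and is void if the proposal contradicts the observed graph.
\<close>

definition vacancy :: "real \<Rightarrow> nat set set \<Rightarrow> nat set \<Rightarrow> real" where
  "vacancy p T t = (\<Prod>e\<in>nsets t 2. if e \<in> cover (T - {t}) then 1 else p)"

definition attempt :: "real \<Rightarrow> real \<Rightarrow> nat set \<Rightarrow> nat set set \<Rightarrow> nat set set pmf" where
  "attempt p p' t T = do {
     y \<leftarrow> bernoulli_pmf (vacancy p T t);
     b \<leftarrow> bernoulli_pmf p';
     return_pmf (if b then insert t T else if y then T - {t} else T) }"

text \<open>The \<open>m\<close> attempts stand in for one heat-bath update of \<open>t\<close>.
  Triangles not contained in \<open>G\<close> have posterior probability 0 and are left
  alone.\<close>

definition refresh :: "real \<Rightarrow> real \<Rightarrow> nat \<Rightarrow> graph \<Rightarrow> nat set \<Rightarrow> nat set set \<Rightarrow> nat set set pmf" where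
  "refresh p p' m G t T =
     (if nsets t 2 \<subseteq> G then iter_pmf (\<lambda>_. attempt p p' t) [0..<m] T else return_pmf T)"

context noisy_graph begin

text \<open>Probability that the triangle is present after \<open>m\<close> attempts from state
  \<open>x\<close>. Here \<open>a\<close> is the heat-bath probability, and
  \<open>(1 - p') * (1 - w)\<close> is the probability that an attempt is void and so preserves the
  memory of \<open>x\<close>.\<close>

definition "rate m x w = (let a = p' / (p' + (1 - p') * w) in a + (of_bool x - a) * ((1 - p') * (1 - w)) ^ m)"

lemma card_pairs_of_triple: assumes "t \<in> triples" shows "card (nsets t 2) = 3" "finite (nsets t 2)"
proof -
  have "t \<in> nsets UNIV 3" using assms by (auto simp: nsets_def)
  then obtain a b c where "t = {a, b, c}" "a < b" "b < c" by (auto simp: ordered_nsets_3_eq)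
  then have "nsets t 2 = {{a, b}, {a, c}, {b, c}}" "a \<noteq> b" "b \<noteq> c" "a \<noteq> c" by (auto simp: nsets_2_eq)
  then show "card (nsets t 2) = 3" "finite (nsets t 2)" by (auto simp: doubleton_eq_iff card_insert_if)
qed

lemma vacancy_bounds:
  assumes "t \<in> triples"
  shows "p ^ 3 \<le> vacancy p T t" "vacancy p T t \<le> 1"
proof -
  have "(\<Prod>e\<in>nsets t 2. p) \<le> vacancy p T t" unfolding vacancy_def using p by (intro prod_mono) auto
  then show "p ^ 3 \<le> vacancy p T t" using card_pairs_of_triple[OF assms] by simp
  show "vacancy p T t \<le> 1" unfolding vacancy_def using p by (intro prod_le_1) auto
qed

lemma rate_bounds:
  assumes "0 < w" "w \<le> 1"
  shows "0 \<le> rate m x w" "rate m x w \<le> 1" "rate m x w \<le> p' / w + (1 - w) ^ m"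
proof -
  define a where "a = p' / (p' + (1 - p') * w)"
  define b where "b = ((1 - p') * (1 - w)) ^ m"
  have den: "w \<le> p' + (1 - p') * w"
  proof -
    have "0 \<le> p' * (1 - w)" using p' assms by simp
    then show ?thesis by (simp add: algebra_simps)
  qed
  have a: "0 \<le> a" "a \<le> 1" "a \<le> p' / w"
    using den assms p' by (auto simp: a_def intro!: divide_left_mono divide_le_eq_1_pos[THEN iffD2])
  have b: "0 \<le> b" "b \<le> 1" "b \<le> (1 - w) ^ m"
    using assms p' by (auto simp: b_def intro!: power_le_one mult_le_one power_mono mult_left_le_one_le)
  have eq: "rate m x w = a * (1 - b) + of_bool x * b"
    by (simp add: rate_def a_def b_def Let_def algebra_simps)
  show "0 \<le> rate m x w" unfolding eq using a b by simp
  have "a * (1 - b) \<le> 1 * (1 - b)" using a b by (intro mult_right_mono) auto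
  then show "rate m x w \<le> 1" unfolding eq by (cases x) (use b in auto)
  have "a * (1 - b) \<le> a * 1" using a b by (intro mult_left_mono) auto
  then show "rate m x w \<le> p' / w + (1 - w) ^ m" unfolding eq by (cases x) (use a b in auto)
qed

text \<open>Attempts at \<open>t\<close> change nothing but the membership of \<open>t\<close>, so
  the vacancy stays constant and the presence of \<open>t\<close> is a two-state chain, whose linear
  recursion is solved by \<open>rate\<close>.\<close>

lemma iter_attempt:
  assumes t: "t \<in> triples"
  shows "iter_pmf (\<lambda>_. attempt p p' t) xs T
    = map_pmf (\<lambda>b. if b then insert t T else T - {t}) (bernoulli_pmf (rate (length xs) (t \<in> T) (vacancy p T t)))"
proof (induction xs arbitrary: T)
  case Nil
  have "rate 0 (t \<in> T) (vacancy p T t) = of_bool (t \<in> T)" by (simp add: rate_def Let_def)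
  moreover have "bernoulli_pmf (of_bool x) = return_pmf x" for x
    by (rule bernoulli_eqI[symmetric]) (cases x; simp)
  ultimately show ?case by (auto simp: insert_absorb)
next
  case (Cons x xs)
  let ?w = "vacancy p T t" and ?F = "\<lambda>b. if b then insert t T else T - {t}"
  have w: "0 < ?w" "?w \<le> 1"
    using vacancy_bounds[OF t, of T] p by (auto intro: less_le_trans[of 0 "p ^ 3"])
  have inv: "insert t T1 = insert t T \<and> T1 - {t} = T - {t} \<and> vacancy p T1 t = ?w"
    if "T1 \<in> set_pmf (attempt p p' t T)" for T1
  proof -
    have "T1 = insert t T \<or> T1 = T - {t} \<or> T1 = T" using that by (auto simp: attempt_def split: if_splits)
    then have "insert t T1 = insert t T" "T1 - {t} = T - {t}" by auto
    then show ?thesis by (simp add: vacancy_def)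
  qed
  have "iter_pmf (\<lambda>_. attempt p p' t) (x # xs) T
    = bind_pmf (attempt p p' t T) (\<lambda>T1. map_pmf ?F (bernoulli_pmf (rate (length xs) (t \<in> T1) ?w)))"
    unfolding iter_pmf.simps
  proof (intro bind_pmf_cong refl)
    fix T1 assume "T1 \<in> set_pmf (attempt p p' t T)"
    note inv[OF this]
    then show "iter_pmf (\<lambda>_. attempt p p' t) xs T1 = map_pmf ?F (bernoulli_pmf (rate (length xs) (t \<in> T1) ?w))"
      unfolding Cons.IH by (simp cong: if_cong)
  qed
  also have "\<dots> = map_pmf ?F (bind_pmf (attempt p p' t T) (\<lambda>T1. bernoulli_pmf (rate (length xs) (t \<in> T1) ?w)))"
    by (simp add: map_bind_pmf)
  also have "bind_pmf (attempt p p' t T) (\<lambda>T1. bernoulli_pmf (rate (length xs) (t \<in> T1) ?w))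
      = bernoulli_pmf (rate (length (x # xs)) (t \<in> T) ?w)"
  proof (rule bernoulli_eqI)
    let ?r = "\<lambda>x. rate (length xs) x ?w"
    have "pmf (bind_pmf (attempt p p' t T) (\<lambda>T1. bernoulli_pmf (?r (t \<in> T1)))) True
      = ?w * (p' * ?r True + (1 - p') * ?r False) + (1 - ?w) * (p' * ?r True + (1 - p') * ?r (t \<in> T))"
      using w p' rate_bounds[OF w]
      by (simp add: attempt_def bind_assoc_pmf bind_return_pmf pmf_bind mult.commute)
    also have "\<dots> = rate (length (x # xs)) (t \<in> T) ?w"
    proof -
      define a where "a = p' / (p' + (1 - p') * ?w)"
      have "0 < p' + (1 - p') * ?w" using w p' by (simp add: add_nonneg_pos)
      then have "a * (p' + (1 - p') * ?w) = p'" by (simp add: a_def)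
      \<comment> \<open>The fixed-point equation of one attempt: from equilibrium \<open>a\<close>,
        the presence probability afterwards is \<open>p'\<close> plus \<open>a\<close> times the
        probability of a void attempt.\<close>
      then have a: "p' = a - a * ((1 - p') * (1 - ?w))" by (simp add: algebra_simps)
      define B where "B = ((1 - p') * (1 - ?w)) ^ length xs"
      have r: "?r x = a + (of_bool x - a) * B" for x by (simp add: rate_def Let_def a_def B_def)
      have "?w * (p' * ?r True + (1 - p') * ?r False) + (1 - ?w) * (p' * ?r True + (1 - p') * ?r (t \<in> T))
        = a + (p' + ((1 - p') * (1 - ?w)) * of_bool (t \<in> T) - a) * B"
        unfolding r by (cases "t \<in> T") (simp_all add: algebra_simps)
      also have "p' + ((1 - p') * (1 - ?w)) * of_bool (t \<in> T) - a
          = (of_bool (t \<in> T) - a) * ((1 - p') * (1 - ?w))"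
        by (subst (1) a) (simp add: algebra_simps)
      finally show ?thesis by (simp add: rate_def Let_def a_def[symmetric] B_def)
    qed
    finally show "pmf (bind_pmf (attempt p p' t T) (\<lambda>T1. bernoulli_pmf (?r (t \<in> T1)))) True
      = rate (length (x # xs)) (t \<in> T) ?w" .
  qed
  finally show ?case .
qed

text \<open>The vacancy is \<open>p\<close> to the number of sides of \<open>t\<close> that no other
  triangle covers. This is exactly the inverse of the factor that the likelihood gains when
  \<open>t\<close> is inserted.\<close>

lemma triangle_law_balance:
  assumes G: "G \<subseteq> pairs" and t: "t \<in> triples" "nsets t 2 \<subseteq> G" and T: "T \<subseteq> triples" "t \<notin> T"
  shows "pmf (triangle_law triples G) T * p'
    = pmf (triangle_law triples G) (insert t T) * ((1 - p') * vacancy p T t)"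
proof -
  obtain c where c: "\<And>T. pmf (triangle_law triples G) T = (if T \<subseteq> triples then c * gibbs_weight G T else 0)"
    using pmf_triangle_law[OF order_refl G] by blast
  have "finite T" using T finite_triples by auto
  have ct: "cover (insert t T) = cover T \<union> (nsets t 2 - cover T)" by (auto simp: cover_def)
  have fins: "finite (cover T)" "finite (nsets t 2)"
    using T finite_cover[OF \<open>finite T\<close>] card_pairs_of_triple[OF t(1)] by auto
  have card: "card (cover (insert t T)) = card (cover T) + card (nsets t 2 - cover T)"
    unfolding ct using fins by (intro card_Un_disjoint) auto
  have vac: "vacancy p T t = p ^ card (nsets t 2 - cover T)"
  proof -
    have "vacancy p T t = (\<Prod>e\<in>nsets t 2. if e \<in> cover T then 1 else p)"
      using T(2) by (simp add: vacancy_def)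
    also have "\<dots> = p ^ card (nsets t 2 - cover T)"
      using fins by (simp add: prod.If_cases Diff_eq)
    finally show ?thesis .
  qed
  have sub: "cover (insert t T) \<subseteq> G \<longleftrightarrow> cover T \<subseteq> G" using t(2) by (auto simp: ct)
  have "gibbs_weight G T * p' = gibbs_weight G (insert t T) * ((1 - p') * vacancy p T t)"
    unfolding gibbs_weight_def sub card vac using \<open>finite T\<close> T(2) p p'
    by (simp add: power_add)
  then show ?thesis using T t(1) by (simp add: c mult.assoc)
qed

text \<open>Detailed balance holds for a single attempt. The posterior is thus stationary for any
  number of attempts, which influences only the contraction rate.\<close>

lemma bind_triangle_law_attempt:
  assumes G: "G \<subseteq> pairs" and t: "t \<in> triples" "nsets t 2 \<subseteq> G"
  shows "bind_pmf (triangle_law triples G) (attempt p p' t) = triangle_law triples G"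
proof (rule bind_reversible)
  let ?\<pi> = "triangle_law triples G"
  obtain c where c: "\<And>T. pmf ?\<pi> T = (if T \<subseteq> triples then c * gibbs_weight G T else 0)"
    using pmf_triangle_law[OF order_refl G] by blast
  show "finite (Pow triples)" using finite_triples by auto
  show "set_pmf ?\<pi> \<subseteq> Pow triples" by (auto simp: set_pmf_iff c split: if_splits)
  show "set_pmf (attempt p p' t X) \<subseteq> Pow triples" if "X \<in> Pow triples" for X
    using that t(1) by (auto simp: attempt_def split: if_splits)
  have K: "pmf (attempt p p' t X) Y = p' * of_bool (Y = insert t X)
      + (1 - p') * (vacancy p X t * of_bool (Y = X - {t}) + (1 - vacancy p X t) * of_bool (Y = X))" for X Y
  proof -
    have w: "0 \<le> vacancy p X t" "vacancy p X t \<le> 1"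
      using vacancy_bounds[OF t(1), of X] p by (auto intro: order_trans[of 0 "p ^ 3"])
    show ?thesis
      using w p' by (simp add: attempt_def pmf_bind indicator_def of_bool_def eq_commute[of _ Y] algebra_simps)
  qed
  show "pmf ?\<pi> X * pmf (attempt p p' t X) Y = pmf ?\<pi> Y * pmf (attempt p p' t Y) X"
    if XY: "X \<in> Pow triples" "Y \<in> Pow triples" for X Y
  proof -
    have step: "pmf ?\<pi> X * pmf (attempt p p' t X) Y = pmf ?\<pi> Y * pmf (attempt p p' t Y) X"
      if "X \<subseteq> triples" "t \<notin> X" "Y = insert t X" for X Y
    proof -
      have 1: "X \<noteq> insert t X" "insert t X \<noteq> X" using that by auto
      have 2: "insert t X - {t} = X" "X - {t} = X" using that by auto
      have "vacancy p (insert t X) t = vacancy p X t" using that by (simp add: vacancy_def)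
      then show ?thesis unfolding K that(3) using triangle_law_balance[OF G t that(1,2)] 1 2 by simp
    qed
    consider "X = Y" | "t \<notin> X" "Y = insert t X" | "t \<notin> Y" "X = insert t Y"
      | "X \<noteq> Y" "Y \<noteq> insert t X" "X \<noteq> insert t Y"
      by (cases "t \<in> X"; cases "t \<in> Y") blast+
    then show ?thesis
    proof cases
      case 4
      then have "Y \<noteq> X - {t}" "X \<noteq> Y - {t}" by auto
      then show ?thesis unfolding K using 4 by simp
    qed (use step XY in auto)
  qed
qed

text \<open>All rates lie between 0 and \<open>p' / p ^ 3 + (1 - p ^ 3) ^ m\<close>, as vacancies
  are at least \<open>p ^ 3\<close>; this range bounds every influence. Only triangles sharing a
  side with \<open>t\<close> influence it, and there are at most \<open>3 * n\<close> of them: three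
  sides and \<open>n\<close> choices for the third vertex.\<close>

theorem d_TV_glauber:
  assumes G: "G \<subseteq> pairs" and xs: "set xs = triples"
    and \<alpha>: "(p' / p ^ 3 + (1 - p ^ 3) ^ m) * real (3 * n) \<le> \<alpha>" "\<alpha> \<le> 1"
  shows "d_TV (iter_pmf (\<lambda>_. iter_pmf (refresh p p' m G) xs) ys {}) (triangle_law triples G)
    \<le> \<alpha> ^ length ys * card triples"
proof -
  define \<Omega> where "\<Omega> = {t \<in> triples. nsets t 2 \<subseteq> G}"
  define r where "r t T = (if t \<in> triples then rate m (t \<in> T) (vacancy p T t) else 0)" for t T
  define nb where "nb t = {s \<in> triples. nsets s 2 \<inter> nsets t 2 \<noteq> {}}" for t
  define e where "e = p' / p ^ 3 + (1 - p ^ 3) ^ m"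
  have \<Omega>: "\<Omega> \<subseteq> triples" by (auto simp: \<Omega>_def)
  have p3: "0 < p ^ 3" "p ^ 3 \<le> 1" using p by (auto simp: power_le_one)
  have e0: "0 \<le> e" using p' p3 by (simp add: e_def)
  have w: "0 < vacancy p T t" "vacancy p T t \<le> 1" if "t \<in> triples" for T t
    using vacancy_bounds[OF that, of T] less_le_trans[OF p3(1)] by auto
  have r: "0 \<le> r t T" "r t T \<le> 1" "r t T \<le> e" for t T
  proof -
    show "0 \<le> r t T" "r t T \<le> 1" using rate_bounds(1,2)[OF w] by (auto simp: r_def)
    show "r t T \<le> e"
    proof (cases "t \<in> triples")
      case True
      have "p' / vacancy p T t \<le> p' / p ^ 3"
        using p' p3 vacancy_bounds[OF True, of T] w[OF True] by (intro divide_left_mono) auto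
      moreover have "(1 - vacancy p T t) ^ m \<le> (1 - p ^ 3) ^ m"
        using vacancy_bounds[OF True, of T] w[OF True] by (intro power_mono) auto
      ultimately show ?thesis using rate_bounds(3)[OF w[OF True], of m "t \<in> T" T] True
        by (simp add: r_def e_def)
    qed (simp add: r_def e0)
  qed
  have nb: "card (nb t \<inter> \<Omega>) \<le> 3 * n" if t: "t \<in> \<Omega>" for t
  proof -
    have t': "t \<in> triples" using t \<Omega> by auto
    have "nb t \<inter> \<Omega> \<subseteq> (\<lambda>(d, v). insert v d) ` (nsets t 2 \<times> {..<n})"
    proof
      fix s assume "s \<in> nb t \<inter> \<Omega>"
      then obtain d where d: "s \<in> triples" "d \<in> nsets s 2" "d \<in> nsets t 2" by (auto simp: nb_def)
      have "card (s - d) = 1" using d by (simp add: nsets_def card_Diff_subset)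
      then obtain v where "s - d = {v}" by (auto simp: card_1_singleton_iff)
      then have "s = insert v d" "v < n" using d by (auto simp: nsets_def)
      then show "s \<in> (\<lambda>(d, v). insert v d) ` (nsets t 2 \<times> {..<n})" using d by force
    qed
    then have "card (nb t \<inter> \<Omega>) \<le> card (nsets t 2 \<times> {..<n})"
      using card_pairs_of_triple[OF t'] by (intro surj_card_le) auto
    then show ?thesis using card_pairs_of_triple[OF t'] by (simp add: card_cartesian_product)
  qed
  interpret heat_bath \<Omega> r nb e \<alpha>
  proof
    show "finite \<Omega>" by (rule finite_triples[OF \<Omega>])
    show "r t T \<in> {0..1}" for t T using r by simp
    show "0 \<le> e" by (rule e0)
    have "0 \<le> e * real (3 * n)" using e0 by simp
    then show "0 \<le> \<alpha>" using \<alpha>(1) by (simp only: e_def)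
    show "\<alpha> \<le> 1" by (rule \<alpha>(2))
    show "e * card (nb t \<inter> \<Omega>) \<le> \<alpha>" if "t \<in> \<Omega>" for t
    proof -
      have "e * card (nb t \<inter> \<Omega>) \<le> e * real (3 * n)"
        using nb[OF that] e0 by (intro mult_left_mono) (simp_all only: of_nat_le_iff)
      then show ?thesis using \<alpha>(1) by (simp only: e_def)
    qed
    show "\<bar>r t (insert s T) - r t (T - {s})\<bar> \<le> (if s \<in> nb t then e else 0)"
      if "s \<in> \<Omega>" "t \<in> \<Omega>" "T \<subseteq> \<Omega>" for s t T
    proof (cases "s \<in> nb t")
      case True
      then show ?thesis using r[of t "insert s T"] r[of t "T - {s}"] by auto
    next
      case False
      have t: "t \<in> triples" and s: "s \<in> triples" using that \<Omega> by auto
      have ne: "nsets t 2 \<noteq> {}" using card_pairs_of_triple(1)[OF t] by (metis card.empty zero_neq_numeral)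
      have "s \<noteq> t" using False s ne by (auto simp: nb_def)
      have "d \<in> cover (insert s T - {t}) \<longleftrightarrow> d \<in> cover (T - {s} - {t})" if "d \<in> nsets t 2" for d
        using False s that by (auto simp: nb_def cover_def)
      then have "vacancy p (insert s T) t = vacancy p (T - {s}) t"
        unfolding vacancy_def by (intro prod.cong) auto
      then show ?thesis using False \<open>s \<noteq> t\<close> by (simp add: r_def)
    qed
  qed
  have upd: "refresh p p' m G t T = (if t \<in> \<Omega> then upd t T else return_pmf T)" if "t \<in> triples" for t T
    using that by (simp add: refresh_def upd_def iter_attempt r_def \<Omega>_def)
  \<comment> \<open>Triangles outside \<open>\<Omega>\<close> are never touched, so a sweep over all
    triples is a heat-bath sweep over \<open>\<Omega>\<close>.\<close>
  have filt: "iter_pmf (refresh p p' m G) ts T = iter_pmf upd (filter (\<lambda>t. t \<in> \<Omega>) ts) T"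
    if "set ts \<subseteq> triples" for ts T
    using that by (induction ts arbitrary: T) (auto simp: upd bind_return_pmf intro!: bind_pmf_cong)
  have "iter_pmf (refresh p p' m G) xs = iter_pmf upd (filter (\<lambda>t. t \<in> \<Omega>) xs)"
    using filt[of xs] xs by auto
  then have "iter_pmf (\<lambda>_. iter_pmf (refresh p p' m G) xs) ys {}
    = iter_pmf (\<lambda>_. iter_pmf upd (filter (\<lambda>t. t \<in> \<Omega>) xs)) ys {}" by simp
  also have "d_TV \<dots> (triangle_law triples G) \<le> \<alpha> ^ length ys * card \<Omega>"
  proof (rule d_TV_sweeps)
    show "set (filter (\<lambda>t. t \<in> \<Omega>) xs) = \<Omega>" using xs \<Omega> by auto
    obtain c where c: "\<And>T. pmf (triangle_law triples G) T = (if T \<subseteq> triples then c * gibbs_weight G T else 0)"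
      using pmf_triangle_law[OF order_refl G] by blast
    show "set_pmf (triangle_law triples G) \<subseteq> Pow \<Omega>"
    proof
      fix T assume "T \<in> set_pmf (triangle_law triples G)"
      then have nz: "pmf (triangle_law triples G) T \<noteq> 0" by (simp add: set_pmf_iff)
      have "T \<subseteq> triples" by (rule ccontr) (use nz in \<open>simp add: c\<close>)
      moreover have "cover T \<subseteq> G" by (rule ccontr) (use nz in \<open>simp add: c gibbs_weight_def split: if_splits\<close>)
      ultimately show "T \<in> Pow \<Omega>" unfolding \<Omega>_def cover_def by blast
    qed
    show "bind_pmf (triangle_law triples G) (upd t) = triangle_law triples G" if t: "t \<in> \<Omega>" for t
    proof -
      have t': "t \<in> triples" "nsets t 2 \<subseteq> G" using t by (auto simp: \<Omega>_def)
      have "upd t = iter_pmf (\<lambda>_. attempt p p' t) [0..<m]"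
        using iter_attempt[OF t'(1), of "[0..<m]"] t'(1) by (auto simp: upd_def r_def)
      then show ?thesis
        using iter_pmf_stationary[of "[0..<m]" "triangle_law triples G" "\<lambda>_. attempt p p' t"]
          bind_triangle_law_attempt[OF G t'] by simp
    qed
  qed
  also have "\<alpha> ^ length ys * card \<Omega> \<le> \<alpha> ^ length ys * card triples"
    using \<Omega> \<alpha> card_mono[OF finite_triples[OF order_refl] \<Omega>]
    by (intro mult_left_mono) (auto intro!: zero_le_power heat_bath.\<alpha>(2)[OF heat_bath_axioms])
  finally show ?thesis .
qed

end


subsection \<open>Programs with bounded running time\<close>

abbreviation seq (infixr \<open>;;\<close> 60) where "c ;; d \<equiv> Seq c d"

lemma run_Skip: "run t (Skip, m) = return_pmf (Skip, m)"
  by (induction t) (simp_all add: bind_return_pmf)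

lemma run_add: "run (a + b) x = bind_pmf (run a x) (run b)"
proof (induction a arbitrary: x)
  case (Suc a)
  then have "run (a + b) = (\<lambda>x. bind_pmf (run a x) (run b))" by (rule ext)
  then show ?case by (simp add: bind_assoc_pmf)
qed (simp add: bind_return_pmf)

text \<open>\<open>T\<close> is an upper bound on the running time along all coin flips: a
  configuration with program \<open>Skip\<close> is a fixed point of \<open>step\<close>, so running
  longer changes nothing.\<close>

definition computes :: "prog \<Rightarrow> memory \<Rightarrow> memory pmf \<Rightarrow> nat \<Rightarrow> bool" where
  "computes c m D T \<longleftrightarrow> (\<forall>x \<in> set_pmf (run T (c, m)). fst x = Skip) \<and> D = map_pmf snd (run T (c, m))"

lemma computes_mono:
  assumes "computes c m D T" "T \<le> T'"
  shows "computes c m D T'"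
proof -
  obtain d where T': "T' = T + d" using assms(2) le_Suc_ex by blast
  have "run T' (c, m) = bind_pmf (run T (c, m)) return_pmf"
    unfolding T' run_add
  proof (intro bind_pmf_cong refl)
    fix x assume "x \<in> set_pmf (run T (c, m))"
    then have "fst x = Skip" using assms(1) by (auto simp: computes_def)
    then show "run d x = return_pmf x" by (cases x) (simp add: run_Skip)
  qed
  then show ?thesis using assms(1) by (simp add: computes_def bind_return_pmf')
qed

lemma computes_Skip: "computes Skip m (return_pmf m) 0"
  by (simp add: computes_def)

lemma computes_step:
  assumes "\<And>c' m'. (c', m') \<in> set_pmf (step (c, m)) \<Longrightarrow> computes c' m' (E (c', m')) T"
  shows "computes c m (bind_pmf (step (c, m)) E) (Suc T)"
proof -
  have "map_pmf snd (run T y) = E y" if "y \<in> set_pmf (step (c, m))" for y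
    using assms[of "fst y" "snd y"] that by (simp add: computes_def)
  then have "bind_pmf (step (c, m)) E = bind_pmf (step (c, m)) (\<lambda>y. map_pmf snd (run T y))"
    by (intro bind_pmf_cong refl) simp
  moreover have "fst x = Skip" if "y \<in> set_pmf (step (c, m))" "x \<in> set_pmf (run T y)" for x y
    using assms[of "fst y" "snd y"] that by (simp add: computes_def)
  ultimately show ?thesis by (auto simp: computes_def map_bind_pmf)
qed

lemma computes_Assign: "computes (Assign a b) m (return_pmf (m(eval_expr a m := eval_expr b m))) 1"
  by (simp add: computes_def bind_return_pmf)

lemma computes_Flip:
  "computes (Flip a) m (map_pmf (\<lambda>b. m(eval_expr a m := of_bool b)) (bernoulli_pmf (1/2))) 1"
  by (auto simp: computes_def map_bind_pmf bind_map_pmf map_pmf_def bind_assoc_pmf bind_return_pmf)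

lemma computes_SkipD: "computes Skip m D T \<Longrightarrow> D = return_pmf m"
  by (simp add: computes_def run_Skip)

text \<open>The additional 1 pays for the step that discards the finished \<open>Skip\<close> in
  front of \<open>d\<close>.\<close>

lemma computes_Seq:
  assumes "computes c m D T1" "\<And>m'. m' \<in> set_pmf D \<Longrightarrow> computes d m' (E m') T2"
  shows "computes (Seq c d) m (bind_pmf D E) (T1 + T2 + 1)"
  using assms
proof (induction T1 arbitrary: c m D)
  have base: "computes (Seq Skip d) m (bind_pmf D E) (Suc T)"
    if "D = return_pmf m" "T2 \<le> T" "\<And>m'. m' \<in> set_pmf D \<Longrightarrow> computes d m' (E m') T2" for D m T
    using computes_step[of "Seq Skip d" m "\<lambda>x. E (snd x)" T] that
    by (auto simp: bind_return_pmf intro: computes_mono)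
  {
    case 0
    then have "c = Skip" by (simp add: computes_def)
    then show ?case using base[of D m T2] 0 computes_SkipD by auto
  next
    case (Suc T)
    show ?case
    proof (cases "c = Skip")
      case True
      then show ?thesis using base[of D m "Suc T + T2"] Suc.prems computes_SkipD by auto
    next
      case False
      define D' where "D' y = map_pmf snd (run T y)" for y
      have D: "D = bind_pmf (step (c, m)) D'"
        using Suc.prems(1) by (simp add: computes_def D'_def[abs_def] map_bind_pmf)
      have halt: "computes c' m' (D' (c', m')) T" if "(c', m') \<in> set_pmf (step (c, m))" for c' m'
        using Suc.prems(1) that by (auto simp: computes_def D'_def)
      have IH: "computes (Seq c' d) m' (bind_pmf (D' (c', m')) E) (T + T2 + 1)"
        if "(c', m') \<in> set_pmf (step (c, m))" for c' m'
        using that by (intro Suc.IH halt Suc.prems(2)) (auto simp: D)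
      \<comment> \<open>The second branch only makes \<open>F\<close> total: as \<open>c\<close> is
        not \<open>Skip\<close>, every successor of \<open>Seq c d\<close> is again of the form
        \<open>Seq\<close>.\<close>
      define F where "F = (\<lambda>x. case x of (Seq c' _, m') \<Rightarrow> bind_pmf (D' (c', m')) E | _ \<Rightarrow> return_pmf m)"
      have "computes (Seq c d) m (bind_pmf (step (Seq c d, m)) F) (Suc (T + T2 + 1))"
        using False by (intro computes_step) (auto simp: F_def IH[simplified])
      moreover have "bind_pmf (step (Seq c d, m)) F = bind_pmf D E"
        using False by (simp add: D bind_map_pmf bind_assoc_pmf F_def case_prod_unfold)
      ultimately show ?thesis by simp
    qed
  }
qed

lemma computes_Seq_return:
  "computes c m (return_pmf m') T1 \<Longrightarrow> computes d m' E T2 \<Longrightarrow> computes (Seq c d) m E (T1 + T2 + 1)"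
  using computes_Seq[of c m "return_pmf m'" T1 d "\<lambda>_. E" T2] by (simp add: bind_return_pmf)

text \<open>The continuation is indexed by the abstract state \<open>x\<close>. Its law depends only
  on the memory \<open>f x\<close>, being the output law of the run, and this is how it is turned
  into a function of the memory.\<close>

lemma computes_Seq_map:
  assumes "computes c m (map_pmf f \<mu>) T1" "\<And>x. x \<in> set_pmf \<mu> \<Longrightarrow> computes d (f x) (E x) T2"
  shows "computes (Seq c d) m (bind_pmf \<mu> E) (T1 + T2 + 1)"
proof -
  define E' where "E' m' = map_pmf snd (run T2 (d, m'))" for m'
  have *: "computes d (f x) (E' (f x)) T2" "E' (f x) = E x" if "x \<in> set_pmf \<mu>" for x
    using assms(2)[OF that] by (simp_all add: computes_def E'_def)
  have "computes (Seq c d) m (bind_pmf (map_pmf f \<mu>) E') (T1 + T2 + 1)"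
    by (rule computes_Seq[OF assms(1)]) (auto simp: *(1))
  moreover have "bind_pmf (map_pmf f \<mu>) E' = bind_pmf \<mu> E"
    unfolding bind_map_pmf by (intro bind_pmf_cong refl *)
  ultimately show ?thesis by simp
qed

lemma computes_Cond:
  assumes "eval_expr b m \<noteq> 0 \<Longrightarrow> computes c m D T" "eval_expr b m = 0 \<Longrightarrow> computes d m D T"
  shows "computes (Cond b c d) m D (Suc T)"
  using computes_step[of "Cond b c d" m "\<lambda>_. D" T] assms by (auto simp: bind_return_pmf)

lemma computes_While_stop: "eval_expr b m = 0 \<Longrightarrow> computes (While b c) m (return_pmf m) 1"
  using computes_step[of "While b c" m "\<lambda>_. return_pmf m" 0] computes_Skip by (simp add: bind_return_pmf)

lemma computes_While_step:
  "eval_expr b m \<noteq> 0 \<Longrightarrow> computes (Seq c (While b c)) m D T \<Longrightarrow> computes (While b c) m D (Suc T)"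
  using computes_step[of "While b c" m "\<lambda>_. D" T] by (simp add: bind_return_pmf)

text \<open>\<open>enc i s\<close> is the memory after \<open>i\<close> rounds with abstract state
  \<open>s\<close>. A round costs two steps beyond the body, one for the test and one for leaving
  the body; the last step is the failing test.\<close>

lemma computes_While:
  assumes test: "\<And>i s. i < N \<Longrightarrow> I s \<Longrightarrow> eval_expr b (enc i s) \<noteq> 0"
    and stop: "\<And>s. I s \<Longrightarrow> eval_expr b (enc N s) = 0"
    and body: "\<And>i s. i < N \<Longrightarrow> I s \<Longrightarrow> computes c (enc i s) (map_pmf (enc (Suc i)) (K i s)) T"
    and inv: "\<And>i s s'. i < N \<Longrightarrow> I s \<Longrightarrow> s' \<in> set_pmf (K i s) \<Longrightarrow> I s'"
    and s: "I s"
  shows "computes (While b c) (enc 0 s) (map_pmf (enc N) (iter_pmf K [0..<N] s)) (N * (T + 2) + 1)"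
proof -
  have "computes (While b c) (enc i s) (map_pmf (enc N) (iter_pmf K [i..<N] s)) ((N - i) * (T + 2) + 1)"
    if "i \<le> N" "I s" for i s
    using that
  proof (induction i arbitrary: s rule: inc_induct)
    case base
    then show ?case using computes_While_stop[OF stop] by simp
  next
    case (step i)
    have "computes (Seq c (While b c)) (enc i s)
        (bind_pmf (K i s) (\<lambda>s'. map_pmf (enc N) (iter_pmf K [Suc i..<N] s')))
        (T + ((N - Suc i) * (T + 2) + 1) + 1)"
    proof (rule computes_Seq_map)
      show "computes c (enc i s) (map_pmf (enc (Suc i)) (K i s)) T"
        by (rule body) (use step in auto)
      show "computes (While b c) (enc (Suc i) s') (map_pmf (enc N) (iter_pmf K [Suc i..<N] s'))
          ((N - Suc i) * (T + 2) + 1)" if "s' \<in> set_pmf (K i s)" for s'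
        by (rule step.IH, rule inv[of i s]) (use step that in auto)
    qed
    then have "computes (While b c) (enc i s)
        (bind_pmf (K i s) (\<lambda>s'. map_pmf (enc N) (iter_pmf K [Suc i..<N] s')))
        (Suc (T + ((N - Suc i) * (T + 2) + 1) + 1))"
      using step by (intro computes_While_step test)
    moreover have "Suc (T + ((N - Suc i) * (T + 2) + 1) + 1) = (N - i) * (T + 2) + 1"
    proof -
      obtain d where "N = Suc i + d" using step.hyps le_Suc_ex[of "Suc i" N] by auto
      then have "N - Suc i = d" "N - i = Suc d" by auto
      then show ?thesis by simp
    qed
    ultimately show ?case using step.hyps by (simp add: upt_conv_Cons map_bind_pmf)
  qed
  from this[of 0 s] s show ?thesis by simp
qed

subsection \<open>Registers\<close>

text \<open>The registers form a block of memory cells whose address \<open>L\<close> is kept in cell 2.\<close>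

definition regs :: "nat \<Rightarrow> nat list \<Rightarrow> memory \<Rightarrow> memory" where
  "regs L xs m = (\<lambda>a. if L \<le> a \<and> a < L + length xs then xs ! (a - L) else m a)"

definition reg_addr :: "nat \<Rightarrow> expr" where "reg_addr c = Add (Read (Lit 2)) (Lit c)"
definition reg :: "nat \<Rightarrow> expr" where "reg c = Read (reg_addr c)"

lemma regs_read: "c < length xs \<Longrightarrow> regs L xs m (L + c) = xs ! c"
  by (simp add: regs_def)

lemma regs_other: "a < L \<or> L + length xs \<le> a \<Longrightarrow> regs L xs m a = m a"
  by (auto simp: regs_def)

lemma regs_write: "c < length xs \<Longrightarrow> (regs L xs m)(L + c := v) = regs L (xs[c := v]) m"
  by (auto simp: regs_def fun_eq_iff nth_list_update)

lemma regs_write_other: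
  "a < L \<or> L + length xs \<le> a \<Longrightarrow> (regs L xs m)(a := v) = regs L xs (m(a := v))"
  by (auto simp: regs_def fun_eq_iff)

lemma eval_reg_addr: "2 < L \<Longrightarrow> m 2 = L \<Longrightarrow> eval_expr (reg_addr c) (regs L xs m) = L + c"
  by (simp add: reg_addr_def regs_other)

lemma eval_reg:
  "2 < L \<Longrightarrow> m 2 = L \<Longrightarrow> c < length xs \<Longrightarrow> eval_expr (reg c) (regs L xs m) = xs ! c"
  by (simp add: reg_def eval_reg_addr regs_read)

lemma computes_set_reg:
  assumes "2 < L" "m 2 = L" "c < length xs"
  shows "computes (Assign (reg_addr c) b) (regs L xs m)
    (return_pmf (regs L (xs[c := eval_expr b (regs L xs m)]) m)) 1"
  using computes_Assign[of "reg_addr c" b "regs L xs m"] assms by (simp add: eval_reg_addr regs_write)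

lemma computes_flip_reg:
  assumes "2 < L" "m 2 = L" "c < length xs"
  shows "computes (Flip (reg_addr c)) (regs L xs m)
    (map_pmf (\<lambda>b. regs L (xs[c := of_bool b]) m) (bernoulli_pmf (1/2))) 1"
  using computes_Flip[of "reg_addr c" "regs L xs m"] assms by (simp add: eval_reg_addr regs_write)


subsection \<open>Sampling from binary digits\<close>

definition truncate :: "nat \<Rightarrow> real \<Rightarrow> real" where
  "truncate n x = \<lfloor>x * 2 ^ n\<rfloor> / 2 ^ n"

lemma truncate_bounds:
  assumes "0 \<le> x"
  shows "0 \<le> truncate n x" "truncate n x \<le> x" "x - 1 / 2 ^ n \<le> truncate n x"
proof -
  show "0 \<le> truncate n x" using assms by (simp add: truncate_def)
  have "real_of_int \<lfloor>x * 2 ^ n\<rfloor> \<le> x * 2 ^ n" "x * 2 ^ n - 1 \<le> real_of_int \<lfloor>x * 2 ^ n\<rfloor>" by linarith+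
  then show "truncate n x \<le> x" "x - 1 / 2 ^ n \<le> truncate n x"
    by (simp_all add: truncate_def pos_divide_le_eq pos_le_divide_eq left_diff_distrib)
qed

text \<open>Nested floors: all digits of \<open>x\<close> become bits of one integer, the form in
  which \<open>iter_coin\<close> consumes them.\<close>

lemma floor_power2_div:
  fixes x :: real
  assumes "i \<le> n"
  shows "\<lfloor>x * 2 ^ i\<rfloor> = \<lfloor>x * 2 ^ n\<rfloor> div 2 ^ (n - i)"
proof -
  have "x * 2 ^ n / 2 ^ (n - i) = x * 2 ^ i"
    using assms by (simp add: power_diff)
  then show ?thesis using floor_divide_real_eq_div[of "2 ^ (n - i)" "x * 2 ^ n"] by simp
qed

lemma binary_digits_nth:
  assumes "i \<le> n"
  shows "binary_digits n x ! i = of_bool (odd (\<lfloor>x * 2 ^ n\<rfloor> div 2 ^ (n - i)))"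
  using assms nth_map[of i "[0..<Suc n]"]
  by (simp add: binary_digits_def floor_power2_div[OF assms] mod_2_eq_odd del: upt_Suc)

lemma bind_coin:
  assumes "v \<in> {0..1}"
  shows "bind_pmf (bernoulli_pmf v) (\<lambda>B. map_pmf (\<lambda>c. if c then D else B) (bernoulli_pmf (1/2)))
    = bernoulli_pmf ((of_bool D + v) / 2)"
proof (rule bernoulli_eqI)
  have "pmf (map_pmf (\<lambda>c. if c then D else B) (bernoulli_pmf (1/2))) True = (of_bool D + of_bool B) / 2" for B
    by (cases D; cases B) (auto simp: map_pmf_def pmf_bind)
  then show "pmf (bind_pmf (bernoulli_pmf v) (\<lambda>B. map_pmf (\<lambda>c. if c then D else B) (bernoulli_pmf (1/2)))) True
    = (of_bool D + v) / 2"
    using assms by (simp add: pmf_bind field_simps)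
qed

text \<open>Horner's scheme for a binary fraction, starting from its least significant digit: each
  round maps the bias \<open>v\<close> to (digit + \<open>v\<close>) / 2.\<close>

lemma iter_coin:
  fixes N :: int
  shows "iter_pmf (\<lambda>i B. map_pmf (\<lambda>c. if c then odd (N div 2 ^ i) else B) (bernoulli_pmf (1/2))) [0..<j] False
    = bernoulli_pmf ((N mod 2 ^ j) / 2 ^ j)"
proof (induction j)
  case 0
  have "bernoulli_pmf 0 = return_pmf False" by (rule bernoulli_eqI[symmetric]) simp
  then show ?case by simp
next
  case (Suc j)
  have "N mod 2 ^ Suc j = 2 ^ j * (N div 2 ^ j mod 2) + N mod 2 ^ j"
    using zmod_zmult2_eq[of 2 N "2 ^ j"] by (simp add: mult.commute)
  then have "N mod 2 ^ Suc j = 2 ^ j * of_bool (odd (N div 2 ^ j)) + N mod 2 ^ j"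
    by (simp add: mod_2_eq_odd)
  then have "real_of_int (N mod 2 ^ Suc j) / 2 ^ Suc j = (of_bool (odd (N div 2 ^ j)) + (N mod 2 ^ j) / 2 ^ j) / 2"
    by (simp add: field_simps)
  moreover have "real_of_int (N mod 2 ^ j) / 2 ^ j \<in> {0..1}"
  proof -
    have "N mod 2 ^ j \<le> 2 ^ j" "0 \<le> N mod 2 ^ j" by (simp_all add: order_less_imp_le)
    then have "real_of_int (N mod 2 ^ j) \<le> real_of_int (2 ^ j)" "0 \<le> real_of_int (N mod 2 ^ j)"
      unfolding of_int_le_iff by auto
    then show ?thesis by simp
  qed
  moreover have "iter_pmf f [j] = f j" for f :: "nat \<Rightarrow> bool \<Rightarrow> bool pmf"
  proof (rule ext)
    have "iter_pmf f [] = return_pmf" by (rule ext) simp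
    then show "iter_pmf f [j] B = f j B" for B by (simp add: bind_return_pmf')
  qed
  ultimately show ?case
    unfolding upt_Suc_append[OF le0] iter_pmf_append Suc by (simp only: bind_coin)
qed

lemma computes_set_reg_eq:
  assumes "2 < L" "m 2 = L" "c < length xs" "eval_expr b (regs L xs m) = v" "ys = xs[c := v]"
  shows "computes (Assign (reg_addr c) b) (regs L xs m) (return_pmf (regs L ys m)) 1"
  using computes_set_reg[of L m c xs b] assms by simp

text \<open>
  The digits are read from the last one to the first. A coin decides whether the current digit \<open>d\<close>
  replaces the bit obtained so far, which turns a bit of bias \<open>v\<close> into one of bias \<open>(d + v) / 2\<close>.
  Registers 0, 1 and 2 hold the coin, the position and the bit.
\<close>

definition bern :: "expr \<Rightarrow> prog" where
  "bern Q =
    Assign (reg_addr 1) (Read (Lit 0)) ;;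
    While (reg 1) (
      Flip (reg_addr 0) ;;
      Cond (reg 0) (Assign (reg_addr 2) (Read (Add Q (reg 1))) ;; Assign (reg_addr 0) (Lit 0)) Skip ;;
      Assign (reg_addr 1) (Sub (reg 1) (Lit 1))) ;;
    Cond (Read Q) (Assign (reg_addr 2) (Lit 1)) Skip"

lemma computes_bern:
  assumes L: "m 0 = n" "m 2 = L" "2 < L"
    and Q: "\<And>xs. eval_expr Q (regs L xs m) = q" "q + n < L"
    and digits: "\<And>i. i \<le> n \<Longrightarrow> m (q + i) = binary_digits n x ! i" and x: "0 \<le> x" "x \<le> 1"
  shows "computes (bern Q) (regs L (0 # 0 # 0 # ys) m)
    (map_pmf (\<lambda>b. regs L (0 # 0 # of_bool b # ys) m) (bernoulli_pmf (truncate n x))) (11 * n + 6)"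
proof -
  let ?keep = "Assign (reg_addr 2) (Read (Add Q (reg 1)))" and ?zero = "Assign (reg_addr 0) (Lit 0)"
  let ?C = "Cond (reg 0) (?keep ;; ?zero) Skip" and ?dec = "Assign (reg_addr 1) (Sub (reg 1) (Lit 1))"
  define N where "N = \<lfloor>x * 2 ^ n\<rfloor>"
  define R where "R i B = regs L (0 # (n - i) # of_bool B # ys) m" for i B
  define K where "K i B = map_pmf (\<lambda>c. if c then odd (N div 2 ^ i) else B) (bernoulli_pmf (1/2))" for i B
  note ev = eval_reg[where m = m, OF L(3,2)] eval_reg_addr[where m = m, OF L(3,2)]
  note set = computes_set_reg_eq[where m = m, OF L(3,2)]
  have digit: "m (q + i) = of_bool (odd (N div 2 ^ (n - i)))" if "i \<le> n" for i
    using digits[OF that] binary_digits_nth[OF that] by (simp add: N_def)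
  have body: "computes (Flip (reg_addr 0) ;; ?C ;; ?dec)
      (R i B) (map_pmf (R (Suc i)) (K i B)) 8" if i: "i < n" for i B
  proof -
    let ?d = "odd (N div 2 ^ i)"
    have "computes ?C
      (regs L (of_bool c # (n - i) # of_bool B # ys) m) (return_pmf (R i (if c then ?d else B))) 4" for c
    proof (rule computes_mono[OF computes_Cond[where T = 3]])
      have *: "m (q + (n - i)) = of_bool ?d" using digit[of "n - i"] i by simp
      assume "eval_expr (reg 0) (regs L (of_bool c # (n - i) # of_bool B # ys) m) \<noteq> 0"
      then have c: "c" by (simp add: ev)
      have "computes (Assign (reg_addr 2) (Read (Add Q (reg 1)))) (regs L (1 # (n - i) # of_bool B # ys) m)
          (return_pmf (regs L (1 # (n - i) # of_bool ?d # ys) m)) 1"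
      proof (rule set)
        show "eval_expr (Read (Add Q (reg 1))) (regs L (1 # (n - i) # of_bool B # ys) m) = of_bool ?d"
        proof -
          have "regs L (1 # (n - i) # of_bool B # ys) m (q + n - i) = of_bool ?d"
            using Q(2) i * by (subst regs_other) auto
          then show ?thesis using i by (simp add: ev Q(1))
        qed
      qed simp_all
      moreover have "computes (Assign (reg_addr 0) (Lit 0)) (regs L (1 # (n - i) # of_bool ?d # ys) m)
          (return_pmf (R i ?d)) 1" unfolding R_def by (rule set) simp_all
      ultimately have "computes (?keep ;; ?zero)
          (regs L (1 # (n - i) # of_bool B # ys) m) (return_pmf (R i ?d)) (1 + 1 + 1)"
        by (rule computes_Seq_return)
      then show "computes (?keep ;; ?zero)
          (regs L (of_bool c # (n - i) # of_bool B # ys) m) (return_pmf (R i (if c then ?d else B))) 3"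
        using c by (simp add: numeral_3_eq_3)
    next
      assume "eval_expr (reg 0) (regs L (of_bool c # (n - i) # of_bool B # ys) m) = 0"
      then have c: "\<not> c" by (simp add: ev)
      then show "computes Skip (regs L (of_bool c # (n - i) # of_bool B # ys) m) (return_pmf (R i (if c then ?d else B))) 3"
        using computes_mono[OF computes_Skip] by (simp add: R_def)
    qed simp
    moreover have "computes ?dec (R i B') (return_pmf (R (Suc i) B')) 1" for B'
      unfolding R_def by (rule set) (simp_all add: ev)
    ultimately have rest: "computes (?C ;; ?dec)
      (regs L (of_bool c # (n - i) # of_bool B # ys) m) (return_pmf (R (Suc i) (if c then ?d else B))) (4 + 1 + 1)" for c
      by (rule computes_Seq_return)
    have flip: "computes (Flip (reg_addr 0)) (R i B)
        (map_pmf (\<lambda>c. regs L (of_bool c # (n - i) # of_bool B # ys) m) (bernoulli_pmf (1/2))) 1"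
      using computes_flip_reg[where m = m, OF L(3,2), of 0 "0 # (n - i) # of_bool B # ys"]
      unfolding R_def by simp
    have "map_pmf (R (Suc i)) (K i B)
        = bind_pmf (bernoulli_pmf (1/2)) (\<lambda>c. return_pmf (R (Suc i) (if c then ?d else B)))"
      by (simp add: K_def map_pmf_def bind_assoc_pmf bind_return_pmf)
    with computes_Seq_map[OF flip rest] show ?thesis by simp
  qed
  have "computes (While (reg 1)
      (Flip (reg_addr 0) ;; ?C ;; ?dec))
    (R 0 False) (map_pmf (R n) (iter_pmf K [0..<n] False)) (n * (8 + 2) + 1)"
  proof (rule computes_While[where I = "\<lambda>_. True"])
    show "eval_expr (reg 1) (R i B) \<noteq> 0" if "i < n" for i B using that by (simp add: R_def ev)
    show "eval_expr (reg 1) (R n B) = 0" for B by (simp add: R_def ev)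
  qed (simp_all only: body)
  moreover have "iter_pmf K [0..<n] False = bernoulli_pmf ((N mod 2 ^ n) / 2 ^ n)"
    unfolding K_def by (rule iter_coin)
  \<comment> \<open>The integer digit is 1 only for \<open>x = 1\<close>. The fractional digits are
    then all 0, and the final test replaces the result by a sure success.\<close>
  moreover have "computes (Cond (Read Q) (Assign (reg_addr 2) (Lit 1)) Skip) (R n B)
      (return_pmf (R n (x = 1 \<or> B))) 2" for B
  proof (rule computes_mono[OF computes_Cond[where T = 1]])
    have "m q = of_bool (odd \<lfloor>x\<rfloor>)"
      using digit[of 0] floor_power2_div[of 0 n x] by (simp add: N_def)
    also have "odd \<lfloor>x\<rfloor> \<longleftrightarrow> x = 1"
    proof (cases "x = 1")
      case False
      then have "\<lfloor>x\<rfloor> = 0" using x by (simp add: floor_eq_iff)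
      then show ?thesis using False by simp
    qed simp
    finally have mq: "m q = of_bool (x = 1)" .
    have Rq: "eval_expr (Read Q) (R n B) = of_bool (x = 1)"
      using Q by (simp add: R_def regs_other mq)
    show "computes (Assign (reg_addr 2) (Lit 1)) (R n B) (return_pmf (R n (x = 1 \<or> B))) 1"
      if "eval_expr (Read Q) (R n B) \<noteq> 0"
    proof -
      have "x = 1" using that unfolding Rq by simp
      then show ?thesis unfolding R_def by (intro set) simp_all
    qed
    show "computes Skip (R n B) (return_pmf (R n (x = 1 \<or> B))) 1"
      if "eval_expr (Read Q) (R n B) = 0"
      using computes_mono[OF computes_Skip, of 1] that unfolding Rq by simp
  qed simp
  ultimately have "computes (While (reg 1) (Flip (reg_addr 0) ;; ?C ;; ?dec) ;;
      Cond (Read Q) (Assign (reg_addr 2) (Lit 1)) Skip)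
    (R 0 False) (bind_pmf (bernoulli_pmf ((N mod 2 ^ n) / 2 ^ n)) (\<lambda>B. return_pmf (R n (x = 1 \<or> B))))
    ((n * (8 + 2) + 1) + 2 + 1)"
    by (intro computes_Seq_map) simp_all
  moreover have "computes (Assign (reg_addr 1) (Read (Lit 0))) (regs L (0 # 0 # 0 # ys) m) (return_pmf (R 0 False)) 1"
    unfolding R_def by (rule set) (use L in \<open>simp_all add: regs_other\<close>)
  ultimately have "computes (bern Q) (regs L (0 # 0 # 0 # ys) m)
    (bind_pmf (bernoulli_pmf ((N mod 2 ^ n) / 2 ^ n)) (\<lambda>B. return_pmf (R n (x = 1 \<or> B))))
    (1 + ((n * (8 + 2) + 1) + 2 + 1) + 1)"
    unfolding bern_def using computes_Seq_return by blast
  moreover have "bind_pmf (bernoulli_pmf ((N mod 2 ^ n) / 2 ^ n)) (\<lambda>B. return_pmf (R n (x = 1 \<or> B)))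
    = map_pmf (\<lambda>b. regs L (0 # 0 # of_bool b # ys) m) (bernoulli_pmf (truncate n x))"
  proof (cases "x = 1")
    case True
    have "bernoulli_pmf 1 = return_pmf True" by (rule bernoulli_eqI[symmetric]) simp
    then show ?thesis using True by (simp add: truncate_def R_def)
  next
    case False
    have "N < 2 ^ n" "0 \<le> N" using x False by (simp_all add: N_def floor_less_iff)
    then have "truncate n x = (N mod 2 ^ n) / 2 ^ n" by (simp add: truncate_def N_def)
    then show ?thesis using False by (simp add: R_def map_pmf_def)
  qed
  ultimately show ?thesis using computes_mono by fastforce
qed


subsection \<open>Loops over registers\<close>

fun straight :: "prog \<Rightarrow> bool" where
  "straight Skip \<longleftrightarrow> True"
| "straight (Assign a b) \<longleftrightarrow> True"
| "straight (Flip a) \<longleftrightarrow> False"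
| "straight (Seq c d) \<longleftrightarrow> straight c \<and> straight d"
| "straight (Cond b c d) \<longleftrightarrow> straight c \<and> straight d"
| "straight (While b c) \<longleftrightarrow> False"

text \<open>A deterministic semantics for programs without coins and loops, so that rewriting can
  evaluate them. The values at \<open>Flip\<close> and \<open>While\<close> are placeholders,
  excluded by \<open>straight\<close>; \<open>cost\<close> charges both branches of a conditional
  and is an upper bound.\<close>

fun exec :: "prog \<Rightarrow> memory \<Rightarrow> memory" where
  "exec Skip m = m"
| "exec (Assign a b) m = m(eval_expr a m := eval_expr b m)"
| "exec (Flip a) m = m"
| "exec (Seq c d) m = exec d (exec c m)"
| "exec (Cond b c d) m = (if eval_expr b m \<noteq> 0 then exec c m else exec d m)"
| "exec (While b c) m = m"

fun cost :: "prog \<Rightarrow> nat" where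
  "cost (Seq c d) = cost c + cost d + 1"
| "cost (Cond b c d) = Suc (cost c + cost d)"
| "cost c = 1"

lemma computes_exec: "straight c \<Longrightarrow> computes c m (return_pmf (exec c m)) (cost c)"
proof (induction c arbitrary: m)
  case Skip
  then show ?case using computes_mono[OF computes_Skip] by simp
next
  case (Assign a b)
  then show ?case using computes_Assign[of a b m] by (simp add: fun_upd_def)
next
  case (Seq c d)
  then show ?case
    using computes_Seq_return[of c m "exec c m" "cost c" d "return_pmf (exec d (exec c m))" "cost d"] by simp
next
  case (Cond b c d)
  then have *: "computes c m (return_pmf (exec c m)) (cost c + cost d)"
    "computes d m (return_pmf (exec d m)) (cost c + cost d)"
    by (simp_all add: computes_mono[OF Cond.IH(1)] computes_mono[OF Cond.IH(2)])
  show ?case unfolding cost.simps by (rule computes_Cond) (simp_all add: *)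
qed simp_all

lemma computes_exec_eq: "straight c \<Longrightarrow> exec c m = m' \<Longrightarrow> cost c \<le> T \<Longrightarrow> computes c m (return_pmf m') T"
  using computes_exec computes_mono by blast

lemma computes_Seq_exec:
  assumes "computes c m (map_pmf f \<mu>) T" "straight d" "\<And>x. x \<in> set_pmf \<mu> \<Longrightarrow> exec d (f x) = g x"
  shows "computes (Seq c d) m (map_pmf g \<mu>) (T + cost d + 1)"
  unfolding map_pmf_def
  by (rule computes_Seq_map[OF assms(1)]) (use computes_exec[OF assms(2)] assms(3) in metis)

lemma computes_exec_Seq:
  assumes "straight c" "exec c m = m'" "computes d m' D T"
  shows "computes (Seq c d) m D (cost c + T + 1)"
  using computes_Seq_return[OF computes_exec[OF assms(1)]] assms(2,3) by blast

definition repeat_prog :: "nat \<Rightarrow> prog \<Rightarrow> prog" where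
  "repeat_prog c B = Seq (Assign (reg_addr c) (Read (Lit 0)))
    (While (reg c) (Seq B (Assign (reg_addr c) (Sub (reg c) (Lit 1)))))"

text \<open>Register \<open>c\<close> is 0 before and after the loop, so the loop acts on the state
  alone and can be nested in others. In return, the body has to behave uniformly in the counter
  value \<open>v\<close>.\<close>

lemma computes_repeat:
  assumes E: "\<And>s. I s \<Longrightarrow> E s 0 = n \<and> E s 2 = L" "2 < L" and c: "c < length xs" "xs ! c = 0"
    and body: "\<And>v s. I s \<Longrightarrow> computes B (regs L (xs[c := v]) (E s)) (map_pmf (\<lambda>s. regs L (xs[c := v]) (E s)) (K s)) T"
    and inv: "\<And>s s'. I s \<Longrightarrow> s' \<in> set_pmf (K s) \<Longrightarrow> I s'" and s: "I s"
  shows "computes (repeat_prog c B) (regs L xs (E s))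
    (map_pmf (\<lambda>s. regs L xs (E s)) (iter_pmf (\<lambda>_. K) [0..<n] s)) (n * (T + 4) + 3)"
proof -
  define enc where "enc i s = regs L (xs[c := n - i]) (E s)" for i s
  have "computes (While (reg c) (Seq B (Assign (reg_addr c) (Sub (reg c) (Lit 1))))) (enc 0 s)
      (map_pmf (enc n) (iter_pmf (\<lambda>_. K) [0..<n] s)) (n * ((T + 1 + 1) + 2) + 1)"
  proof (rule computes_While[where I = I])
    fix i s assume I: "I s"
    show "eval_expr (reg c) (enc n s) = 0" using E(1)[OF I] E(2) c by (simp add: enc_def eval_reg)
    assume i: "i < n"
    then show "eval_expr (reg c) (enc i s) \<noteq> 0" using E(1)[OF I] E(2) c by (simp add: enc_def eval_reg)
    have "computes (Seq B (Assign (reg_addr c) (Sub (reg c) (Lit 1)))) (enc i s)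
      (map_pmf (enc (Suc i)) (K s)) (T + cost (Assign (reg_addr c) (Sub (reg c) (Lit 1))) + 1)"
      unfolding enc_def
    proof (rule computes_Seq_exec[OF body[OF I]])
      fix s' assume "s' \<in> set_pmf (K s)"
      then have "E s' 2 = L" using E(1) inv I by blast
      then show "exec (Assign (reg_addr c) (Sub (reg c) (Lit 1))) (regs L (xs[c := n - i]) (E s'))
          = regs L (xs[c := n - Suc i]) (E s')"
        using E(2) c by (simp add: eval_reg eval_reg_addr regs_write)
    qed simp
    then show "computes (Seq B (Assign (reg_addr c) (Sub (reg c) (Lit 1)))) (enc i s)
      (map_pmf (enc (Suc i)) (K s)) (T + 1 + 1)" by simp
  qed (use s inv in auto)
  then have "computes (repeat_prog c B) (regs L xs (E s))
    (map_pmf (enc n) (iter_pmf (\<lambda>_. K) [0..<n] s)) (cost (Assign (reg_addr c) (Read (Lit 0))) + (n * ((T + 1 + 1) + 2) + 1) + 1)"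
    unfolding repeat_prog_def
    by (rule computes_exec_Seq[rotated 2])
      (use E(1)[OF s] E(2) c in \<open>simp_all add: enc_def eval_reg_addr regs_write regs_other\<close>)
  moreover have "enc n = (\<lambda>s. regs L xs (E s))"
  proof -
    have "xs[c := 0] = xs" using c list_update_id[of xs c] by simp
    then show ?thesis by (simp add: enc_def[abs_def])
  qed
  ultimately have "computes (repeat_prog c B) (regs L xs (E s))
    (map_pmf (\<lambda>s. regs L xs (E s)) (iter_pmf (\<lambda>_. K) [0..<n] s)) (1 + (n * ((T + 1 + 1) + 2) + 1) + 1)" by simp
  then show ?thesis by (rule computes_mono) (simp add: algebra_simps)
qed

text \<open>
  Registers 4 to 9 hold the base-\<open>n\<close> digits \<open>k\<close>, \<open>j\<close>, \<open>i\<close> of a counter \<open>x\<close>, the addresses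
  of rows \<open>j\<close> and \<open>i\<close> of the adjacency matrix, and \<open>x\<close> itself.
\<close>

definition odometer :: "nat \<Rightarrow> nat \<Rightarrow> nat list" where
  "odometer n x = [x mod n, x div n mod n, x div n div n, 3 + x div n mod n * n, 3 + x div n div n * n, x]"

definition advance :: prog where
  "advance =
    Assign (reg_addr 9) (Add (reg 9) (Lit 1)) ;;
    Assign (reg_addr 4) (Add (reg 4) (Lit 1)) ;;
    Cond (Sub (Read (Lit 0)) (reg 4)) Skip (
      Assign (reg_addr 4) (Lit 0) ;;
      Assign (reg_addr 5) (Add (reg 5) (Lit 1)) ;;
      Assign (reg_addr 7) (Add (reg 7) (Read (Lit 0))) ;;
      Cond (Sub (Read (Lit 0)) (reg 5)) Skip (
        Assign (reg_addr 5) (Lit 0) ;;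
        Assign (reg_addr 7) (Lit 3) ;;
        Assign (reg_addr 6) (Add (reg 6) (Lit 1)) ;;
        Assign (reg_addr 8) (Add (reg 8) (Read (Lit 0)))))"

definition clear :: prog where
  "clear =
    Assign (reg_addr 4) (Lit 0) ;; Assign (reg_addr 5) (Lit 0) ;; Assign (reg_addr 6) (Lit 0) ;;
    Assign (reg_addr 7) (Lit 0) ;; Assign (reg_addr 8) (Lit 0) ;; Assign (reg_addr 9) (Lit 0)"

text \<open>The leading digit of the odometer is not reduced modulo \<open>n\<close>; it reaches
  \<open>n\<close> exactly when the counter reaches \<open>n * n * n\<close>, which ends the loop.
  Rows start at address 3, right after the three header cells.\<close>

definition sweep :: "prog \<Rightarrow> prog" where
  "sweep B =
    (Assign (reg_addr 7) (Lit 3) ;; Assign (reg_addr 8) (Lit 3)) ;;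
    While (Sub (Read (Lit 0)) (reg 6)) (B ;; advance) ;;
    clear"

text \<open>Registers 0 to 3 are scratch space, zero whenever a loop body starts or ends.
  \<open>v\<close> and \<open>w\<close> sit in registers 10 and 11, the counters of the loops over
  attempts and over sweeps.\<close>

definition scene :: "nat \<Rightarrow> nat list \<Rightarrow> nat \<Rightarrow> nat \<Rightarrow> memory \<Rightarrow> memory" where
  "scene L xs v w m = regs L ([0, 0, 0, 0] @ xs @ [v, w]) m"

lemma exec_advance:
  assumes "m 0 = n" "m 2 = L" "2 < L" "0 < n"
  shows "exec advance (scene L (odometer n x) v w m) = scene L (odometer n (Suc x)) v w m"
proof -
  note ev = eval_reg[where m = m, OF assms(3,2)] eval_reg_addr[where m = m, OF assms(3,2)] regs_write regs_other scene_def odometer_def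
  consider "Suc (x mod n) < n" | "Suc (x mod n) = n" "Suc (x div n mod n) < n"
    | "Suc (x mod n) = n" "Suc (x div n mod n) = n"
    using assms(4) mod_less_divisor[of n x] mod_less_divisor[of n "x div n"] by linarith
  then show ?thesis
  proof cases
    case 1
    then have "Suc x mod n = Suc (x mod n)" "Suc x div n = x div n" by (auto simp: mod_Suc div_Suc)
    then show ?thesis using 1 assms(1,3) by (simp add: advance_def ev)
  next
    case 2
    then have "Suc x mod n = 0" "Suc x div n = Suc (x div n)" by (auto simp: mod_Suc div_Suc)
    moreover have "Suc (x div n) mod n = Suc (x div n mod n)" "Suc (x div n) div n = x div n div n"
      using 2 by (auto simp: mod_Suc div_Suc)
    ultimately show ?thesis using 2 assms(1,3) by (simp add: advance_def ev add_ac)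
  next
    case 3
    then have "Suc x mod n = 0" "Suc x div n = Suc (x div n)" by (auto simp: mod_Suc div_Suc)
    moreover have "Suc (x div n) mod n = 0" "Suc (x div n) div n = Suc (x div n div n)"
      using 3 by (auto simp: mod_Suc div_Suc)
    ultimately show ?thesis using 3 assms(1,3) by (simp add: advance_def ev add_ac)
  qed
qed

lemma computes_sweep:
  assumes E: "\<And>s. I s \<Longrightarrow> E s 0 = n \<and> E s 2 = L" "2 < L"
    and body: "\<And>x s. x < n * n * n \<Longrightarrow> I s \<Longrightarrow> computes B (scene L (odometer n x) v w (E s))
      (map_pmf (\<lambda>s. scene L (odometer n x) v w (E s)) (K x s)) T"
    and inv: "\<And>x s s'. x < n * n * n \<Longrightarrow> I s \<Longrightarrow> s' \<in> set_pmf (K x s) \<Longrightarrow> I s'" and s: "I s"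
  shows "computes (sweep B) (scene L [0, 0, 0, 0, 0, 0] v w (E s))
    (map_pmf (\<lambda>s. scene L [0, 0, 0, 0, 0, 0] v w (E s)) (iter_pmf K [0..<n * n * n] s))
    (n * n * n * (T + 25) + 25)"
proof -
  define enc where "enc x s = scene L (odometer n x) v w (E s)" for x s
  have digit: "x div n div n < n \<longleftrightarrow> x < n * n * n" if "0 < n" for x
    using that by (simp add: div_mult2_eq[symmetric] div_less_iff_less_mult mult.assoc)
  have "computes (While (Sub (Read (Lit 0)) (reg 6)) (Seq B advance)) (enc 0 s)
      (map_pmf (enc (n * n * n)) (iter_pmf K [0..<n * n * n] s)) (n * n * n * ((T + cost advance + 1) + 2) + 1)"
  proof (rule computes_While[where I = I])
    fix x s assume I: "I s"
    show "eval_expr (Sub (Read (Lit 0)) (reg 6)) (enc (n * n * n) s) = 0"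
      using E(1)[OF I] E(2) digit[of "n * n * n"]
      by (cases "n = 0") (simp_all add: enc_def scene_def odometer_def eval_reg regs_other)
    assume x: "x < n * n * n"
    then have n: "0 < n" by (cases n) auto
    show "eval_expr (Sub (Read (Lit 0)) (reg 6)) (enc x s) \<noteq> 0"
      using E(1)[OF I] E(2) digit[OF n, of x] x by (simp add: enc_def scene_def odometer_def eval_reg regs_other)
    show "computes (Seq B advance) (enc x s) (map_pmf (enc (Suc x)) (K x s)) (T + cost advance + 1)"
      unfolding enc_def
    proof (rule computes_Seq_exec[OF body[OF x I]])
      show "straight advance" by (simp add: advance_def)
      fix s' assume "s' \<in> set_pmf (K x s)"
      then have "I s'" using inv x I by blast
      then show "exec advance (scene L (odometer n x) v w (E s')) = scene L (odometer n (Suc x)) v w (E s')"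
        using E n by (intro exec_advance) auto
    qed
  qed (use s inv in auto)
  moreover have "exec clear
      (enc (n * n * n) s') = scene L [0, 0, 0, 0, 0, 0] v w (E s')"
    if "s' \<in> set_pmf (iter_pmf K [0..<n * n * n] s)" for s'
  proof -
    \<comment> \<open>The invariant is known only for counters below \<open>n * n * n\<close>,
      whereas \<open>iter_pmf_invariant\<close> quantifies over all of them; the kernel is therefore
      continued by the identity.\<close>
    have "I s'"
    proof (rule iter_pmf_invariant[where f = "\<lambda>x s. if x < n * n * n then K x s else return_pmf s"])
      show "\<forall>s'\<in>set_pmf (if x < n * n * n then K x s else return_pmf s). I s'" if "I s" for x s
        using inv that by auto
      have "iter_pmf K xs s = iter_pmf (\<lambda>x s. if x < n * n * n then K x s else return_pmf s) xs s"
        if "set xs \<subseteq> {..<n * n * n}" for xs s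
        using that by (induction xs arbitrary: s) (auto intro!: bind_pmf_cong)
      then show "s' \<in> set_pmf (iter_pmf (\<lambda>x s. if x < n * n * n then K x s else return_pmf s) [0..<n * n * n] s)"
        using that by (auto simp: atLeast_upt)
    qed (rule s)
    then have "E s' 2 = L" using E(1) by blast
    then show ?thesis using E(2)
      by (simp add: clear_def enc_def scene_def odometer_def eval_reg_addr regs_write)
  qed
  moreover have "exec (Seq (Assign (reg_addr 7) (Lit 3)) (Assign (reg_addr 8) (Lit 3)))
      (scene L [0, 0, 0, 0, 0, 0] v w (E s)) = enc 0 s"
    using E(1)[OF s] E(2)
    by (simp add: enc_def scene_def odometer_def eval_reg_addr regs_write)
  ultimately have "computes (sweep B) (scene L [0, 0, 0, 0, 0, 0] v w (E s))
    (map_pmf (\<lambda>s. scene L [0, 0, 0, 0, 0, 0] v w (E s)) (iter_pmf K [0..<n * n * n] s))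
    (cost (Seq (Assign (reg_addr 7) (Lit 3)) (Assign (reg_addr 8) (Lit 3)))
     + ((n * n * n * ((T + cost advance + 1) + 2) + 1)
     + cost clear + 1) + 1)"
    unfolding sweep_def by (intro computes_exec_Seq computes_Seq_exec) (simp_all add: clear_def)
  then show ?thesis by (rule computes_mono) (simp add: advance_def clear_def algebra_simps)
qed

text \<open>Stores in cell 2 the address \<open>n * n + 3 * n + 6\<close> of the first cell after
  the input: three header cells, the matrix, and three blocks of \<open>n + 1\<close> digits. The
  square is formed by repeated addition, with cell 1 as counter.\<close>

definition prepare :: prog where
  "prepare =
    Seq (Seq (Assign (Lit 1) (Read (Lit 0)))
      (Assign (Lit 2) (Add (Add (Read (Lit 0)) (Add (Read (Lit 0)) (Read (Lit 0)))) (Lit 6))))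
    (While (Read (Lit 1)) (Seq (Assign (Lit 2) (Add (Read (Lit 2)) (Read (Lit 0)))) (Assign (Lit 1) (Sub (Read (Lit 1)) (Lit 1)))))"

lemma computes_prepare:
  assumes "m 0 = n"
  shows "computes prepare m (return_pmf (m(1 := 0, 2 := n * n + 3 * n + 6))) (5 * n + 5)"
proof -
  define enc where "enc i (u :: unit) = m(1 := n - i, 2 := i * n + 3 * n + 6)" for i u
  let ?B = "Seq (Assign (Lit 2) (Add (Read (Lit 2)) (Read (Lit 0)))) (Assign (Lit 1) (Sub (Read (Lit 1)) (Lit 1)))"
  have "computes (While (Read (Lit 1)) ?B) (enc 0 ())
    (map_pmf (enc n) (iter_pmf (\<lambda>_. return_pmf) [0..<n] ())) (n * (3 + 2) + 1)"
  proof (rule computes_While[where I = "\<lambda>_. True"])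
    fix i u assume "i < n"
    then show "computes ?B (enc i u) (map_pmf (enc (Suc i)) (return_pmf u)) 3"
      unfolding map_return_pmf
      by (intro computes_exec_eq) (use assms in \<open>auto simp: enc_def fun_eq_iff\<close>)
  qed (auto simp: enc_def)
  moreover have "iter_pmf (\<lambda>_. return_pmf) xs () = return_pmf ()" for xs :: "nat list"
    by (induction xs) (simp_all add: bind_return_pmf)
  ultimately have "computes (While (Read (Lit 1)) ?B) (enc 0 ()) (return_pmf (enc n ())) (n * (3 + 2) + 1)" by simp
  then have "computes prepare m (return_pmf (enc n ())) (cost (Seq (Assign (Lit 1) (Read (Lit 0)))
      (Assign (Lit 2) (Add (Add (Read (Lit 0)) (Add (Read (Lit 0)) (Read (Lit 0)))) (Lit 6)))) + (n * (3 + 2) + 1) + 1)"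
    unfolding prepare_def
    by (rule computes_exec_Seq[rotated 2]) (use assms in \<open>simp_all add: enc_def\<close>)
  then show ?thesis 
    unfolding enc_def diff_self_eq_0 by (rule computes_mono) simp
qed


subsection \<open>Memory layout\<close>

definition arr :: "nat \<Rightarrow> nat \<Rightarrow> (nat \<Rightarrow> nat) \<Rightarrow> memory \<Rightarrow> memory" where
  "arr base N f m = (\<lambda>a. if base \<le> a \<and> a < base + N then f (a - base) else m a)"

lemma arr_read: "i < N \<Longrightarrow> arr base N f m (base + i) = f i"
  by (simp add: arr_def)

lemma arr_other: "a < base \<or> base + N \<le> a \<Longrightarrow> arr base N f m a = m a"
  by (auto simp: arr_def)

lemma arr_write: "i < N \<Longrightarrow> (arr base N f m)(base + i := v) = arr base N (f(i := v)) m"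
  by (auto simp: arr_def fun_eq_iff)

lemma arr_write_other:
  "a < base \<or> base + N \<le> a \<Longrightarrow> (arr base N f m)(a := v) = arr base N f (m(a := v))"
  by (auto simp: arr_def fun_eq_iff)

lemma pair_code:
  fixes a b n :: nat
  assumes "a < n" "b < n"
  shows "(a * n + b) div n = a" "(a * n + b) mod n = b" "a * n + b < n * n"
proof -
  show "(a * n + b) div n = a" "(a * n + b) mod n = b" using assms by simp_all
  have "a * n + b < Suc a * n" using assms by simp
  also have "\<dots> \<le> n * n" using assms by (intro mult_le_mono) auto
  finally show "a * n + b < n * n" .
qed

lemma exec_set_reg:
  assumes "2 < L" "m 2 = L" "c < length xs"
  shows "exec (Assign (reg_addr c) b) (regs L xs m) = regs L (xs[c := eval_expr b (regs L xs m)]) m"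
  using assms by (simp add: eval_reg_addr regs_write)

text \<open>
  Above the registers lie, for each pair of vertices, the number of current triangles that contain
  it, and then, for each counter value of the odometer, the indicator that the triple of its digits
  is a current triangle.
\<close>

locale machine =
  fixes n :: nat and p p' :: real and m0 :: memory and L :: nat
  assumes L: "L = n * n + 3 * n + 6"
    and m0: "m0 0 = n" "m0 2 = L"
    and p_digits: "\<And>i. i \<le> n \<Longrightarrow> m0 (n * n + 3 + i) = binary_digits n p ! i"
    and p'_digits: "\<And>i. i \<le> n \<Longrightarrow> m0 (n * n + 2 * n + 5 + i) = binary_digits n p' ! i"
    and p: "0 \<le> p" "p \<le> 1" and p': "0 \<le> p'" "p' \<le> 1"
begin

definition "enc A C R = arr 3 (n * n) A (arr (L + 19) (n * n) C (arr (L + L + 16) (n * n * n) R m0))"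
definition "cell a b = 3 + a * n + b"
text \<open>The twelve registers occupy \<open>L\<close> to \<open>L + 11\<close> and the counts
  start at \<open>L + 19\<close>. The address of a count is thus that of the matrix entry shifted by
  \<open>L + 16\<close>, computable by two additions.\<close>

definition "cov_addr a b = cell a b + L + 16"
definition "tri_addr x = L + L + (x + 16)"

lemma L_gt_2: "2 < L" by (simp add: L)

lemma cell_less_L: "a < n \<Longrightarrow> b < n \<Longrightarrow> cell a b < L"
  using pair_code(3)[of a n b] by (simp add: cell_def L)

lemma cov_addr_bounds: "a < n \<Longrightarrow> b < n \<Longrightarrow> L + 19 \<le> cov_addr a b \<and> cov_addr a b < L + L + 16"
  using cell_less_L[of a b] by (simp add: cov_addr_def cell_def)

lemma enc_fixed [simp]: "enc A C R 0 = n" "enc A C R 2 = L"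
  unfolding enc_def by (simp_all add: arr_other m0)

lemma enc_digits:
  "i \<le> n \<Longrightarrow> enc A C R (n * n + 3 + i) = binary_digits n p ! i"
  "i \<le> n \<Longrightarrow> enc A C R (n * n + 2 * n + 5 + i) = binary_digits n p' ! i"
  unfolding enc_def by (subst arr_other | simp add: L p_digits p'_digits)+

lemma enc_cell:
  assumes "a < n" "b < n"
  shows "enc A C R (cell a b) = A (a * n + b)"
    "(enc A C R)(cell a b := v) = enc (A(a * n + b := v)) C R"
  using arr_read[OF pair_code(3)[OF assms], of 3] arr_write[OF pair_code(3)[OF assms], of 3]
  by (simp_all add: enc_def cell_def add.assoc)

lemma enc_cov:
  assumes "a < n" "b < n"
  shows "enc A C R (cov_addr a b) = C (a * n + b)"
    "(enc A C R)(cov_addr a b := v) = enc A (C(a * n + b := v)) R"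
proof -
  have addr: "cov_addr a b = L + 19 + (a * n + b)" by (simp add: cov_addr_def cell_def)
  have out: "3 + n * n \<le> L + 19 + (a * n + b)" by (simp add: L)
  show "enc A C R (cov_addr a b) = C (a * n + b)"
    unfolding enc_def addr arr_other[OF disjI2[OF out]] by (rule arr_read[OF pair_code(3)[OF assms]])
  show "(enc A C R)(cov_addr a b := v) = enc A (C(a * n + b := v)) R"
    unfolding enc_def addr arr_write_other[OF disjI2[OF out]] arr_write[OF pair_code(3)[OF assms]] ..
qed

lemma enc_tri:
  assumes "x < n * n * n"
  shows "enc A C R (tri_addr x) = R x" "(enc A C R)(tri_addr x := v) = enc A C (R(x := v))"
proof -
  have addr: "tri_addr x = L + L + 16 + x" by (simp add: tri_addr_def)
  have out: "3 + n * n \<le> L + L + 16 + x" "L + 19 + n * n \<le> L + L + 16 + x" by (simp_all add: L)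
  show "enc A C R (tri_addr x) = R x"
    unfolding enc_def addr arr_other[OF disjI2[OF out(1)]] arr_other[OF disjI2[OF out(2)]] by (rule arr_read[OF assms])
  show "(enc A C R)(tri_addr x := v) = enc A C (R(x := v))"
    unfolding enc_def addr arr_write_other[OF disjI2[OF out(1)]] arr_write_other[OF disjI2[OF out(2)]]
      arr_write[OF assms] ..
qed

text \<open>Only entries above the diagonal are maintained. The others keep their input value, so
  that the input memory itself is the encoding of the input graph.\<close>

definition "adj G x = (if x div n < x mod n then of_bool ({x div n, x mod n} \<in> G) else m0 (3 + x))"
definition "cov T x = (if x div n < x mod n then card {t \<in> T. {x div n, x mod n} \<subseteq> t} else 0)"
definition "sorted_digits x \<longleftrightarrow> x div n div n < x div n mod n \<and> x div n mod n < x mod n"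
definition "triple x = {x div n div n, x div n mod n, x mod n}"
definition "tri T x = (of_bool (sorted_digits x \<and> triple x \<in> T) :: nat)"
definition "encode G T = enc (adj G) (cov T) (tri T)"

lemma adj_eq: "a < b \<Longrightarrow> b < n \<Longrightarrow> adj G (a * n + b) = of_bool ({a, b} \<in> G)"
  using pair_code[of a n b] by (simp add: adj_def)

lemma cov_eq: "a < b \<Longrightarrow> b < n \<Longrightarrow> cov T (a * n + b) = card {t \<in> T. {a, b} \<subseteq> t}"
  using pair_code[of a n b] by (simp add: cov_def)

lemma adj_update:
  assumes "a < b" "b < n"
  shows "(adj G)(a * n + b := of_bool c) = adj (if c then insert {a, b} G else G - {{a, b}})"
proof
  fix x
  show "((adj G)(a * n + b := of_bool c)) x = adj (if c then insert {a, b} G else G - {{a, b}}) x"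
  proof (cases "x = a * n + b")
    case True
    then show ?thesis using assms by (simp add: adj_eq)
  next
    case False
    then have "{x div n, x mod n} \<noteq> {a, b}" if "x div n < x mod n"
      using that assms(1) div_mult_mod_eq[of x n] by (auto simp: doubleton_eq_iff)
    then show ?thesis using False by (simp add: adj_def)
  qed
qed

text \<open>The digit blocks end just below \<open>L\<close>: the one of \<open>p\<close> starts at
  \<open>L - 3 * (n + 1)\<close>, the one of \<open>p'\<close> at
  \<open>L - (n + 1)\<close>.\<close>

definition "p_addr = Sub (Read (Lit 2)) (Add (Add (Read (Lit 0)) (Add (Read (Lit 0)) (Read (Lit 0)))) (Lit 3))"
definition "p'_addr = Sub (Read (Lit 2)) (Add (Read (Lit 0)) (Lit 1))"

lemma computes_bern_p:
  "computes (bern p_addr) (regs L (0 # 0 # 0 # ys) (enc A C R))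
    (map_pmf (\<lambda>b. regs L (0 # 0 # of_bool b # ys) (enc A C R)) (bernoulli_pmf (truncate n p))) (11 * n + 6)"
  by (rule computes_bern[where q = "n * n + 3"])
    (use L_gt_2 p in \<open>simp_all add: enc_digits(1) p_addr_def regs_other\<close>, simp_all add: L)

lemma computes_bern_p':
  "computes (bern p'_addr) (regs L (0 # 0 # 0 # ys) (enc A C R))
    (map_pmf (\<lambda>b. regs L (0 # 0 # of_bool b # ys) (enc A C R)) (bernoulli_pmf (truncate n p'))) (11 * n + 6)"
  by (rule computes_bern[where q = "n * n + 2 * n + 5"])
    (use L_gt_2 p' in \<open>simp_all add: enc_digits(2) p'_addr_def regs_other\<close>, simp_all add: L)

text \<open>The registers in the middle of a loop body: \<open>b\<close> is the latest coin,
  \<open>y\<close> the conjunction of the coins for the uncovered sides.\<close>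

definition "stage b y x v w M = regs L ([0, 0, of_bool b, of_bool y] @ odometer n x @ [v, w]) M"

lemma scene_stage: "scene L (odometer n x) v w M = stage False False x v w M"
  by (simp add: scene_def stage_def)

lemma stage_bern_p:
  "computes (bern p_addr) (stage False y x v w (enc A C R))
    (map_pmf (\<lambda>b. stage b y x v w (enc A C R)) (bernoulli_pmf (truncate n p))) (11 * n + 6)"
  using computes_bern_p by (simp add: stage_def)

lemma stage_bern_p':
  "computes (bern p'_addr) (stage False y x v w (enc A C R))
    (map_pmf (\<lambda>b. stage b y x v w (enc A C R)) (bernoulli_pmf (truncate n p'))) (11 * n + 6)"
  using computes_bern_p' by (simp add: stage_def)

lemma eval_reg_stage:
  assumes "c < 12"
  shows "eval_expr (reg c) (stage b y x v w (enc A C R)) = ([0, 0, of_bool b, of_bool y] @ odometer n x @ [v, w]) ! c"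
  unfolding stage_def by (rule eval_reg) (use assms L_gt_2 in \<open>simp_all add: odometer_def\<close>)

lemma exec_set_flag:
  "exec (Assign (reg_addr 2) (Lit 0)) (stage b y x v w (enc A C R)) = stage False y x v w (enc A C R)"
  "exec (Assign (reg_addr 3) (Lit 0)) (stage b y x v w (enc A C R)) = stage b False x v w (enc A C R)"
  "exec (Assign (reg_addr 3) (Lit 1)) (stage b y x v w (enc A C R)) = stage b True x v w (enc A C R)"
  unfolding stage_def
  by (subst exec_set_reg; simp add: L_gt_2)+

lemma stage_read:
  "stage b y x v w (enc A C R) 0 = n" "stage b y x v w (enc A C R) 2 = L"
  "a < L \<or> L + 12 \<le> a \<Longrightarrow> stage b y x v w M a = M a"
  unfolding stage_def by (subst regs_other; use L_gt_2 in \<open>auto simp: odometer_def\<close>)+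

lemma stage_write: "a < L \<or> L + 12 \<le> a \<Longrightarrow> (stage b y x v w M)(a := r) = stage b y x v w (M(a := r))"
  unfolding stage_def by (rule regs_write_other) (auto simp: odometer_def)

definition "cell_ij = Add (reg 8) (reg 5)"
definition "cell_ik = Add (reg 8) (reg 4)"
definition "cell_jk = Add (reg 7) (reg 4)"
definition "cov_expr e = Add (Add e (Read (Lit 2))) (Lit 16)"
definition "tri_expr = Add (Add (Read (Lit 2)) (Read (Lit 2))) (Add (reg 9) (Lit 16))"

lemma eval_cells:
  fixes x defines "i \<equiv> x div n div n" and "j \<equiv> x div n mod n" and "k \<equiv> x mod n"
  shows "eval_expr cell_ij (stage b y x v w (enc A C R)) = cell i j"
    "eval_expr cell_ik (stage b y x v w (enc A C R)) = cell i k"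
    "eval_expr cell_jk (stage b y x v w (enc A C R)) = cell j k"
    "eval_expr (cov_expr cell_ij) (stage b y x v w (enc A C R)) = cov_addr i j"
    "eval_expr (cov_expr cell_ik) (stage b y x v w (enc A C R)) = cov_addr i k"
    "eval_expr (cov_expr cell_jk) (stage b y x v w (enc A C R)) = cov_addr j k"
    "eval_expr tri_expr (stage b y x v w (enc A C R)) = tri_addr x"
  by (simp_all add: cell_ij_def cell_ik_def cell_jk_def cov_expr_def tri_expr_def eval_reg_stage odometer_def
      cell_def cov_addr_def tri_addr_def stage_read i_def j_def k_def)

definition "guard B = Cond (Sub (reg 5) (reg 6)) (Cond (Sub (reg 4) (reg 5)) B Skip) Skip"

lemma computes_guard:
  assumes "sorted_digits x \<Longrightarrow> computes B (stage b y x v w (enc A C R)) D T"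
    and "\<not> sorted_digits x \<Longrightarrow> D = return_pmf (stage b y x v w (enc A C R))"
  shows "computes (guard B) (stage b y x v w (enc A C R)) D (T + 2)"
proof -
  have "eval_expr (Sub (reg 5) (reg 6)) (stage b y x v w (enc A C R)) = x div n mod n - x div n div n"
    "eval_expr (Sub (reg 4) (reg 5)) (stage b y x v w (enc A C R)) = x mod n - x div n mod n"
    by (simp_all add: eval_reg_stage odometer_def)
  then have "computes (guard B) (stage b y x v w (enc A C R)) D (Suc (Suc T))"
    unfolding guard_def using assms computes_mono[OF computes_Skip]
    by (intro computes_Cond) (auto simp: sorted_digits_def)
  then show ?thesis by simp
qed

lemma sorted_digits_bounds:
  assumes "sorted_digits x"
  shows "x div n div n < n" "x div n mod n < n" "x mod n < n" "x < n * n * n"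
proof -
  have n: "0 < n"
  proof (rule ccontr)
    assume "\<not> 0 < n"
    then show False using assms unfolding sorted_digits_def by simp
  qed
  then show b: "x div n mod n < n" "x mod n < n" by simp_all
  then show "x div n div n < n" using assms by (simp add: sorted_digits_def)
  then show "x < n * n * n"
    using n by (simp add: div_mult2_eq[symmetric] div_less_iff_less_mult mult.assoc)
qed

lemma nsets_triple:
  assumes "sorted_digits x"
  shows "nsets (triple x) 2
    = {{x div n div n, x div n mod n}, {x div n div n, x mod n}, {x div n mod n, x mod n}}"
proof -
  obtain i j k where ijk: "x div n div n = i" "x div n mod n = j" "x mod n = k" by blast
  have "i < j" "j < k" using assms by (simp_all add: sorted_digits_def ijk)
  have "e \<in> nsets {i, j, k} 2 \<longleftrightarrow> e \<in> {{i, j}, {i, k}, {j, k}}" for e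
  proof
    assume "e \<in> nsets {i, j, k} 2"
    then have e: "e \<subseteq> {i, j, k}" "card e = 2" by (auto simp: nsets_def)
    then obtain a b where "e = {a, b}" "a \<noteq> b" by (auto simp: card_2_iff)
    then show "e \<in> {{i, j}, {i, k}, {j, k}}" using e(1) by auto
  qed (use \<open>i < j\<close> \<open>j < k\<close> in \<open>auto simp: nsets_def\<close>)
  then show ?thesis by (simp add: triple_def ijk set_eq_iff)
qed

section \<open>Adding triangles as a program\<close>

definition "mark =
  Cond (reg 2) (Assign cell_ij (Lit 1) ;; Assign cell_ik (Lit 1) ;; Assign cell_jk (Lit 1)) Skip ;;
  Assign (reg_addr 2) (Lit 0)"

lemma exec_mark:
  assumes "sorted_digits x"
  shows "exec mark (stage b False x v w (encode G T))
    = stage False False x v w (encode (if b then G \<union> nsets (triple x) 2 else G) T)"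
proof -
  obtain i j k where ijk: "x div n div n = i" "x div n mod n = j" "x mod n = k" by blast
  have s: "i < j" "j < k" "i < k" using assms by (auto simp: sorted_digits_def ijk)
  have bd: "i < n" "j < n" "k < n" using sorted_digits_bounds[OF assms] by (simp_all add: ijk)
  have one: "(adj G)(a * n + b := Suc 0) = adj (insert {a, b} G)" if "a < b" "b < n" for a b G
    using adj_update[OF that, of G True] by simp
  have G: "G \<union> nsets (triple x) 2 = insert {j, k} (insert {i, k} (insert {i, j} G))"
    using nsets_triple[OF assms] by (auto simp: ijk)
  show ?thesis
    using bd s unfolding mark_def encode_def G
    by (simp add: eval_reg_stage eval_cells[where x = x, unfolded ijk] stage_write cell_less_L enc_cell one
        exec_set_flag[simplified])
qed

lemma iter_pmf_filter_map:
  "iter_pmf (\<lambda>x s. if P x then f (g x) s else return_pmf s) xs s = iter_pmf f (map g (filter P xs)) s"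
  by (induction xs arbitrary: s) (auto simp: bind_return_pmf intro!: bind_pmf_cong)

definition "triple_list = map triple (filter sorted_digits [0..<n * n * n])"

lemma triple_inj:
  assumes "sorted_digits x" "sorted_digits y" "triple x = triple y"
  shows "x = y"
proof -
  obtain i j k where x: "x div n div n = i" "x div n mod n = j" "x mod n = k" by blast
  obtain i' j' k' where y: "y div n div n = i'" "y div n mod n = j'" "y mod n = k'" by blast
  have s: "i < j" "j < k" "i' < j'" "j' < k'" using assms by (auto simp: sorted_digits_def x y)
  have t: "{i, j, k} = {i', j', k'}" using assms by (simp add: triple_def x y)
  then have "i \<in> {i', j', k'}" "j \<in> {i', j', k'}" "k \<in> {i', j', k'}" "i' \<in> {i, j, k}" "j' \<in> {i, j, k}" "k' \<in> {i, j, k}"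
    by blast+
  then have "i = i'" "j = j'" "k = k'" using s by auto
  moreover have "x = (i * n + j) * n + k" "y = (i' * n + j') * n + k'"
    using div_mult_mod_eq[of x n] div_mult_mod_eq[of "x div n" n]
      div_mult_mod_eq[of y n] div_mult_mod_eq[of "y div n" n] by (simp_all add: x y)
  ultimately show ?thesis by simp
qed

lemma distinct_triple_list: "distinct triple_list"
  unfolding triple_list_def by (auto simp: distinct_map inj_on_def intro: triple_inj)

lemma set_triple_list: "set triple_list = nsets {..<n} 3"
proof
  show "set triple_list \<subseteq> nsets {..<n} 3"
  proof
    fix t assume "t \<in> set triple_list"
    then obtain x where x: "sorted_digits x" "t = triple x" by (auto simp: triple_list_def)
    then have "t \<subseteq> {..<n}" using sorted_digits_bounds[OF x(1)] by (simp add: triple_def)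
    moreover have "card t = 3" using x by (auto simp: triple_def sorted_digits_def)
    ultimately show "t \<in> nsets {..<n} 3" by (auto simp: nsets_def intro: finite_subset)
  qed
  show "nsets {..<n} 3 \<subseteq> set triple_list"
  proof
    fix t assume t: "t \<in> nsets {..<n} 3"
    then have "t \<in> nsets UNIV 3" "t \<subseteq> {..<n}" by (auto simp: nsets_def)
    then obtain i j k where ijk: "t = {i, j, k}" "i < j" "j < k" "k < n"
      by (auto simp: ordered_nsets_3_eq)
    define x where "x = (i * n + j) * n + k"
    have *: "x div n = i * n + j" "x mod n = k" "(i * n + j) div n = i" "(i * n + j) mod n = j"
      using ijk by (simp_all add: x_def)
    then have s: "sorted_digits x" "triple x = t"
      using ijk by (simp_all add: sorted_digits_def triple_def)
    then show "t \<in> set triple_list"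
      using sorted_digits_bounds(4)[OF s(1)] by (auto simp: triple_list_def)
  qed
qed

lemma initial_memory:
  assumes "\<And>a. L \<le> a \<Longrightarrow> m0 a = 0" "\<And>i j. i < n \<Longrightarrow> j < n \<Longrightarrow> m0 (3 + i * n + j) = of_bool ({i, j} \<in> G)"
  shows "scene L [0, 0, 0, 0, 0, 0] 0 0 (encode G {}) = m0"
proof -
  have *: "arr base N f m0 = m0" if "\<And>i. i < N \<Longrightarrow> f i = m0 (base + i)" for base N f
    using that by (force simp: arr_def fun_eq_iff)
  have "arr (L + L + 16) (n * n * n) (tri {}) m0 = m0" by (rule *) (simp add: tri_def assms(1))
  moreover have "arr (L + 19) (n * n) (cov {}) m0 = m0" by (rule *) (simp add: cov_def assms(1))
  moreover have "arr 3 (n * n) (adj G) m0 = m0"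
  proof (rule *)
    fix x assume x: "x < n * n"
    show "adj G x = m0 (3 + x)"
    proof (cases "n = 0")
      case False
      then have "x div n < n" "x mod n < n" using x by (auto simp: less_mult_imp_div_less)
      from assms(2)[OF this] show ?thesis by (simp add: adj_def add.assoc)
    qed (use x in simp)
  qed
  ultimately have "encode G {} = m0" by (simp add: encode_def enc_def)
  moreover have "regs L (replicate N 0) m0 = m0" for N
    by (auto simp: regs_def fun_eq_iff assms(1))
  moreover have "[0, 0, 0, 0] @ [0, 0, 0, 0, 0, 0] @ [0, 0] = replicate 12 (0 :: nat)"
    by (simp add: numeral_eq_Suc)
  ultimately show ?thesis unfolding scene_def by simp
qed

lemma output_encode:
  assumes "G \<subseteq> nsets {..<n} 2"
  shows "output_graph n (scene L xs v w (encode G T)) = G"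
proof -
  have "scene L xs v w (encode G T) (3 + i * n + j) = of_bool ({i, j} \<in> G)" if "i < j" "j < n" for i j
  proof -
    have "i < n" using that by simp
    then have "scene L xs v w (encode G T) (cell i j) = adj G (i * n + j)"
      unfolding scene_def encode_def using that cell_less_L[of i j] by (simp add: regs_other enc_cell)
    then show ?thesis using that by (simp add: adj_eq cell_def)
  qed
  then have "output_graph n (scene L xs v w (encode G T)) = {{i, j} | i j. i < j \<and> j < n \<and> {i, j} \<in> G}"
    unfolding output_graph_def by (intro Collect_cong ex_cong1 conj_cong refl) simp
  also have "\<dots> = G"
  proof -
    have "\<exists>i j. e = {i, j} \<and> i < j \<and> j < n" if "e \<in> G" for e
    proof -
      have "e \<in> nsets UNIV 2" "e \<subseteq> {..<n}" using that assms by (auto simp: nsets_def)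
      then show ?thesis by (auto simp: ordered_nsets_2_eq)
    qed
    then show ?thesis by blast
  qed
  finally show ?thesis .
qed

definition "mark_step t G = map_pmf (\<lambda>b. if b then G \<union> nsets t 2 else G) (bernoulli_pmf (truncate n p'))"

lemma computes_mark:
  "computes (guard (bern p'_addr ;; mark)) (scene L (odometer n x) v w (encode G T))
    (map_pmf (\<lambda>G. scene L (odometer n x) v w (encode G T))
      (if sorted_digits x then mark_step (triple x) G else return_pmf G)) (11 * n + 30)"
proof -
  have "computes (bern p'_addr ;; mark) (stage False False x v w (encode G T))
    (map_pmf (\<lambda>b. stage False False x v w (encode (if b then G \<union> nsets (triple x) 2 else G) T))
      (bernoulli_pmf (truncate n p'))) (11 * n + 6 + cost mark + 1)" if "sorted_digits x"
  proof (rule computes_Seq_exec[OF stage_bern_p'[where A = "adj G" and C = "cov T" and R = "tri T", folded encode_def]])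
    show "straight mark" by (simp add: mark_def)
  qed (rule exec_mark[OF that])
  then have "computes (guard (bern p'_addr ;; mark)) (stage False False x v w (encode G T))
    (map_pmf (\<lambda>G. stage False False x v w (encode G T))
      (if sorted_digits x then mark_step (triple x) G else return_pmf G)) (11 * n + 6 + cost mark + 1 + 2)"
    unfolding encode_def
    by (intro computes_guard) (auto simp: mark_step_def pmf.map_comp o_def)
  then show ?thesis unfolding scene_stage by (rule computes_mono) (simp add: mark_def)
qed

lemma iter_mark_step:
  "distinct ts \<Longrightarrow> iter_pmf mark_step ts G = map_pmf (\<lambda>T. G \<union> cover T) (random_subset (set ts) (truncate n p'))"
proof (induction ts arbitrary: G)
  case Nil
  then show ?case by (simp add: cover_def)
next
  case (Cons t ts)
  have "(if b then G \<union> nsets t 2 else G) \<union> cover T = G \<union> cover (if b then insert t T else T)" for b T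
    by (auto simp: cover_def)
  then show ?case using Cons
    by (simp add: random_subset_insert mark_step_def bind_map_pmf map_bind_pmf pmf.map_comp o_def)
qed

lemma computes_add_triangles:
  "computes (sweep (guard (bern p'_addr ;; mark))) (scene L [0, 0, 0, 0, 0, 0] 0 0 (encode G T))
    (map_pmf (\<lambda>G. scene L [0, 0, 0, 0, 0, 0] 0 0 (encode G T)) (add_triangles n (truncate n p') G))
    (n * n * n * (11 * n + 30 + 25) + 25)"
proof -
  have "computes (sweep (guard (bern p'_addr ;; mark))) (scene L [0, 0, 0, 0, 0, 0] 0 0 (encode G T))
    (map_pmf (\<lambda>G. scene L [0, 0, 0, 0, 0, 0] 0 0 (encode G T))
      (iter_pmf (\<lambda>x G. if sorted_digits x then mark_step (triple x) G else return_pmf G) [0..<n * n * n] G))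
    (n * n * n * (11 * n + 30 + 25) + 25)"
    by (rule computes_sweep[where I = "\<lambda>_. True"]) (auto simp: L_gt_2 encode_def computes_mark[unfolded encode_def])
  then show ?thesis
    unfolding iter_pmf_filter_map[where f = mark_step and g = triple]
    by (simp add: triple_list_def[symmetric] iter_mark_step distinct_triple_list set_triple_list add_triangles_def)
qed

end


subsection \<open>The Glauber dynamics as a program\<close>

text \<open>A product of biases is realised by the conjunction of independent coins; vacancies are
  sampled in this way, without multiplication.\<close>

lemma bernoulli_conj:
  assumes "a \<in> {0..1}" "c \<in> {0..1}"
  shows "bind_pmf (bernoulli_pmf a) (\<lambda>y. map_pmf (\<lambda>b. y \<and> b) (bernoulli_pmf c)) = bernoulli_pmf (a * c)"
proof (rule bernoulli_eqI)
  have "pmf (map_pmf (\<lambda>b. y \<and> b) (bernoulli_pmf c)) True = of_bool y * c" for y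
    using assms by (cases y) (simp_all add: map_pmf_def pmf_bind)
  then show "pmf (bind_pmf (bernoulli_pmf a) (\<lambda>y. map_pmf (\<lambda>b. y \<and> b) (bernoulli_pmf c))) True = a * c"
    using assms by (simp add: pmf_bind)
qed

lemma truncate_le_1: "x \<le> 1 \<Longrightarrow> 0 \<le> x \<Longrightarrow> truncate n x \<in> {0..1}"
  using truncate_bounds[of x n] by auto

context machine begin

definition "uncovered e = Cond (Sub (Read (cov_expr e)) (Read tri_expr)) Skip
  (bern p_addr ;; Cond (reg 2) Skip (Assign (reg_addr 3) (Lit 0)) ;; Assign (reg_addr 2) (Lit 0))"

lemma computes_uncovered:
  assumes "eval_expr (Sub (Read (cov_expr e)) (Read tri_expr)) (stage False y x v w (enc A C R)) \<noteq> 0 \<longleftrightarrow> d"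
  shows "computes (uncovered e) (stage False y x v w (enc A C R))
    (map_pmf (\<lambda>b. stage False (y \<and> b) x v w (enc A C R)) (bernoulli_pmf (if d then 1 else truncate n p))) (11 * n + 14)"
proof -
  have "computes (bern p_addr ;; Cond (reg 2) Skip (Assign (reg_addr 3) (Lit 0)) ;; Assign (reg_addr 2) (Lit 0))
      (stage False y x v w (enc A C R))
      (map_pmf (\<lambda>b. stage False (y \<and> b) x v w (enc A C R)) (bernoulli_pmf (truncate n p)))
      (11 * n + 6 + cost (Cond (reg 2) Skip (Assign (reg_addr 3) (Lit 0)) ;; Assign (reg_addr 2) (Lit 0)) + 1)"
  proof (rule computes_Seq_exec[OF stage_bern_p])
    show "exec (Cond (reg 2) Skip (Assign (reg_addr 3) (Lit 0)) ;; Assign (reg_addr 2) (Lit 0))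
        (stage b y x v w (enc A C R)) = stage False (y \<and> b) x v w (enc A C R)" for b
      by (cases b) (simp_all add: eval_reg_stage exec_set_flag[simplified])
  qed simp
  from computes_mono[OF this, of "11 * n + 13"] have "computes (bern p_addr ;; Cond (reg 2) Skip (Assign (reg_addr 3) (Lit 0)) ;; Assign (reg_addr 2) (Lit 0))
      (stage False y x v w (enc A C R))
      (map_pmf (\<lambda>b. stage False (y \<and> b) x v w (enc A C R)) (bernoulli_pmf (truncate n p))) (11 * n + 13)" by simp
  moreover have "bernoulli_pmf 1 = return_pmf True" by (rule bernoulli_eqI[symmetric]) simp
  ultimately show ?thesis
    unfolding uncovered_def using assms
    by (intro computes_mono[OF computes_Cond[where T = "11 * n + 13"]])
      (auto intro: computes_mono[OF computes_Skip])
qed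

lemma card_through:
  assumes "finite T" "e \<in> nsets t 2"
  shows "card {s \<in> T. e \<subseteq> s} = card {s \<in> T - {t}. e \<subseteq> s} + of_bool (t \<in> T)"
    "card {s \<in> T - {t}. e \<subseteq> s} \<noteq> 0 \<longleftrightarrow> e \<in> cover (T - {t})"
proof -
  have e: "e \<subseteq> t" "finite e" "card e = 2" using assms by (auto simp: nsets_def)
  show "card {s \<in> T. e \<subseteq> s} = card {s \<in> T - {t}. e \<subseteq> s} + of_bool (t \<in> T)"
  proof (cases "t \<in> T")
    case True
    then have "{s \<in> T. e \<subseteq> s} = insert t {s \<in> T - {t}. e \<subseteq> s}" using e by auto
    then show ?thesis using assms True by simp
  qed simp
  have "finite {s \<in> T - {t}. e \<subseteq> s}" using assms by simp
  then show "card {s \<in> T - {t}. e \<subseteq> s} \<noteq> 0 \<longleftrightarrow> e \<in> cover (T - {t})"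
    using e by (auto simp: cover_def nsets_def)
qed

lemma tri_eq: "sorted_digits x \<Longrightarrow> tri T x = of_bool (triple x \<in> T)"
  by (simp add: tri_def)

lemma tri_update:
  assumes "sorted_digits x"
  shows "(tri T)(x := of_bool c) = tri (if c then insert (triple x) T else T - {triple x})"
  using assms triple_inj[of _ x] by (auto simp: tri_def fun_eq_iff)

lemma cov_update:
  assumes x: "sorted_digits x" and T: "finite T"
    and ijk: "x div n div n = i" "x div n mod n = j" "x mod n = k"
  shows "(cov T)(i * n + j := cov (T - {triple x}) (i * n + j) + of_bool c,
      i * n + k := cov (T - {triple x}) (i * n + k) + of_bool c,
      j * n + k := cov (T - {triple x}) (j * n + k) + of_bool c)
    = cov (if c then insert (triple x) T else T - {triple x})"
proof
  fix z
  let ?t = "triple x" and ?T = "if c then insert (triple x) T else T - {triple x}"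
  have s: "i < j" "j < k" "i < k" using x by (auto simp: sorted_digits_def ijk)
  have bd: "i < n" "j < n" "k < n" using sorted_digits_bounds[OF x] by (simp_all add: ijk)
  have t: "?t = {i, j, k}" by (simp add: triple_def ijk)
  have T': "?T - {?t} = T - {?t}" "?t \<in> ?T \<longleftrightarrow> c" by auto
  have on: "cov ?T (a * n + b) = cov (T - {?t}) (a * n + b) + of_bool c"
    if "a < b" "b < n" "{a, b} \<subseteq> ?t" for a b
  proof -
    have "{a, b} \<in> nsets ?t 2" using that by (auto simp: nsets_def)
    from card_through(1)[OF _ this, of ?T] show ?thesis using T that T' by (simp add: cov_eq)
  qed
  have off: "cov ?T z = cov T z" if "z \<noteq> i * n + j" "z \<noteq> i * n + k" "z \<noteq> j * n + k"
  proof (cases "z div n < z mod n")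
    case True
    have "\<not> {z div n, z mod n} \<subseteq> ?t"
    proof
      assume "{z div n, z mod n} \<subseteq> ?t"
      then have "(z div n, z mod n) \<in> {(i, j), (i, k), (j, k)}" using True s by (auto simp: t)
      then show False using that div_mult_mod_eq[of z n] by auto
    qed
    then have "{s \<in> ?T. {z div n, z mod n} \<subseteq> s} = {s \<in> T. {z div n, z mod n} \<subseteq> s}" by auto
    then show ?thesis by (simp add: cov_def)
  qed (simp add: cov_def)
  show "((cov T)(i * n + j := cov (T - {?t}) (i * n + j) + of_bool c,
      i * n + k := cov (T - {?t}) (i * n + k) + of_bool c,
      j * n + k := cov (T - {?t}) (j * n + k) + of_bool c)) z = cov ?T z"
    using on[of i j] on[of i k] on[of j k] off s bd by (simp add: t)
qed

text \<open>Every update subtracts the old indicator before adding the new one, so it is correct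
  whether or not the triangle was present. The indicator is overwritten last because the three
  counts still read it.\<close>

definition "settle =
  Cond (reg 2)
    (Assign (cov_expr cell_ij) (Add (Sub (Read (cov_expr cell_ij)) (Read tri_expr)) (Lit 1)) ;;
     Assign (cov_expr cell_ik) (Add (Sub (Read (cov_expr cell_ik)) (Read tri_expr)) (Lit 1)) ;;
     Assign (cov_expr cell_jk) (Add (Sub (Read (cov_expr cell_jk)) (Read tri_expr)) (Lit 1)) ;;
     Assign tri_expr (Lit 1))
    (Cond (reg 3)
      (Assign (cov_expr cell_ij) (Sub (Read (cov_expr cell_ij)) (Read tri_expr)) ;;
       Assign (cov_expr cell_ik) (Sub (Read (cov_expr cell_ik)) (Read tri_expr)) ;;
       Assign (cov_expr cell_jk) (Sub (Read (cov_expr cell_jk)) (Read tri_expr)) ;;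
       Assign tri_expr (Lit 0))
      Skip) ;;
  Assign (reg_addr 2) (Lit 0) ;; Assign (reg_addr 3) (Lit 0)"

lemma cov_minus_tri:
  assumes "sorted_digits x" "finite T" "{a, b} \<in> nsets (triple x) 2" "a < b" "b < n"
  shows "cov T (a * n + b) - tri T x = cov (T - {triple x}) (a * n + b)"
  using card_through(1)[OF assms(2,3)] assms by (simp add: tri_eq cov_eq)

lemma exec_settle:
  assumes x: "sorted_digits x" and T: "finite T"
  shows "exec settle (stage b y x v w (encode G T))
    = stage False False x v w (encode G (if b then insert (triple x) T else if y then T - {triple x} else T))"
proof -
  obtain i j k where ijk: "x div n div n = i" "x div n mod n = j" "x mod n = k" by blast
  have s: "i < j" "j < k" "i < k" using x by (auto simp: sorted_digits_def ijk)
  have bd: "i < n" "j < n" "k < n" "x < n * n * n" using sorted_digits_bounds[OF x] by (simp_all add: ijk)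
  have e: "{i, j} \<in> nsets (triple x) 2" "{i, k} \<in> nsets (triple x) 2" "{j, k} \<in> nsets (triple x) 2"
    using nsets_triple[OF x] by (simp_all add: ijk)
  have "i * n + j \<noteq> i * n + k" "i * n + j \<noteq> j * n + k" "i * n + k \<noteq> j * n + k"
    using s bd pair_code(1)[of i n j] pair_code(1)[of j n k] pair_code(1)[of i n k] by (simp, (metis less_irrefl)+)
  moreover have "k \<noteq> j" "j \<noteq> k" "i \<noteq> j" "j \<noteq> i" "n \<noteq> 0" using s bd by auto
  ultimately have ne: "i * n + j \<noteq> j * n + k" "j * n + k \<noteq> i * n + j" "k \<noteq> j" "j \<noteq> k" "i \<noteq> j" "j \<noteq> i" "n \<noteq> 0"
    by auto
  have ltL: "L + 12 \<le> cov_addr a c" if "a < n" "c < n" for a c using cov_addr_bounds[OF that] by simp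
  have ltL': "L + 12 \<le> tri_addr x" by (simp add: tri_addr_def)
  note minus = cov_minus_tri[OF x T e(1) s(1) bd(2)] cov_minus_tri[OF x T e(2) s(3) bd(3)]
    cov_minus_tri[OF x T e(3) s(2) bd(3)]
  note rules = eval_reg_stage eval_cells[where x = x, unfolded ijk] stage_read(3) stage_write
    enc_cov enc_tri bd ltL ltL' ne minus exec_set_flag
  note upd = cov_update[OF x T ijk] tri_update[OF x]
  show ?thesis
  proof (cases b)
    case True
    then show ?thesis
      using upd(1)[of True] upd(2)[of T True] unfolding settle_def encode_def
      by (simp add: rules exec_set_flag[simplified])
  next
    case False
    then show ?thesis
      using upd(1)[of False] upd(2)[of T False] unfolding settle_def encode_def
      by (simp add: rules exec_set_flag[simplified])
  qed
qed

definition "attempt_prog =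
  Assign (reg_addr 3) (Lit 1) ;; uncovered cell_ij ;; uncovered cell_ik ;; uncovered cell_jk ;;
  bern p'_addr ;; settle"

lemma vacancy_triple:
  assumes "sorted_digits x" and ijk: "x div n div n = i" "x div n mod n = j" "x mod n = k"
  shows "vacancy r T (triple x) = (if {i, j} \<in> cover (T - {triple x}) then 1 else r) *
    ((if {i, k} \<in> cover (T - {triple x}) then 1 else r) * (if {j, k} \<in> cover (T - {triple x}) then 1 else r))"
proof -
  have s: "i < j" "j < k" using assms(1) by (auto simp: sorted_digits_def ijk)
  then have "{i, j} \<noteq> {i, k}" "{i, j} \<noteq> {j, k}" "{i, k} \<noteq> {j, k}" by (auto simp: doubleton_eq_iff)
  then show ?thesis unfolding vacancy_def nsets_triple[OF assms(1)] ijk by (simp add: mult.assoc)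
qed

lemma computes_attempt:
  assumes x: "sorted_digits x" and T: "finite T"
  shows "computes attempt_prog (stage False False x v w (encode G T))
    (map_pmf (\<lambda>T. stage False False x v w (encode G T)) (attempt (truncate n p) (truncate n p') (triple x) T))
    (44 * n + 100)"
proof -
  let ?r = "truncate n p" and ?r' = "truncate n p'" and ?t = "triple x"
  let ?S = "\<lambda>b y. stage b y x v w (encode G T)"
  obtain i j k where ijk: "x div n div n = i" "x div n mod n = j" "x mod n = k" by blast
  have s: "i < j" "j < k" "i < k" using x by (auto simp: sorted_digits_def ijk)
  have bd: "i < n" "j < n" "k < n" "x < n * n * n" using sorted_digits_bounds[OF x] by (simp_all add: ijk)
  have e: "{i, j} \<in> nsets ?t 2" "{i, k} \<in> nsets ?t 2" "{j, k} \<in> nsets ?t 2"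
    using nsets_triple[OF x] by (simp_all add: ijk)
  define d where "d a b \<longleftrightarrow> {a, b} \<in> cover (T - {?t})" for a b
  define \<nu> where "\<nu> a b = (if d a b then 1 else ?r)" for a b
  have r: "?r \<in> {0..1}" by (rule truncate_le_1[OF p(2,1)])
  have \<nu>: "\<nu> a b \<in> {0..1}" for a b using r by (simp add: \<nu>_def)
  have addr: "L + 12 \<le> cov_addr a c" "L + 12 \<le> tri_addr x" if "a < n" "c < n" for a c
    using cov_addr_bounds[OF that] by (simp_all add: tri_addr_def)
  have test: "eval_expr (Sub (Read (cov_expr c)) (Read tri_expr)) (?S False y) \<noteq> 0 \<longleftrightarrow> d a b"
    if "\<And>y. eval_expr (cov_expr c) (?S False y) = cov_addr a b" "{a, b} \<in> nsets ?t 2" "a < b" "b < n" for c a b y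
  proof -
    have "eval_expr (Sub (Read (cov_expr c)) (Read tri_expr)) (?S False y) = cov T (a * n + b) - tri T x"
      using that addr[of a b] bd unfolding encode_def
      by (simp add: eval_cells stage_read(3) enc_cov enc_tri)
    also have "\<dots> = cov (T - {?t}) (a * n + b)" by (rule cov_minus_tri[OF x T that(2-4)])
    finally show ?thesis using card_through(2)[OF T that(2)] that(3,4) by (simp add: cov_eq d_def)
  qed
  have edge: "computes (uncovered c) (?S False y) (map_pmf (\<lambda>b. ?S False (y \<and> b)) (bernoulli_pmf (\<nu> a b))) (11 * n + 14)"
    if "\<And>y. eval_expr (cov_expr c) (?S False y) = cov_addr a b" "{a, b} \<in> nsets ?t 2" "a < b" "b < n" for c a b y
    using computes_uncovered[OF test[OF that, unfolded encode_def]] by (simp add: \<nu>_def encode_def)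
  have cells: "eval_expr (cov_expr cell_ij) (?S False y) = cov_addr i j"
    "eval_expr (cov_expr cell_ik) (?S False y) = cov_addr i k"
    "eval_expr (cov_expr cell_jk) (?S False y) = cov_addr j k" for y
    unfolding encode_def by (simp_all add: eval_cells ijk)
  have edges: "computes (uncovered cell_ij) (?S False y) (map_pmf (\<lambda>b. ?S False (y \<and> b)) (bernoulli_pmf (\<nu> i j))) (11 * n + 14)"
    "computes (uncovered cell_ik) (?S False y) (map_pmf (\<lambda>b. ?S False (y \<and> b)) (bernoulli_pmf (\<nu> i k))) (11 * n + 14)"
    "computes (uncovered cell_jk) (?S False y) (map_pmf (\<lambda>b. ?S False (y \<and> b)) (bernoulli_pmf (\<nu> j k))) (11 * n + 14)" for y
    using edge[OF cells(1) e(1) s(1) bd(2)] edge[OF cells(2) e(2) s(3) bd(3)] edge[OF cells(3) e(3) s(2) bd(3)]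
    by blast+
  define D where "D y = map_pmf (\<lambda>b. stage False False x v w
    (encode G (if b then insert ?t T else if y then T - {?t} else T))) (bernoulli_pmf ?r')" for y
  have last: "computes (bern p'_addr ;; settle) (?S False y) (D y) (11 * n + 6 + cost settle + 1)" for y
    unfolding D_def
  proof (rule computes_Seq_exec[OF stage_bern_p'[where A = "adj G" and C = "cov T" and R = "tri T", folded encode_def]])
    show "straight settle" by (simp add: settle_def)
  qed (rule exec_settle[OF x T])
  have "computes (uncovered cell_jk ;; bern p'_addr ;; settle) (?S False y)
      (bind_pmf (bernoulli_pmf (\<nu> j k)) (\<lambda>b. D (y \<and> b))) (11 * n + 14 + (11 * n + 6 + cost settle + 1) + 1)" for y
    by (rule computes_Seq_map[OF edges(3) last])
  then have "computes (uncovered cell_ik ;; uncovered cell_jk ;; bern p'_addr ;; settle) (?S False y)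
      (bind_pmf (bernoulli_pmf (\<nu> i k)) (\<lambda>b'. bind_pmf (bernoulli_pmf (\<nu> j k)) (\<lambda>b. D ((y \<and> b') \<and> b))))
      (11 * n + 14 + (11 * n + 14 + (11 * n + 6 + cost settle + 1) + 1) + 1)" for y
    by (rule computes_Seq_map[OF edges(2)])
  then have "computes (uncovered cell_ij ;; uncovered cell_ik ;; uncovered cell_jk ;; bern p'_addr ;; settle) (?S False True)
      (bind_pmf (bernoulli_pmf (\<nu> i j)) (\<lambda>b''. bind_pmf (bernoulli_pmf (\<nu> i k)) (\<lambda>b'.
        bind_pmf (bernoulli_pmf (\<nu> j k)) (\<lambda>b. D (((True \<and> b'') \<and> b') \<and> b)))))
      (11 * n + 14 + (11 * n + 14 + (11 * n + 14 + (11 * n + 6 + cost settle + 1) + 1) + 1) + 1)"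
    by (rule computes_Seq_map[OF edges(1)])
  moreover have "exec (Assign (reg_addr 3) (Lit 1)) (?S False False) = ?S False True"
    unfolding encode_def by (rule exec_set_flag)
  ultimately have run: "computes attempt_prog (?S False False)
      (bind_pmf (bernoulli_pmf (\<nu> i j)) (\<lambda>b''. bind_pmf (bernoulli_pmf (\<nu> i k)) (\<lambda>b'.
        bind_pmf (bernoulli_pmf (\<nu> j k)) (\<lambda>b. D (((True \<and> b'') \<and> b') \<and> b)))))
      (cost (Assign (reg_addr 3) (Lit 1))
        + (11 * n + 14 + (11 * n + 14 + (11 * n + 14 + (11 * n + 6 + cost settle + 1) + 1) + 1) + 1) + 1)"
    unfolding attempt_prog_def by (intro computes_exec_Seq) simp_all
  \<comment> \<open>The conjunction of the three side coins has the product of their biases, which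
    is the vacancy.\<close>
  have bits: "bind_pmf (bernoulli_pmf (\<nu> i j)) (\<lambda>b''. bind_pmf (bernoulli_pmf (\<nu> i k)) (\<lambda>b'.
        bind_pmf (bernoulli_pmf (\<nu> j k)) (\<lambda>b. D (((True \<and> b'') \<and> b') \<and> b))))
      = bind_pmf (bernoulli_pmf (vacancy ?r T ?t)) D"
  proof -
    have "vacancy ?r T ?t = \<nu> i j * (\<nu> i k * \<nu> j k)"
      unfolding vacancy_triple[OF x ijk] \<nu>_def d_def ..
    moreover have "\<nu> i k * \<nu> j k \<in> {0..1}" using \<nu>[of i k] \<nu>[of j k] by (auto intro: mult_le_one)
    ultimately have "bernoulli_pmf (vacancy ?r T ?t) = bind_pmf (bernoulli_pmf (\<nu> i j)) (\<lambda>b''. map_pmf (\<lambda>b. b'' \<and> b)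
        (bind_pmf (bernoulli_pmf (\<nu> i k)) (\<lambda>b'. map_pmf (\<lambda>b. b' \<and> b) (bernoulli_pmf (\<nu> j k)))))"
      using \<nu> by (simp only: bernoulli_conj)
    then show ?thesis by (simp add: bind_assoc_pmf bind_map_pmf conj_assoc)
  qed
  have law: "bind_pmf (bernoulli_pmf (vacancy ?r T ?t)) D
      = map_pmf (\<lambda>T. stage False False x v w (encode G T)) (attempt ?r ?r' ?t T)"
    by (simp add: D_def[abs_def] attempt_def map_bind_pmf) (simp add: map_pmf_def)
  show ?thesis by (rule computes_mono[OF run[unfolded bits law]]) (simp add: settle_def)
qed

end


lemma computes_Cond_iff:
  assumes "eval_expr b m \<noteq> 0 \<longleftrightarrow> P" "P \<Longrightarrow> computes c m D T" "\<not> P \<Longrightarrow> computes d m D T"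
  shows "computes (Cond b c d) m D (Suc T)"
  by (rule computes_Cond) (use assms in auto)

context machine begin

definition "refresh_prog = guard (Cond (Read cell_ij) (Cond (Read cell_ik) (Cond (Read cell_jk)
  (repeat_prog 10 attempt_prog) Skip) Skip) Skip)"

lemma finite_attempt: "finite T \<Longrightarrow> T' \<in> set_pmf (attempt r r' t T) \<Longrightarrow> finite T'"
  by (auto simp: attempt_def split: if_splits)

lemma attempt_subset: "T \<subseteq> \<Omega> \<Longrightarrow> t \<in> \<Omega> \<Longrightarrow> T' \<in> set_pmf (attempt r r' t T) \<Longrightarrow> T' \<subseteq> \<Omega>"
  by (auto simp: attempt_def split: if_splits)

lemma refresh_subset:
  assumes "T \<subseteq> \<Omega>" "t \<in> \<Omega>" "T' \<in> set_pmf (refresh r r' l G t T)"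
  shows "T' \<subseteq> \<Omega>"
proof (cases "nsets t 2 \<subseteq> G")
  case True
  then have "T' \<in> set_pmf (iter_pmf (\<lambda>_. attempt r r' t) [0..<l] T)" using assms(3) by (simp add: refresh_def)
  with _ assms(1) show ?thesis
    by (rule iter_pmf_invariant[where P = "\<lambda>T. T \<subseteq> \<Omega>"]) (use attempt_subset assms(2) in blast)
qed (use assms in \<open>simp add: refresh_def\<close>)

lemma computes_refresh:
  assumes T: "finite T"
  shows "computes refresh_prog (scene L (odometer n x) 0 w (encode G T))
    (map_pmf (\<lambda>T. scene L (odometer n x) 0 w (encode G T))
      (if sorted_digits x then refresh (truncate n p) (truncate n p') n G (triple x) T else return_pmf T))
    (n * (44 * n + 104) + 8)"
proof -
  let ?D = "map_pmf (\<lambda>T. stage False False x 0 w (encode G T))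
      (if sorted_digits x then refresh (truncate n p) (truncate n p') n G (triple x) T else return_pmf T)"
  let ?m = "stage False False x 0 w (encode G T)"
  have "computes (Cond (Read cell_ij) (Cond (Read cell_ik) (Cond (Read cell_jk) (repeat_prog 10 attempt_prog) Skip) Skip) Skip)
    ?m ?D (n * (44 * n + 104) + 6)" if x: "sorted_digits x"
  proof -
    obtain i j k where ijk: "x div n div n = i" "x div n mod n = j" "x mod n = k" by blast
    have s: "i < j" "j < k" "i < k" using x by (auto simp: sorted_digits_def ijk)
    have bd: "i < n" "j < n" "k < n" using sorted_digits_bounds[OF x] by (simp_all add: ijk)
    let ?xs = "[0, 0, 0, 0] @ odometer n x @ [0, w]"
    have xs: "regs L (?xs[10 := v]) M = stage False False x v w M" for v M
      by (simp add: stage_def odometer_def)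
    have run: "computes (repeat_prog 10 attempt_prog) (regs L ?xs (encode G T)) (map_pmf (\<lambda>T. regs L ?xs (encode G T))
        (iter_pmf (\<lambda>_. attempt (truncate n p) (truncate n p') (triple x)) [0..<n] T)) (n * ((44 * n + 100) + 4) + 3)"
    proof (rule computes_repeat[where I = finite and c = 10])
      show "?xs ! 10 = 0" "10 < length ?xs" by (simp_all add: odometer_def)
      show "computes attempt_prog (regs L (?xs[10 := v]) (encode G T))
          (map_pmf (\<lambda>T. regs L (?xs[10 := v]) (encode G T)) (attempt (truncate n p) (truncate n p') (triple x) T)) (44 * n + 100)"
        if "finite T" for v T
        unfolding xs by (rule computes_attempt[OF x that])
    qed (use L_gt_2 T finite_attempt in \<open>auto simp: encode_def\<close>)
    have stage: "regs L ?xs M = stage False False x 0 w M" for M by (simp add: stage_def)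
    have rep: "computes (repeat_prog 10 attempt_prog) ?m (map_pmf (\<lambda>T. stage False False x 0 w (encode G T))
        (iter_pmf (\<lambda>_. attempt (truncate n p) (truncate n p') (triple x)) [0..<n] T)) (n * (44 * n + 104) + 3)"
      by (rule computes_mono[OF run[unfolded stage]]) simp
    have cells: "eval_expr (Read cell_ij) ?m \<noteq> 0 \<longleftrightarrow> {i, j} \<in> G" "eval_expr (Read cell_ik) ?m \<noteq> 0 \<longleftrightarrow> {i, k} \<in> G"
      "eval_expr (Read cell_jk) ?m \<noteq> 0 \<longleftrightarrow> {j, k} \<in> G"
      using s bd unfolding encode_def
      by (simp_all add: eval_cells ijk stage_read(3) cell_less_L enc_cell adj_eq)
    have sub: "nsets (triple x) 2 \<subseteq> G \<longleftrightarrow> {i, j} \<in> G \<and> {i, k} \<in> G \<and> {j, k} \<in> G"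
      unfolding nsets_triple[OF x] ijk by simp
    have stop: "computes Skip ?m ?D t" if "\<not> nsets (triple x) 2 \<subseteq> G" for t
      using that x computes_mono[OF computes_Skip] by (simp add: refresh_def)
    have go: "computes (repeat_prog 10 attempt_prog) ?m ?D (n * (44 * n + 104) + 3)" if "nsets (triple x) 2 \<subseteq> G"
      using rep that x by (simp add: refresh_def)
    have "computes (Cond (Read cell_jk) (repeat_prog 10 attempt_prog) Skip) ?m ?D (Suc (n * (44 * n + 104) + 3))"
      if "{i, j} \<in> G" "{i, k} \<in> G"
      by (rule computes_Cond_iff[OF cells(3)]; (rule stop | rule go); use that in \<open>simp add: sub\<close>)
    then have "computes (Cond (Read cell_ik) (Cond (Read cell_jk) (repeat_prog 10 attempt_prog) Skip) Skip) ?m ?D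
        (Suc (Suc (n * (44 * n + 104) + 3)))" if "{i, j} \<in> G"
      by (rule computes_Cond_iff[OF cells(2)]) (use that in \<open>simp_all add: sub stop\<close>)
    then have "computes (Cond (Read cell_ij) (Cond (Read cell_ik) (Cond (Read cell_jk) (repeat_prog 10 attempt_prog) Skip) Skip) Skip)
        ?m ?D (Suc (Suc (Suc (n * (44 * n + 104) + 3))))"
      by (rule computes_Cond_iff[OF cells(1)]) (simp_all add: sub stop)
    then show ?thesis by (rule computes_mono) simp
  qed
  then have "computes refresh_prog ?m ?D (n * (44 * n + 104) + 6 + 2)"
    unfolding refresh_prog_def encode_def by (intro computes_guard) simp_all
  then show ?thesis unfolding scene_stage by (rule computes_mono) simp
qed

definition "sweep_law G = iter_pmf (refresh (truncate n p) (truncate n p') n G) triple_list"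
definition "glauber_law G = iter_pmf (\<lambda>_. sweep_law G) [0..<n] {}"

lemma sweep_law_subset:
  assumes "T \<subseteq> nsets {..<n} 3" "T' \<in> set_pmf (sweep_law G T)"
  shows "T' \<subseteq> nsets {..<n} 3"
proof -
  have "T' \<subseteq> nsets {..<n} 3" if "set ts \<subseteq> nsets {..<n} 3" "T \<subseteq> nsets {..<n} 3"
    "T' \<in> set_pmf (iter_pmf (refresh (truncate n p) (truncate n p') n G) ts T)" for ts T
    using that
  proof (induction ts arbitrary: T)
    case (Cons t ts)
    then obtain T1 where T1: "T1 \<in> set_pmf (refresh (truncate n p) (truncate n p') n G t T)"
      "T' \<in> set_pmf (iter_pmf (refresh (truncate n p) (truncate n p') n G) ts T1)" by auto
    have "T1 \<subseteq> nsets {..<n} 3"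
      by (rule refresh_subset[OF Cons.prems(2) _ T1(1)]) (use Cons.prems(1) in simp)
    then show ?case using Cons.IH[OF _ _ T1(2)] Cons.prems(1) by simp
  qed simp
  then show ?thesis using assms set_triple_list by (auto simp: sweep_law_def)
qed

lemma finite_sub_triples: "T \<subseteq> nsets {..<n} 3 \<Longrightarrow> finite T"
  by (rule finite_subset) (auto intro: finite_imp_finite_nsets)

lemma computes_glauber:
  "computes (repeat_prog 11 (sweep refresh_prog)) (scene L [0, 0, 0, 0, 0, 0] 0 0 (encode G {}))
    (map_pmf (\<lambda>T. scene L [0, 0, 0, 0, 0, 0] 0 0 (encode G T)) (glauber_law G))
    (n * (n * n * n * (n * (44 * n + 104) + 33) + 29) + 3)"
proof -
  have sweep: "computes (sweep refresh_prog) (scene L [0, 0, 0, 0, 0, 0] 0 w (encode G T))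
      (map_pmf (\<lambda>T. scene L [0, 0, 0, 0, 0, 0] 0 w (encode G T)) (sweep_law G T))
      (n * n * n * (n * (44 * n + 104) + 8 + 25) + 25)" if T: "T \<subseteq> nsets {..<n} 3" for w T
  proof -
    have "computes (sweep refresh_prog) (scene L [0, 0, 0, 0, 0, 0] 0 w (encode G T))
      (map_pmf (\<lambda>T. scene L [0, 0, 0, 0, 0, 0] 0 w (encode G T))
        (iter_pmf (\<lambda>x T. if sorted_digits x then refresh (truncate n p) (truncate n p') n G (triple x) T else return_pmf T)
          [0..<n * n * n] T))
      (n * n * n * (n * (44 * n + 104) + 8 + 25) + 25)"
    proof (rule computes_sweep[where I = "\<lambda>T. T \<subseteq> nsets {..<n} 3"])
      show "computes refresh_prog (scene L (odometer n x) 0 w (encode G T))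
        (map_pmf (\<lambda>T. scene L (odometer n x) 0 w (encode G T))
          (if sorted_digits x then refresh (truncate n p) (truncate n p') n G (triple x) T else return_pmf T))
        (n * (44 * n + 104) + 8)" if "T \<subseteq> nsets {..<n} 3" for x T
        by (rule computes_refresh[OF finite_sub_triples[OF that]])
      fix x T T' assume x: "x < n * n * n" and T: "T \<subseteq> nsets {..<n} 3"
        and T': "T' \<in> set_pmf (if sorted_digits x then refresh (truncate n p) (truncate n p') n G (triple x) T else return_pmf T)"
      show "T' \<subseteq> nsets {..<n} 3"
      proof (cases "sorted_digits x")
        case True
        then have "triple x \<in> set triple_list" using x by (auto simp: triple_list_def)
        then show ?thesis using refresh_subset[OF T] T' True by (auto simp: set_triple_list)
      qed (use T T' in simp)
    qed (use T L_gt_2 in \<open>simp_all add: encode_def\<close>)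
    then show ?thesis
      unfolding iter_pmf_filter_map[where f = "refresh (truncate n p) (truncate n p') n G" and g = triple]
      by (simp only: triple_list_def[symmetric] sweep_law_def)
  qed
  let ?xs = "[0, 0, 0, 0] @ [0, 0, 0, 0, 0, 0] @ [0, 0]"
  have xs: "regs L (?xs[11 := v]) M = scene L [0, 0, 0, 0, 0, 0] 0 v M" for v M
    by (simp add: scene_def)
  have "computes (repeat_prog 11 (sweep refresh_prog)) (regs L ?xs (encode G {}))
    (map_pmf (\<lambda>T. regs L ?xs (encode G T)) (iter_pmf (\<lambda>_. sweep_law G) [0..<n] {}))
    (n * ((n * n * n * (n * (44 * n + 104) + 8 + 25) + 25) + 4) + 3)"
  proof (rule computes_repeat[where I = "\<lambda>T. T \<subseteq> nsets {..<n} 3" and c = 11])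
    show "computes (sweep refresh_prog) (regs L (?xs[11 := v]) (encode G T))
        (map_pmf (\<lambda>T. regs L (?xs[11 := v]) (encode G T)) (sweep_law G T))
        (n * n * n * (n * (44 * n + 104) + 8 + 25) + 25)" if "T \<subseteq> nsets {..<n} 3" for v T
      unfolding xs by (rule sweep[OF that])
  qed (use L_gt_2 sweep_law_subset in \<open>auto simp: encode_def\<close>)
  then have "computes (repeat_prog 11 (sweep refresh_prog)) (scene L [0, 0, 0, 0, 0, 0] 0 0 (encode G {}))
    (map_pmf (\<lambda>T. scene L [0, 0, 0, 0, 0, 0] 0 0 (encode G T)) (glauber_law G))
    (n * ((n * n * n * (n * (44 * n + 104) + 8 + 25) + 25) + 4) + 3)"
    by (simp only: scene_def glauber_law_def)
  then show ?thesis by (rule computes_mono) simp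
qed

lemma glauber_law_subset:
  assumes "T \<in> set_pmf (glauber_law G)"
  shows "T \<subseteq> nsets {..<n} 3"
  using assms unfolding glauber_law_def
  by (rule iter_pmf_invariant[where P = "\<lambda>T. T \<subseteq> nsets {..<n} 3", rotated 2]) (use sweep_law_subset in auto)

text \<open>The loop over triples is reused for pairs: the pair of the two leading digits is handled
  once, when the last digit is 0.\<close>

definition "pair_digits x \<longleftrightarrow> x mod n = 0 \<and> x div n div n < x div n mod n"
definition "pair x = {x div n div n, x div n mod n}"
definition "pair_list = map pair (filter pair_digits [0..<n * n * n])"

lemma pair_digits_bounds: "pair_digits x \<Longrightarrow> x div n div n < x div n mod n \<and> x div n mod n < n"
proof -
  assume x: "pair_digits x"
  have "n \<noteq> 0"
  proof
    assume "n = 0"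
    then show False using x unfolding pair_digits_def by simp
  qed
  then show ?thesis using x by (simp add: pair_digits_def)
qed

lemma distinct_pair_list: "distinct pair_list"
proof -
  have "x = y" if "pair_digits x" "pair_digits y" "pair x = pair y" for x y
  proof -
    have "x div n div n = y div n div n" "x div n mod n = y div n mod n" "x mod n = y mod n"
      using that by (auto simp: pair_def pair_digits_def doubleton_eq_iff)
    then show "x = y" by (metis div_mult_mod_eq)
  qed
  then show ?thesis unfolding pair_list_def by (auto simp: distinct_map inj_on_def)
qed

lemma set_pair_list: "set pair_list = nsets {..<n} 2"
proof
  show "set pair_list \<subseteq> nsets {..<n} 2"
  proof
    fix e assume "e \<in> set pair_list"
    then obtain x where x: "pair_digits x" "e = pair x" by (auto simp: pair_list_def)
    then show "e \<in> nsets {..<n} 2" using pair_digits_bounds[OF x(1)] by (auto simp: nsets_def pair_def)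
  qed
  show "nsets {..<n} 2 \<subseteq> set pair_list"
  proof
    fix e assume "e \<in> nsets {..<n} 2"
    then have "e \<in> nsets UNIV 2" "e \<subseteq> {..<n}" by (auto simp: nsets_def)
    then obtain i j where ij: "e = {i, j}" "i < j" "j < n" by (auto simp: ordered_nsets_2_eq)
    have i: "i < n" using ij by simp
    have x: "(i * n + j) * n div n = i * n + j" "(i * n + j) div n = i" "(i * n + j) mod n = j"
      using ij i pair_code[of i n j] by simp_all
    then have "pair_digits ((i * n + j) * n)" "pair ((i * n + j) * n) = e"
      using ij by (simp_all add: pair_digits_def pair_def)
    moreover have "(i * n + j) * n < n * n * n" using pair_code(3)[OF i ij(3)] ij by simp
    ultimately show "e \<in> set pair_list" unfolding pair_list_def by force
  qed
qed

definition "resample_prog = Cond (reg 4) Skip (Cond (Sub (reg 5) (reg 6)) (Cond (Read (cov_expr cell_ij))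
  (bern p_addr ;; Assign cell_ij (reg 2) ;; Assign (reg_addr 2) (Lit 0)) Skip) Skip)"

lemma resample_singleton:
  "resample r {e} G = map_pmf (\<lambda>b. if b then insert e G else G - {e}) (bernoulli_pmf r)"
proof -
  have "random_subset {e} r = map_pmf (\<lambda>b. if b then {e} else {}) (bernoulli_pmf r)"
    using random_subset_insert[of "{}" e r] by (simp add: map_pmf_def bind_return_pmf)
  moreover have "(G - {e}) \<union> (if b then {e} else {}) = (if b then insert e G else G - {e})" for b by auto
  ultimately show ?thesis by (simp add: resample_def pmf.map_comp o_def)
qed

lemma resample_insert:
  assumes "finite U" "e \<notin> U"
  shows "resample r (insert e U) G = bind_pmf (resample r {e} G) (resample r U)"
proof -
  have "(G - insert e U) \<union> (if b then insert e H else H) = (if b then insert e G else G - {e}) - U \<union> H"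
    if "H \<subseteq> U" for b H
    using that assms(2) by auto
  then show ?thesis
    unfolding resample_singleton
    by (auto simp: resample_def[abs_def] random_subset_insert[OF assms] map_bind_pmf bind_map_pmf pmf.map_comp
        intro!: bind_pmf_cong map_pmf_cong dest!: random_subset_subsetD)
qed

lemma resample_empty [simp]: "resample r {} G = return_pmf G"
  by (simp add: resample_def)

definition "resample_step U e G = (if e \<in> U then resample (truncate n p) {e} G else return_pmf G)"

lemma iter_resample_step:
  "distinct es \<Longrightarrow> iter_pmf (resample_step U) es G = resample (truncate n p) (U \<inter> set es) G"
proof (induction es arbitrary: G)
  case (Cons e es)
  then have IH: "iter_pmf (resample_step U) es = resample (truncate n p) (U \<inter> set es)"
    by (intro ext Cons.IH) simp
  show ?case
  proof (cases "e \<in> U")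
    case True
    then have "U \<inter> set (e # es) = insert e (U \<inter> set es)" by auto
    moreover have "resample (truncate n p) (insert e (U \<inter> set es)) G
        = bind_pmf (resample (truncate n p) {e} G) (resample (truncate n p) (U \<inter> set es))"
      by (rule resample_insert) (use Cons.prems in auto)
    ultimately show ?thesis using True unfolding iter_pmf.simps IH by (simp add: resample_step_def)
  next
    case False
    then have "U \<inter> set (e # es) = U \<inter> set es" by auto
    then show ?thesis using False unfolding iter_pmf.simps IH by (simp add: resample_step_def bind_return_pmf)
  qed
qed simp

lemma computes_resample_step:
  assumes T: "T \<subseteq> nsets {..<n} 3"
  shows "computes resample_prog (scene L (odometer n x) v w (encode G T))
    (map_pmf (\<lambda>G. scene L (odometer n x) v w (encode G T))
      (if pair_digits x then resample_step (cover T) (pair x) G else return_pmf G)) (11 * n + 20)"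
proof -
  let ?m = "stage False False x v w (encode G T)"
  let ?D = "map_pmf (\<lambda>G. stage False False x v w (encode G T))
    (if pair_digits x then resample_step (cover T) (pair x) G else return_pmf G)"
  let ?put = "Assign cell_ij (reg 2) ;; Assign (reg_addr 2) (Lit 0)"
  obtain i j where ij: "x div n div n = i" "x div n mod n = j" by blast
  have bd: "i < n" "j < n" "i < j" if "pair_digits x" using pair_digits_bounds[OF that] by (simp_all add: ij)
  have skip: "computes Skip ?m ?D t" if "\<not> (pair_digits x \<and> pair x \<in> cover T)" for t
    using that computes_mono[OF computes_Skip] by (auto simp: resample_step_def)
  have cov: "eval_expr (Read (cov_expr cell_ij)) ?m \<noteq> 0 \<longleftrightarrow> pair x \<in> cover T" if x: "pair_digits x"
  proof -
    have "eval_expr (Read (cov_expr cell_ij)) ?m = card {t \<in> T. {i, j} \<subseteq> t}"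
      using bd[OF x] cov_addr_bounds[of i j] unfolding encode_def
      by (simp add: eval_cells ij stage_read(3) enc_cov cov_eq)
    also have "\<dots> \<noteq> 0 \<longleftrightarrow> (\<exists>t\<in>T. {i, j} \<subseteq> t)" using finite_sub_triples[OF T] by auto
    also have "\<dots> \<longleftrightarrow> pair x \<in> cover T" using bd[OF x] by (auto simp: cover_def nsets_def pair_def ij)
    finally show ?thesis .
  qed
  have "computes (bern p_addr ;; ?put) ?m ?D (11 * n + 6 + cost ?put + 1)" if x: "pair_digits x" "pair x \<in> cover T"
  proof -
    have "computes (bern p_addr ;; ?put) ?m
      (map_pmf (\<lambda>b. stage False False x v w (encode (if b then insert (pair x) G else G - {pair x}) T))
        (bernoulli_pmf (truncate n p))) (11 * n + 6 + cost ?put + 1)"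
    proof (rule computes_Seq_exec[OF stage_bern_p[where A = "adj G" and C = "cov T" and R = "tri T", folded encode_def]])
      show "exec ?put (stage b False x v w (encode G T))
          = stage False False x v w (encode (if b then insert (pair x) G else G - {pair x}) T)" for b
        using bd[OF x(1)] adj_update[OF bd(3)[OF x(1)] bd(2)[OF x(1)], of G b] unfolding encode_def
        by (simp add: eval_cells ij stage_write cell_less_L enc_cell eval_reg_stage exec_set_flag[simplified] pair_def)
    qed simp
    then show ?thesis using x by (simp add: resample_step_def resample_singleton pmf.map_comp o_def)
  qed
  then have "computes (bern p_addr ;; ?put) ?m ?D (11 * n + 17)" if "pair_digits x" "pair x \<in> cover T"
    using that by (intro computes_mono[where T' = "11 * n + 17"]) auto
  then have inner: "computes (Cond (Read (cov_expr cell_ij)) (bern p_addr ;; ?put) Skip) ?m ?D (Suc (11 * n + 17))" if "pair_digits x"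
    using that by (intro computes_Cond_iff[OF cov] skip) simp_all
  have t: "eval_expr (reg 4) ?m = x mod n" "eval_expr (Sub (reg 5) (reg 6)) ?m = j - i"
    unfolding encode_def by (simp_all add: eval_reg_stage odometer_def ij)
  have "computes (Cond (Sub (reg 5) (reg 6)) (Cond (Read (cov_expr cell_ij)) (bern p_addr ;; ?put) Skip) Skip) ?m ?D
      (Suc (Suc (11 * n + 17)))" if "x mod n = 0"
  proof (rule computes_Cond_iff[where P = "pair_digits x"])
    show "eval_expr (Sub (reg 5) (reg 6)) ?m \<noteq> 0 \<longleftrightarrow> pair_digits x"
      unfolding t using that by (auto simp: pair_digits_def ij)
  qed (rule inner, assumption, rule skip, simp)
  moreover have "computes Skip ?m ?D (Suc (Suc (11 * n + 17)))" if "x mod n \<noteq> 0"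
    by (rule skip) (use that in \<open>simp add: pair_digits_def\<close>)
  ultimately have "computes resample_prog ?m ?D (Suc (Suc (Suc (11 * n + 17))))"
    unfolding resample_prog_def
    by - (rule computes_Cond_iff[where P = "x mod n \<noteq> 0"], simp_all only: t(1) not_not simp_thms)
  then show ?thesis unfolding scene_stage by (rule computes_mono) simp
qed

lemma computes_resample:
  assumes T: "T \<subseteq> nsets {..<n} 3"
  shows "computes (sweep resample_prog) (scene L [0, 0, 0, 0, 0, 0] 0 0 (encode G T))
    (map_pmf (\<lambda>G. scene L [0, 0, 0, 0, 0, 0] 0 0 (encode G T)) (resample (truncate n p) (cover T) G))
    (n * n * n * (11 * n + 20 + 25) + 25)"
proof -
  have "computes (sweep resample_prog) (scene L [0, 0, 0, 0, 0, 0] 0 0 (encode G T))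
    (map_pmf (\<lambda>G. scene L [0, 0, 0, 0, 0, 0] 0 0 (encode G T))
      (iter_pmf (\<lambda>x G. if pair_digits x then resample_step (cover T) (pair x) G else return_pmf G) [0..<n * n * n] G))
    (n * n * n * (11 * n + 20 + 25) + 25)"
  proof (rule computes_sweep[where I = "\<lambda>_. True"])
  qed (rule computes_resample_step[OF T] | simp add: L_gt_2 encode_def)+
  moreover have "cover T \<inter> nsets {..<n} 2 = cover T" using cover_subset[OF T] by blast
  ultimately show ?thesis
    unfolding iter_pmf_filter_map[where f = "resample_step (cover T)" and g = pair]
    by (simp add: pair_list_def[symmetric] iter_resample_step distinct_pair_list set_pair_list)
qed

lemma computes_inverse:
  "computes (repeat_prog 11 (sweep refresh_prog) ;; sweep resample_prog) (scene L [0, 0, 0, 0, 0, 0] 0 0 (encode G {}))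
    (bind_pmf (glauber_law G) (\<lambda>T. map_pmf (\<lambda>G. scene L [0, 0, 0, 0, 0, 0] 0 0 (encode G T))
      (resample (truncate n p) (cover T) G)))
    (n * (n * n * n * (n * (44 * n + 104) + 33) + 29) + 3 + (n * n * n * (11 * n + 20 + 25) + 25) + 1)"
  by (rule computes_Seq_map[OF computes_glauber]) (rule computes_resample[OF glauber_law_subset])

end


subsection \<open>Efficiency\<close>

definition poly_bounded :: "(nat \<Rightarrow> nat) \<Rightarrow> bool" where
  "poly_bounded T \<longleftrightarrow> (\<exists>t :: nat poly. \<forall>n. T n \<le> poly t n)"

lemma poly_bounded_const: "poly_bounded (\<lambda>_. c)"
  unfolding poly_bounded_def by (rule exI[of _ "[:c:]"]) simp

lemma poly_bounded_id: "poly_bounded (\<lambda>n. n)"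
  unfolding poly_bounded_def by (rule exI[of _ "[:0, 1:]"]) simp

lemma poly_bounded_add:
  assumes "poly_bounded S" "poly_bounded T"
  shows "poly_bounded (\<lambda>n. S n + T n)"
proof -
  obtain s t where "\<forall>n. S n \<le> poly s n" "\<forall>n. T n \<le> poly t n" using assms by (auto simp: poly_bounded_def)
  then show ?thesis unfolding poly_bounded_def by (intro exI[of _ "s + t"]) (auto intro: add_mono)
qed

lemma poly_bounded_mult:
  assumes "poly_bounded S" "poly_bounded T"
  shows "poly_bounded (\<lambda>n. S n * T n)"
proof -
  obtain s t where "\<forall>n. S n \<le> poly s n" "\<forall>n. T n \<le> poly t n" using assms by (auto simp: poly_bounded_def)
  then show ?thesis unfolding poly_bounded_def by (intro exI[of _ "s * t"]) (auto intro: mult_le_mono)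
qed

lemmas poly_bounded_intros = poly_bounded_const poly_bounded_id poly_bounded_add poly_bounded_mult

lemma efficientI:
  assumes "poly_bounded T"
    and "\<And>n G. G \<subseteq> nsets {..<n} 2 \<Longrightarrow> computes c (input_memory n (k n) (\<theta> n) n G) (D n G) (T n)"
    and "\<And>n G. G \<subseteq> nsets {..<n} 2 \<Longrightarrow> map_pmf (output_graph n) (D n G) = A n G"
  shows "efficient k \<theta> A"
proof -
  obtain t where t: "\<And>n. T n \<le> poly t n" using assms(1) by (auto simp: poly_bounded_def)
  have "(\<forall>x\<in>set_pmf (run (poly t n) (c, input_memory n (k n) (\<theta> n) n G)). fst x = Skip) \<and>
      A n G = map_pmf (\<lambda>x. output_graph n (snd x)) (run (poly t n) (c, input_memory n (k n) (\<theta> n) n G))"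
    if G: "G \<subseteq> nsets {..<n} 2" for n G
  proof -
    have "computes c (input_memory n (k n) (\<theta> n) n G) (D n G) (poly t n)"
      by (rule computes_mono[OF assms(2)[OF G] t])
    then show ?thesis using assms(3)[OF G, symmetric] by (simp add: computes_def pmf.map_comp o_def)
  qed
  \<comment> \<open>The precision is the polynomial X, that is, \<open>n\<close> digits after the
    point.\<close>
  then show ?thesis
    unfolding efficient_def Let_def
    by (intro exI[of _ c] exI[of _ "[:0, 1:]"] exI[of _ t]) simp
qed

lemma concat_rows:
  "length (concat (map (\<lambda>i. map (f i) [0..<n]) [0..<l])) = l * n"
  "i < l \<Longrightarrow> j < n \<Longrightarrow> concat (map (\<lambda>i. map (f i) [0..<n]) [0..<l]) ! (i * n + j) = f i j"
proof (induction l)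
  case (Suc l)
  {
    case 1
    then show ?case using Suc.IH(1) by simp
  next
    case 2
    show ?case
    proof (cases "i = l")
      case True
      then show ?thesis using 2 Suc.IH(1) by (simp add: nth_append)
    next
      case False
      then have i: "i < l" using 2 by simp
      then have "i * n + j < Suc i * n" using 2 by simp
      also have "\<dots> \<le> l * n" using i by (intro mult_le_mono) auto
      finally show ?thesis using 2 Suc.IH i by (simp add: nth_append)
    qed
  }
qed simp_all

lemma input_memory_cells:
  fixes n k G p q p'
  defines "m \<equiv> input_memory n k [p, q, p'] n G"
  shows "m 0 = n" "i < n \<Longrightarrow> j < n \<Longrightarrow> m (3 + i * n + j) = of_bool ({i, j} \<in> G)"
    "i \<le> n \<Longrightarrow> m (n * n + 3 + i) = binary_digits n p ! i"
    "i \<le> n \<Longrightarrow> m (n * n + 2 * n + 5 + i) = binary_digits n p' ! i"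
    "n * n + 3 * n + 6 \<le> a \<Longrightarrow> m a = 0"
proof -
  define A where "A = adjacency_list n G"
  have A: "length A = n * n" by (simp add: A_def adjacency_list_def concat_rows)
  have B: "length (binary_digits n x) = Suc n" for x by (simp add: binary_digits_def)
  define xs where "xs = [n, k, n] @ A @ binary_digits n p @ binary_digits n q @ binary_digits n p'"
  have len: "length xs = n * n + 3 * n + 6" by (simp add: xs_def A B)
  have m: "m a = (if a < length xs then xs ! a else 0)" for a
    by (simp add: m_def input_memory_def xs_def A_def Let_def)
  show "m 0 = n" by (simp add: m len) (simp add: xs_def)
  show "m a = 0" if "n * n + 3 * n + 6 \<le> a" using that by (simp add: m len)
  have off: "xs ! (3 + a) = (A @ binary_digits n p @ binary_digits n q @ binary_digits n p') ! a" for a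
    by (simp add: xs_def numeral_3_eq_3)
  show "m (3 + i * n + j) = of_bool ({i, j} \<in> G)" if ij: "i < n" "j < n"
  proof -
    have c: "i * n + j < n * n" by (rule pair_code(3)[OF ij])
    then have "m (3 + (i * n + j)) = A ! (i * n + j)" using off[of "i * n + j"] by (simp add: m len nth_append A)
    also have "\<dots> = of_bool ({i, j} \<in> G)" using ij by (simp add: A_def adjacency_list_def concat_rows(2))
    finally show ?thesis by (simp add: add.assoc)
  qed
  show "m (n * n + 3 + i) = binary_digits n p ! i" if "i \<le> n"
  proof -
    have "m (3 + (n * n + i)) = binary_digits n p ! i"
      using that off[of "n * n + i"] by (simp add: m len nth_append A B)
    then show ?thesis by (simp add: add_ac)
  qed
  show "m (n * n + 2 * n + 5 + i) = binary_digits n p' ! i" if "i \<le> n"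
  proof -
    have "m (3 + (n * n + 2 * n + 2 + i)) = binary_digits n p' ! i"
      using that off[of "n * n + 2 * n + 2 + i"] by (simp add: m len nth_append A B)
    moreover have "3 + (n * n + 2 * n + 2 + i) = n * n + 2 * n + 5 + i" by simp
    ultimately show ?thesis by (simp only:)
  qed
qed

lemma machine_input:
  assumes "p \<in> {0..1}" "p' \<in> {0..1}"
  shows "machine n p p' ((input_memory n k [p, q, p'] n G)(1 := 0, 2 := n * n + 3 * n + 6)) (n * n + 3 * n + 6)"
proof
  show "((input_memory n k [p, q, p'] n G)(1 := 0, 2 := n * n + 3 * n + 6)) 0 = n"
    by (simp add: input_memory_cells)
  show "((input_memory n k [p, q, p'] n G)(1 := 0, 2 := n * n + 3 * n + 6)) (n * n + 3 + i) = binary_digits n p ! i"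
    if "i \<le> n" for i
    using input_memory_cells(3)[OF that] by simp
  show "((input_memory n k [p, q, p'] n G)(1 := 0, 2 := n * n + 3 * n + 6)) (n * n + 2 * n + 5 + i) = binary_digits n p' ! i"
    if "i \<le> n" for i
    using input_memory_cells(4)[OF that] by simp
qed (use assms in auto)

text \<open>The number of attempts per update and the number of sweeps are both \<open>n\<close>.
  The former makes the dynamics contract by 1/2 per sweep for large \<open>n\<close>, the latter
  then brings the mixing error down to order \<open>n ^ 3 / 2 ^ n\<close>.\<close>

definition "inverse_sampler n p p' ts G =
  bind_pmf (iter_pmf (\<lambda>_. iter_pmf (refresh p p' n G) ts) [0..<n] {}) (\<lambda>T. resample p (cover T) G)"

lemma efficient_add_triangles:
  assumes "0 \<le> p" "p \<le> 1" "\<And>n. 0 \<le> p' n \<and> p' n \<le> 1"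
  shows "efficient k (\<lambda>n. [p, q, p' n]) (\<lambda>n. add_triangles n (truncate n (p' n)))"
proof (rule efficientI)
  let ?m0 = "\<lambda>n G. (input_memory n (k n) [p, q, p' n] n G)(1 := 0, 2 := n * n + 3 * n + 6)"
  let ?D = "\<lambda>n G. map_pmf (\<lambda>G'. scene (n * n + 3 * n + 6) [0, 0, 0, 0, 0, 0] 0 0 (machine.encode n (?m0 n G) (n * n + 3 * n + 6) G' {}))
    (add_triangles n (truncate n (p' n)) G)"
  fix n :: nat and G :: graph assume G: "G \<subseteq> nsets {..<n} 2"
  interpret machine n p "p' n" "?m0 n G" "n * n + 3 * n + 6"
    by (rule machine_input) (use assms in auto)
  have prep: "computes prepare (input_memory n (k n) [p, q, p' n] n G) (return_pmf (?m0 n G)) (5 * n + 5)"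
    by (rule computes_prepare) (rule input_memory_cells)
  have init: "scene (n * n + 3 * n + 6) [0, 0, 0, 0, 0, 0] 0 0 (encode G {}) = ?m0 n G"
    by (rule initial_memory) (auto simp: input_memory_cells)
  show "computes (prepare ;; sweep (machine.guard (bern machine.p'_addr ;; machine.mark)))
      (input_memory n (k n) [p, q, p' n] n G) (?D n G) (5 * n + 5 + (n * n * n * (11 * n + 30 + 25) + 25) + 1)"
    by (rule computes_Seq_return[OF prep computes_add_triangles[of G "{}", unfolded init]])
  have "G' \<subseteq> nsets {..<n} 2" if "G' \<in> set_pmf (add_triangles n (truncate n (p' n)) G)" for G'
  proof -
    obtain T where T: "T \<in> set_pmf (random_subset (nsets {..<n} 3) (truncate n (p' n)))" "G' = G \<union> cover T"
      using \<open>G' \<in> _\<close> by (auto simp: add_triangles_def)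
    show ?thesis unfolding T(2) using G cover_subset[OF random_subset_subsetD[OF T(1)]] by (rule Un_least)
  qed
  then have "map_pmf (output_graph n) (?D n G) = map_pmf (\<lambda>G'. G') (add_triangles n (truncate n (p' n)) G)"
    unfolding pmf.map_comp o_def by (intro map_pmf_cong refl output_encode)
  then show "map_pmf (output_graph n) (?D n G) = add_triangles n (truncate n (p' n)) G" by simp
qed (intro poly_bounded_intros)

lemma efficient_inverse_sampler:
  assumes "0 \<le> p" "p \<le> 1" "\<And>n. 0 \<le> p' n \<and> p' n \<le> 1"
  obtains ts where "\<And>n. set (ts n) = nsets {..<n} 3"
    "efficient k (\<lambda>n. [p, q, p' n]) (\<lambda>n. inverse_sampler n (truncate n p) (truncate n (p' n)) (ts n))"
proof
  show "set (machine.triple_list n) = nsets {..<n} 3" for n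
    by (rule machine.set_triple_list[OF machine_input[of p "p' n"]]) (use assms in auto)
  let ?m0 = "\<lambda>n G. (input_memory n (k n) [p, q, p' n] n G)(1 := 0, 2 := n * n + 3 * n + 6)"
  let ?A = "\<lambda>n. inverse_sampler n (truncate n p) (truncate n (p' n)) (machine.triple_list n)"
  let ?D = "\<lambda>n G. bind_pmf (machine.glauber_law n p (p' n) G) (\<lambda>T.
    map_pmf (\<lambda>G'. scene (n * n + 3 * n + 6) [0, 0, 0, 0, 0, 0] 0 0 (machine.encode n (?m0 n G) (n * n + 3 * n + 6) G' T))
      (resample (truncate n p) (cover T) G))"
  show "efficient k (\<lambda>n. [p, q, p' n]) ?A"
  proof (rule efficientI)
    fix n :: nat and G :: graph assume G: "G \<subseteq> nsets {..<n} 2"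
    interpret machine n p "p' n" "?m0 n G" "n * n + 3 * n + 6"
      by (rule machine_input) (use assms in auto)
    have prep: "computes prepare (input_memory n (k n) [p, q, p' n] n G) (return_pmf (?m0 n G)) (5 * n + 5)"
      by (rule computes_prepare) (rule input_memory_cells)
    have init: "scene (n * n + 3 * n + 6) [0, 0, 0, 0, 0, 0] 0 0 (encode G {}) = ?m0 n G"
      by (rule initial_memory) (auto simp: input_memory_cells)
    show "computes (prepare ;; repeat_prog 11 (sweep machine.refresh_prog) ;; sweep machine.resample_prog)
        (input_memory n (k n) [p, q, p' n] n G) (?D n G)
        (5 * n + 5 + (n * (n * n * n * (n * (44 * n + 104) + 33) + 29) + 3 + (n * n * n * (11 * n + 20 + 25) + 25) + 1) + 1)"
      by (rule computes_Seq_return[OF prep computes_inverse[of G, unfolded init]])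
    have sub: "G' \<subseteq> nsets {..<n} 2" if "T \<in> set_pmf (glauber_law G)" "G' \<in> set_pmf (resample (truncate n p) (cover T) G)" for G' T
      using that G cover_subset[OF glauber_law_subset[OF that(1)]]
      by (auto simp: resample_def dest!: random_subset_subsetD)
    have "map_pmf (output_graph n) (?D n G)
        = bind_pmf (glauber_law G) (\<lambda>T. map_pmf (\<lambda>G'. G') (resample (truncate n p) (cover T) G))"
      unfolding map_bind_pmf pmf.map_comp o_def
      by (intro bind_pmf_cong map_pmf_cong refl output_encode) (rule sub)
    then show "map_pmf (output_graph n) (?D n G) = ?A n G"
      by (simp add: inverse_sampler_def glauber_law_def sweep_law_def[abs_def])
  qed (intro poly_bounded_intros)
qed


subsection \<open>Error bounds at a fixed number of vertices\<close>

lemma choose_le_power: "n choose k \<le> n ^ k"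
  by (cases "k \<le> n") (simp_all add: binomial_le_pow binomial_eq_0)

lemma d_TV_RGT:
  assumes "p \<in> {0..1}" "r \<in> {0..1}" "p' \<in> {0..1}" "r' \<in> {0..1}"
  shows "d_TV (RGT n p p') (RGT n r r') \<le> real n ^ 2 * \<bar>p - r\<bar> + real n ^ 3 * \<bar>p' - r'\<bar>"
proof -
  have c: "real (card (nsets {..<n} m)) \<le> real n ^ m" for m
    using choose_le_power[of n m] by (simp flip: of_nat_power)
  have "d_TV (bind_pmf (ER n p) (add_triangles n p')) (bind_pmf (ER n r) (add_triangles n p'))
      \<le> card (nsets {..<n} 2) * \<bar>p - r\<bar>"
    unfolding ER_def
    by (rule order_trans[OF d_TV_bind_left d_TV_random_subset]) (use assms in \<open>auto intro: finite_imp_finite_nsets\<close>)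
  also have "\<dots> \<le> real n ^ 2 * \<bar>p - r\<bar>" by (intro mult_right_mono c) simp
  finally have 1: "d_TV (bind_pmf (ER n p) (add_triangles n p')) (bind_pmf (ER n r) (add_triangles n p'))
      \<le> real n ^ 2 * \<bar>p - r\<bar>" .
  have "d_TV (bind_pmf (ER n r) (add_triangles n p')) (bind_pmf (ER n r) (add_triangles n r'))
      \<le> card (nsets {..<n} 3) * \<bar>p' - r'\<bar>"
    unfolding add_triangles_def
    by (intro d_TV_bind_right order_trans[OF d_TV_map_left d_TV_random_subset])
      (use assms in \<open>auto intro: finite_imp_finite_nsets\<close>)
  also have "\<dots> \<le> real n ^ 3 * \<bar>p' - r'\<bar>" by (intro mult_right_mono c) simp
  finally have 2: "d_TV (bind_pmf (ER n r) (add_triangles n p')) (bind_pmf (ER n r) (add_triangles n r'))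
      \<le> real n ^ 3 * \<bar>p' - r'\<bar>" .
  show ?thesis
    unfolding RGT_eq_add_triangles using d_TV_triangle[of _ _ "bind_pmf (ER n r) (add_triangles n p')"] 1 2
    by (meson add_mono order_trans)
qed

lemma d_TV_ER:
  assumes "p \<in> {0..1}" "r \<in> {0..1}"
  shows "d_TV (ER n p) (ER n r) \<le> real n ^ 2 * \<bar>p - r\<bar>"
proof -
  have "d_TV (ER n p) (ER n r) \<le> card (nsets {..<n} 2) * \<bar>p - r\<bar>"
    unfolding ER_def by (rule d_TV_random_subset) (use assms in \<open>auto intro: finite_imp_finite_nsets\<close>)
  also have "\<dots> \<le> real n ^ 2 * \<bar>p - r\<bar>"
    using choose_le_power[of n 2] by (intro mult_right_mono) (simp_all flip: of_nat_power)
  finally show ?thesis .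
qed

lemma d_TV_plant:
  assumes "\<And>S. S \<in> nsets {..<n} k \<Longrightarrow> d_TV (bind_pmf (bind_pmf \<mu> (plant_at S q)) A) (bind_pmf \<nu> (plant_at S r)) \<le> e"
    and "k \<le> n"
  shows "d_TV (bind_pmf (plant n k q \<mu>) A) (plant n k r \<nu>) \<le> e"
proof -
  have "0 < card (nsets {..<n} k)" using assms(2) by simp
  then have "finite (nsets {..<n} k)" "nsets {..<n} k \<noteq> {}" unfolding card_gt_0_iff by auto
  then show ?thesis
    unfolding plant_eq_plant_at bind_assoc_pmf
    by (intro d_TV_bind_right) (use assms(1) in \<open>simp add: bind_assoc_pmf\<close>)
qed

lemma power_gap_le:
  assumes "0 \<le> x" "real n * x \<le> 1"
  shows "(1 + x) ^ n - 1 \<le> 2 * (real n * x)"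
proof -
  have "(1 + x) ^ n \<le> exp x ^ n" by (rule power_mono) (use assms exp_ge_add_one_self in auto)
  also have "\<dots> = exp (real n * x)" by (simp add: exp_of_nat_mult)
  also have "\<dots> \<le> 1 + real n * x + (real n * x)\<^sup>2" by (rule exp_bound) (use assms in auto)
  also have "(real n * x)\<^sup>2 \<le> real n * x" using assms by (simp add: power2_eq_square mult_left_le)
  finally show ?thesis by linarith
qed

text \<open>\<open>r\<close> and \<open>r'\<close> are the truncations of \<open>p\<close> and
  \<open>p'\<close>. As \<open>r\<close> is at least \<open>p / 2\<close>, the constant
  \<open>c\<close> bounds \<open>1 / r\<^sup>2\<close>, and the last assumption bounds the
  contraction factor of the Glauber dynamics run with \<open>r\<close> and \<open>r'\<close> by 1/2;
  the bound on \<open>c\<close> keeps the exponent in \<open>gap_le\<close> below 1. From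
  \<open>n \<ge> 3\<close> the logarithm is at least 1.\<close>

locale regime =
  fixes n k :: nat and p p' r r' c :: real
  assumes n: "3 \<le> n" and k: "k \<le> n" "real k ^ 4 \<le> n"
    and p: "0 < p" "p < 1" and r: "p / 2 \<le> r" "r \<le> p" "p - r \<le> 1 / 2 ^ n"
    and r': "0 \<le> r'" "r' \<le> p'" "p' - r' \<le> 1 / 2 ^ n" and p': "p' \<le> 1 / (n * ln n)"
    and c: "c = 4 / p\<^sup>2" "c \<le> n * (ln n)\<^sup>2"
    and \<alpha>: "(8 / p ^ 3 / (n * ln n) + (1 - p ^ 3 / 8) ^ n) * real (3 * n) \<le> 1 / 2"
begin

lemma ln_n: "1 \<le> ln n"
proof -
  have "exp (1 :: real) \<le> 3" by (rule exp_le)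
  also have "\<dots> \<le> n" using n by simp
  finally show ?thesis using n by (subst ln_ge_iff) auto
qed

lemma r'_less: "r' \<le> 1 / (n * ln n)" "r' < 1" "p' < 1" "r' \<le> 1 / 2"
proof -
  have "real n * 1 \<le> n * ln n" using ln_n n by (intro mult_left_mono) auto
  then have "3 \<le> real n * ln n" using n by linarith
  then have "1 / (n * ln n) \<le> 1 / 3" using n by (intro divide_left_mono) auto
  then show "r' \<le> 1 / (n * ln n)" "r' < 1" "p' < 1" "r' \<le> 1 / 2" using r' p' by linarith+
qed

lemma noisy: "s \<in> {r, p} \<Longrightarrow> noisy_graph s r'"
  using p r r'(1) r'_less(2) by unfold_locales auto

text \<open>Here the two size conditions meet: \<open>N\<close>, the number of inner edges, is at
  most sqrt n, and the gap is at most of order 1 / (sqrt n ln n). Adding triangles uses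
  \<open>s = p\<close>, the inverse \<open>s = r\<close>.\<close>

lemma gap_le:
  assumes s: "s \<in> {r, p}" and N: "real N \<le> sqrt n"
  shows "N * sqrt ((1 + (1 / s\<^sup>2 - 1) * r'\<^sup>2) ^ n - 1) \<le> sqrt (2 * c) / ln n"
proof -
  have n0: "0 < real n * ln n" using n ln_n by simp
  have s2: "p / 2 \<le> s" "0 < s" using s p r by auto
  have x: "0 \<le> (1 / s\<^sup>2 - 1) * r'\<^sup>2"
    using s2 s p r by (intro mult_nonneg_nonneg) (auto simp: power_le_one)
  have "1 / s\<^sup>2 - 1 \<le> c"
  proof -
    have "(p / 2)\<^sup>2 \<le> s\<^sup>2" using s2 p by (intro power_mono) auto
    then have "1 / s\<^sup>2 \<le> 1 / (p / 2)\<^sup>2" using p s2 by (intro divide_left_mono) auto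
    then show ?thesis by (simp add: c power_divide)
  qed
  moreover have "r'\<^sup>2 \<le> (1 / (n * ln n))\<^sup>2" using r' r'_less by (intro power_mono) auto
  moreover have c0: "0 \<le> c" by (simp add: c)
  ultimately have "n * ((1 / s\<^sup>2 - 1) * r'\<^sup>2) \<le> n * (c * (1 / (n * ln n))\<^sup>2)"
    by (intro mult_left_mono mult_mono) auto
  also have "\<dots> = c / (n * (ln n)\<^sup>2)" using n by (simp add: power2_eq_square field_simps)
  finally have nx: "n * ((1 / s\<^sup>2 - 1) * r'\<^sup>2) \<le> c / (n * (ln n)\<^sup>2)" .
  also have "\<dots> \<le> 1" using c(2) n ln_n by (subst divide_le_eq_1) auto
  finally have "(1 + (1 / s\<^sup>2 - 1) * r'\<^sup>2) ^ n - 1 \<le> 2 * (n * ((1 / s\<^sup>2 - 1) * r'\<^sup>2))"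
    by (rule power_gap_le[OF x])
  also have "\<dots> \<le> 2 * c / (n * (ln n)\<^sup>2)" using nx by simp
  finally have "sqrt ((1 + (1 / s\<^sup>2 - 1) * r'\<^sup>2) ^ n - 1) \<le> sqrt (2 * c / (n * (ln n)\<^sup>2))"
    by (rule real_sqrt_le_mono)
  also have "\<dots> = sqrt (2 * c) / (sqrt n * ln n)" using ln_n by (simp add: real_sqrt_divide real_sqrt_mult)
  finally have "N * sqrt ((1 + (1 / s\<^sup>2 - 1) * r'\<^sup>2) ^ n - 1) \<le> sqrt n * (sqrt (2 * c) / (sqrt n * ln n))"
    using N x by (intro mult_mono) auto
  also have "\<dots> = sqrt (2 * c) / ln n" using n by simp
  finally show ?thesis .
qed

lemma planted:
  assumes "s \<in> {r, p}" "S \<in> nsets {..<n} k"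
  shows "planted n s r' S"
  using noisy[OF assms(1)] assms(2) by (auto simp: planted_def planted_axioms_def nsets_def)

lemma card_inside:
  assumes "S \<in> nsets {..<n} k"
  shows "real (card (nsets S 2)) \<le> sqrt n" "real (card (nsets S 3)) \<le> n" "card S = k" "card ({..<n} - S) = n - k"
proof -
  show S: "card S = k" using assms by (simp add: nsets_def)
  show "card ({..<n} - S) = n - k" using assms by (simp add: nsets_def card_Diff_subset)
  have "((real k)\<^sup>2)\<^sup>2 \<le> n" using k(2) by (simp flip: power_mult)
  then have "(real k)\<^sup>2 \<le> sqrt n" by (rule real_le_rsqrt)
  moreover have "real (card (nsets S 2)) \<le> (real k)\<^sup>2"
    using choose_le_power[of k 2] S by (simp flip: of_nat_power)
  ultimately show "real (card (nsets S 2)) \<le> sqrt n" by (rule order_trans[rotated])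
  have "k ^ 3 \<le> k ^ 4" by (cases "k = 0") (auto intro: power_increasing)
  then have "real k ^ 3 \<le> real k ^ 4" by (simp flip: of_nat_power)
  moreover have "real (card (nsets S 3)) \<le> real k ^ 3"
    using choose_le_power[of k 3] S by (simp flip: of_nat_power)
  ultimately show "real (card (nsets S 3)) \<le> n" using k(2) by linarith
qed

lemma triangles_inside:
  assumes "S \<in> nsets {..<n} k"
  shows "card (nsets S 3) * r' \<le> 1 / ln n"
proof -
  have "card (nsets S 3) * r' \<le> n * (1 / (n * ln n))"
    using card_inside(2)[OF assms] r' r'_less by (intro mult_mono) auto
  also have "\<dots> = 1 / ln n" using n by simp
  finally show ?thesis .
qed

lemma in_unit: "p \<in> {0..1}" "r \<in> {0..1}" "p' \<in> {0..1}" "r' \<in> {0..1}"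
  using p r r' r'_less by auto

text \<open>Truncation shifts each of at most \<open>n ^ 3\<close> coins by at most
  \<open>1 / 2 ^ n\<close>. The mixing error after \<open>n\<close> sweeps over at most
  \<open>n ^ 3\<close> triples has the same bound.\<close>

definition "tiny = real n ^ 3 / 2 ^ n"

lemma RGT_truncate: "d_TV (RGT n p p') (RGT n r r') \<le> 2 * tiny"
  "d_TV (RGT n p r') (RGT n p p') \<le> tiny" "d_TV (ER n r) (ER n p) \<le> tiny"
proof -
  have d: "\<bar>p - r\<bar> \<le> 1 / 2 ^ n" "\<bar>p' - r'\<bar> \<le> 1 / 2 ^ n" using r r' by auto
  have "real n ^ 2 * \<bar>p - r\<bar> \<le> real n ^ 3 * (1 / 2 ^ n)"
    using d n by (intro mult_mono power_increasing) auto
  then have 1: "real n ^ 2 * \<bar>p - r\<bar> \<le> tiny" by (simp add: tiny_def)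
  have "real n ^ 3 * \<bar>p' - r'\<bar> \<le> real n ^ 3 * (1 / 2 ^ n)" using d by (intro mult_left_mono) auto
  then have 2: "real n ^ 3 * \<bar>p' - r'\<bar> \<le> tiny" by (simp add: tiny_def)
  show "d_TV (RGT n p p') (RGT n r r') \<le> 2 * tiny"
    using d_TV_RGT[OF in_unit(1,2,3,4), of n] 1 2 by simp
  show "d_TV (RGT n p r') (RGT n p p') \<le> tiny"
    using d_TV_RGT[OF in_unit(1,1,4,3), of n] 2 by (simp add: abs_minus_commute)
  show "d_TV (ER n r) (ER n p) \<le> tiny"
    using d_TV_ER[OF in_unit(2,1), of n] 1 by (simp add: abs_minus_commute)
qed

lemma add_triangles_null: "d_TV (bind_pmf (ER n p) (add_triangles n r')) (RGT n p p') \<le> tiny"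
  using RGT_truncate(2) by (simp add: RGT_eq_add_triangles)

text \<open>The planted density is computed from \<open>r'\<close>, the probability with which the
  machine really adds triangles; only the ambient graph is then moved from \<open>r'\<close> to
  \<open>p'\<close>, at the cost \<open>tiny\<close>.\<close>

lemma add_triangles_planted:
  assumes q: "0 < q" "q < 1"
  shows "d_TV (bind_pmf (planted_ER n p k q) (add_triangles n r'))
      (planted_RGT n p p' k (1 - (1 - q) * (1 - r') ^ (n - k)))
    \<le> (1 + sqrt (2 * c) / q + sqrt (2 * c)) / ln n + tiny"
  unfolding planted_ER_def planted_RGT_def
proof (rule d_TV_plant[OF _ k(1)])
  fix S assume Sk: "S \<in> nsets {..<n} k"
  interpret planted n p r' S by (rule planted[OF _ Sk]) simp
  have dens: "dens q = 1 - (1 - q) * (1 - r') ^ (n - k)"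
    using card_inside(4)[OF Sk] by (simp add: dens_def Ap_def)
  have "d_TV (bind_pmf (bind_pmf (ER n p) (plant_at S q)) (add_triangles n r')) (bind_pmf (RGT n p r') (plant_at S (dens q)))
      \<le> card Int3 * r' + card In * (gap / q) + card In * gap"
    by (rule d_TV_add_triangles_plant[OF q])
  also have "\<dots> \<le> 1 / ln n + sqrt (2 * c) / ln n / q + sqrt (2 * c) / ln n"
  proof -
    have g: "card In * gap \<le> sqrt (2 * c) / ln n"
      using gap_le[OF _ card_inside(1)[OF Sk], of p] by (simp add: gap_def)
    then have "card In * gap / q \<le> sqrt (2 * c) / ln n / q" using q by (intro divide_right_mono) auto
    then show ?thesis using g triangles_inside[OF Sk] by simp
  qed
  also have "\<dots> = (1 + sqrt (2 * c) / q + sqrt (2 * c)) / ln n" by (simp add: add_divide_distrib)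
  finally show "d_TV (bind_pmf (bind_pmf (ER n p) (plant_at S q)) (add_triangles n r'))
      (bind_pmf (RGT n p p') (plant_at S (1 - (1 - q) * (1 - r') ^ (n - k))))
    \<le> (1 + sqrt (2 * c) / q + sqrt (2 * c)) / ln n + tiny"
    using RGT_truncate(2) d_TV_bind_left[of "RGT n p r'" "plant_at S (dens q)" "RGT n p p'"]
      d_TV_triangle[of "bind_pmf (bind_pmf (ER n p) (plant_at S q)) (add_triangles n r')"
        "bind_pmf (RGT n p p') (plant_at S (dens q))" "bind_pmf (RGT n p r') (plant_at S (dens q))"]
    unfolding dens by linarith
qed

lemma inverse_sampler:
  assumes ts: "set ts = nsets {..<n} 3" and G: "G \<subseteq> nsets {..<n} 2"
  shows "d_TV (inverse_sampler n r r' ts G) (noisy_graph.exact_inverse n r r' G) \<le> tiny"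
proof -
  interpret noisy_graph n r r' by (rule noisy) simp
  have n0: "0 < real n * ln n" using n ln_n by simp
  have p3: "(p / 2) ^ 3 \<le> r ^ 3" using p r by (intro power_mono) auto
  have "r' / r ^ 3 \<le> 1 / (n * ln n) / (p / 2) ^ 3"
    using r' r'_less n0 p p3 r by (intro frac_le) auto
  also have "\<dots> = 8 / p ^ 3 / (n * ln n)" by (simp add: power_divide)
  finally have a: "r' / r ^ 3 \<le> 8 / p ^ 3 / (n * ln n)" .
  have "r ^ 3 \<le> 1" using r p by (intro power_le_one) auto
  then have b: "(1 - r ^ 3) ^ n \<le> (1 - p ^ 3 / 8) ^ n"
    using p3 by (intro power_mono) (auto simp: power_divide)
  have "(r' / r ^ 3 + (1 - r ^ 3) ^ n) * real (3 * n) \<le> (8 / p ^ 3 / (n * ln n) + (1 - p ^ 3 / 8) ^ n) * real (3 * n)"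
    by (intro mult_right_mono add_mono a b) simp
  then have "(r' / r ^ 3 + (1 - r ^ 3) ^ n) * real (3 * n) \<le> 1 / 2" using \<alpha> by linarith
  from d_TV_glauber[OF G ts this, of "[0..<n]"]
  have "d_TV (iter_pmf (\<lambda>_. iter_pmf (refresh r r' n G) ts) [0..<n] {}) (triangle_law (nsets {..<n} 3) G)
      \<le> (1 / 2) ^ n * card (nsets {..<n} 3)" by simp
  also have "\<dots> \<le> (1 / 2) ^ n * n ^ 3"
    using choose_le_power[of n 3] by (intro mult_left_mono) (simp_all flip: of_nat_power)
  also have "\<dots> = tiny" by (simp add: tiny_def power_divide)
  finally show ?thesis
    unfolding inverse_sampler_def exact_inverse_def using d_TV_bind_left order_trans by blast
qed

lemma inverse_null:
  assumes ts: "set ts = nsets {..<n} 3"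
  shows "d_TV (bind_pmf (RGT n p p') (inverse_sampler n r r' ts)) (ER n p) \<le> 4 * tiny"
proof -
  interpret noisy_graph n r r' by (rule noisy) simp
  let ?A = "inverse_sampler n r r' ts"
  have "d_TV (bind_pmf (RGT n p p') ?A) (bind_pmf (RGT n r r') ?A) \<le> 2 * tiny"
    by (rule order_trans[OF d_TV_bind_left RGT_truncate(1)])
  moreover have "d_TV (bind_pmf (RGT n r r') ?A) (ER n r) \<le> tiny"
    unfolding bind_RGT_exact_inverse[symmetric]
    by (intro d_TV_bind_right inverse_sampler[OF ts] RGT_subset)
  ultimately show ?thesis
    using RGT_truncate(3) d_TV_triangle[of "bind_pmf (RGT n p p') ?A" "ER n r" "bind_pmf (RGT n r r') ?A"]
      d_TV_triangle[of "bind_pmf (RGT n p p') ?A" "ER n p" "ER n r"] by linarith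
qed

text \<open>A chain of five comparisons: true parameters to truncated ones, sampler to exact
  posterior, exact posterior to the one without triangles inside \<open>S\<close>, its action on the
  planted graph, and ambient density \<open>r\<close> back to \<open>p\<close>. The Bayes inverse is
  taken for \<open>r\<close> and \<open>r'\<close> because these define the posterior for which the
  sampler is stationary.\<close>

lemma inverse_planted:
  assumes ts: "set ts = nsets {..<n} 3" and q: "0 < q" "q < 1"
  shows "d_TV (bind_pmf (planted_RGT n p p' k q) (inverse_sampler n r r' ts))
      (planted_ER n p k (q * (r / (1 - (1 - r) * (1 - r') ^ (n - k)))))
    \<le> (16 / p ^ 3 + sqrt (2 * c) + sqrt (2 * c) / (p / 2)) / ln n + 4 * tiny"
  unfolding planted_ER_def planted_RGT_def
proof (rule d_TV_plant[OF _ k(1)])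
  fix S assume Sk: "S \<in> nsets {..<n} k"
  interpret planted n r r' S by (rule planted[OF _ Sk]) simp
  let ?A = "inverse_sampler n r r' ts"
  let ?P = "plant_at S q" and ?P' = "plant_at S (q * (r / dens r))"
  have dens: "dens r = 1 - (1 - r) * (1 - r') ^ (n - k)"
    using card_inside(4)[OF Sk] by (simp add: dens_def Ap_def)
  have "d_TV (bind_pmf (bind_pmf (RGT n p p') ?P) ?A) (bind_pmf (bind_pmf (RGT n r r') ?P) ?A) \<le> 2 * tiny"
    by (rule order_trans[OF d_TV_bind_left order_trans[OF d_TV_bind_left RGT_truncate(1)]])
  moreover have sub: "G \<subseteq> nsets {..<n} 2" if G: "G \<in> set_pmf (bind_pmf (RGT n r r') ?P)" for G
  proof -
    obtain G0 H where *: "G0 \<in> set_pmf (RGT n r r')" "H \<in> set_pmf (random_subset In q)" "G = (G0 - In) \<union> H"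
      using G by (auto simp: plant_at_def)
    have "In \<subseteq> nsets {..<n} 2" using Sk by (auto simp: nsets_def)
    then show ?thesis using RGT_subset[OF *(1)] random_subset_subsetD[OF *(2)] *(3) by blast
  qed
  moreover have "d_TV (bind_pmf (bind_pmf (RGT n r r') ?P) ?A) (bind_pmf (bind_pmf (RGT n r r') ?P) exact_inverse) \<le> tiny"
    by (intro d_TV_bind_right inverse_sampler[OF ts] sub)
  moreover have "d_TV (bind_pmf (bind_pmf (RGT n r r') ?P) exact_inverse) (bind_pmf (bind_pmf (RGT n r r') ?P) inverse_kernel)
      \<le> card Int3 * (r' / (1 - r') / r ^ 3)"
    by (intro d_TV_bind_right d_TV_exact_inverse_kernel sub)
  moreover have "card Int3 * (r' / (1 - r') / r ^ 3) \<le> 16 / p ^ 3 / ln n"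
  proof -
    have "(p / 2) ^ 3 \<le> r ^ 3" using p r by (intro power_mono) auto
    then have "1 / (1 - r') / r ^ 3 \<le> 2 / (p / 2) ^ 3"
      using r'_less p r by (intro frac_le) (auto simp: divide_le_eq)
    moreover have "0 \<le> card Int3 * r'" using r' by simp
    ultimately have "card Int3 * r' * (1 / (1 - r') / r ^ 3) \<le> 1 / ln n * (2 / (p / 2) ^ 3)"
      using triangles_inside[OF Sk] r'_less(2) p r ln_n by (intro mult_mono) auto
    then show ?thesis by (simp add: power_divide field_simps)
  qed
  moreover have "d_TV (bind_pmf (bind_pmf (RGT n r r') ?P) inverse_kernel) (bind_pmf (ER n r) ?P')
      \<le> card In * gap + card In * (gap / r)"
    by (rule d_TV_inverse_kernel_plant[OF q])
  moreover have g: "card In * gap \<le> sqrt (2 * c) / ln n"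
    using gap_le[OF _ card_inside(1)[OF Sk], of r] by (simp add: gap_def)
  moreover have "card In * (gap / r) \<le> sqrt (2 * c) / ln n / (p / 2)"
  proof -
    have "card In * gap / r \<le> sqrt (2 * c) / ln n / (p / 2)"
    proof (rule frac_le)
      show "0 \<le> sqrt (2 * c) / ln n" using ln_n by (simp add: c)
    qed (use g p r in auto)
    then show ?thesis by simp
  qed
  moreover have "d_TV (bind_pmf (ER n r) ?P') (bind_pmf (ER n p) ?P') \<le> tiny"
    by (rule order_trans[OF d_TV_bind_left RGT_truncate(3)])
  moreover have "(16 / p ^ 3 + sqrt (2 * c) + sqrt (2 * c) / (p / 2)) / ln n
      = 16 / p ^ 3 / ln n + sqrt (2 * c) / ln n + sqrt (2 * c) / ln n / (p / 2)"
    by (simp add: add_divide_distrib)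
  moreover note d_TV_triangle[of "bind_pmf (bind_pmf (RGT n p p') ?P) ?A" "bind_pmf (ER n p) ?P'" "bind_pmf (bind_pmf (RGT n r r') ?P) ?A"]
    d_TV_triangle[of "bind_pmf (bind_pmf (RGT n r r') ?P) ?A" "bind_pmf (ER n p) ?P'" "bind_pmf (bind_pmf (RGT n r r') ?P) exact_inverse"]
    d_TV_triangle[of "bind_pmf (bind_pmf (RGT n r r') ?P) exact_inverse" "bind_pmf (ER n p) ?P'" "bind_pmf (bind_pmf (RGT n r r') ?P) inverse_kernel"]
    d_TV_triangle[of "bind_pmf (bind_pmf (RGT n r r') ?P) inverse_kernel" "bind_pmf (ER n p) ?P'" "bind_pmf (ER n r) ?P'"]
  ultimately show "d_TV (bind_pmf (bind_pmf (RGT n p p') ?P) ?A)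
      (bind_pmf (ER n p) (plant_at S (q * (r / (1 - (1 - r) * (1 - r') ^ (n - k))))))
    \<le> (16 / p ^ 3 + sqrt (2 * c) + sqrt (2 * c) / (p / 2)) / ln n + 4 * tiny"
    unfolding dens[symmetric] by linarith
qed

end

subsection \<open>The limit\<close>

lemma regime_eventually:
  fixes p :: real and k :: "nat \<Rightarrow> nat" and p' :: "nat \<Rightarrow> real"
  assumes p: "0 < p" "p < 1" and k: "\<forall>n. k n \<le> n"
    and small: "(\<lambda>n. real (k n)) \<in> o(\<lambda>n. real n powr (1/4) * ln (real n) powr (-17/4))"
    and p': "\<forall>n. 0 \<le> p' n \<and> p' n \<le> 1" "\<forall>n\<ge>2. p' n \<le> 1 / (real n * ln (real n))"
  shows "eventually (\<lambda>n. regime n (k n) p (p' n) (truncate n p) (truncate n (p' n)) (4 / p\<^sup>2)) at_top"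
proof -
  have "eventually (\<lambda>n. real (k n) ^ 4 \<le> n) at_top"
    using landau_o.smallD[OF small zero_less_one] eventually_ge_at_top[of 3]
  proof eventually_elim
    case (elim n)
    have "exp (1 :: real) \<le> 3" by (rule exp_le)
    then have ln: "1 \<le> ln (real n)" using elim(2) by (subst ln_ge_iff) auto
    have "ln (real n) powr (-17/4) \<le> ln (real n) powr 0" using ln by (intro powr_mono) auto
    then have "ln (real n) powr (-17/4) \<le> 1" using ln by simp
    then have "real n powr (1/4) * ln (real n) powr (-17/4) \<le> real n powr (1/4)" by (intro mult_left_le) auto
    then have "real (k n) \<le> real n powr (1/4)" using elim(1) by simp
    then have "real (k n) ^ 4 \<le> (real n powr (1/4)) ^ 4" by (intro power_mono) auto
    also have "\<dots> = n" using elim(2) by (simp add: powr_power)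
    finally show ?case .
  qed
  moreover have "eventually (\<lambda>n. 1 / 2 ^ n \<le> p / 2) at_top" using p by real_asymp
  moreover have "eventually (\<lambda>n. 4 / p\<^sup>2 \<le> real n * (ln (real n))\<^sup>2) at_top" by real_asymp
  moreover have "eventually (\<lambda>n. (8 / p ^ 3 / (real n * ln (real n)) + (1 - p ^ 3 / 8) ^ n) * real (3 * n) \<le> 1 / 2) at_top"
  proof -
    have "p ^ 3 \<le> 1" "0 < p ^ 3" using p by (auto simp: power_le_one)
    then obtain b where b: "b = 1 - p ^ 3 / 8" "0 < b" "b < 1" by auto
    define a where "a = 8 / p ^ 3"
    have "((\<lambda>n. (a / (real n * ln (real n)) + b ^ n) * real (3 * n)) \<longlongrightarrow> 0) at_top" using b(2,3) by real_asymp
    then have "eventually (\<lambda>n. (a / (real n * ln (real n)) + b ^ n) * real (3 * n) < 1 / 2) at_top"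
      by (rule order_tendstoD) simp
    then show ?thesis unfolding a_def b(1) by (rule eventually_mono) simp
  qed
  ultimately show ?thesis using eventually_ge_at_top[of 3]
  proof eventually_elim
    case (elim n)
    have tp: "truncate n p \<le> p" "p - 1 / 2 ^ n \<le> truncate n p" using truncate_bounds[of p n] p by auto
    have tp': "0 \<le> truncate n (p' n)" "truncate n (p' n) \<le> p' n" "p' n - 1 / 2 ^ n \<le> truncate n (p' n)"
      using truncate_bounds[of "p' n" n] p' by auto
    have "p / 2 \<le> truncate n p" "p - truncate n p \<le> 1 / 2 ^ n" "p' n - truncate n (p' n) \<le> 1 / 2 ^ n"
      using tp tp' elim(2) by linarith+
    moreover have "p' n \<le> 1 / (real n * ln (real n))" using p'(2) elim(5) by simp
    ultimately show ?case
      using elim tp(1) tp'(1,2) k p by unfold_locales auto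
  qed
qed

lemma squeeze_null:
  fixes d :: "nat \<Rightarrow> real"
  assumes "eventually (\<lambda>n. d n \<le> C / ln (real n) + 4 * (real n ^ 3 / 2 ^ n)) at_top" "\<And>n. 0 \<le> d n"
  shows "d \<longlonglongrightarrow> 0"
proof (rule tendsto_sandwich[where f = "\<lambda>_. 0"])
  show "(\<lambda>n. C / ln (real n) + 4 * (real n ^ 3 / 2 ^ n)) \<longlonglongrightarrow> 0" by real_asymp
qed (use assms in auto)

text \<open>By Bernoulli's inequality the power is at least \<open>1 - n * r'\<close>, hence at
  least 1 - 1 / ln n. An inner edge thus rarely lies in an added triangle, which makes both
  parameter maps asymptotically the identity.\<close>

lemma survival_tendsto:
  assumes "\<And>n. 0 \<le> (r' :: nat \<Rightarrow> real) n" "eventually (\<lambda>n. r' n \<le> 1 / (real n * ln (real n))) at_top"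
  shows "(\<lambda>n. (1 - r' n) ^ (n - k n)) \<longlonglongrightarrow> 1"
proof (rule tendsto_sandwich)
  show "(\<lambda>n. 1 - 1 / ln (real n)) \<longlonglongrightarrow> 1" by real_asymp
  have ev: "eventually (\<lambda>n. r' n \<le> 1 / (real n * ln (real n)) \<and> r' n \<le> 1 \<and> 3 \<le> n) at_top"
  proof -
    have "eventually (\<lambda>n. 1 / (real n * ln (real n)) \<le> 1) at_top" by real_asymp
    then show ?thesis using assms(2) eventually_ge_at_top[of 3]
      by eventually_elim (intro conjI; linarith)
  qed
  then show "eventually (\<lambda>n. 1 - 1 / ln (real n) \<le> (1 - r' n) ^ (n - k n)) at_top"
  proof eventually_elim
    case (elim n)
    have "real (n - k n) * r' n \<le> n * (1 / (real n * ln (real n)))"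
      using elim assms(1)[of n] by (intro mult_mono) auto
    also have "\<dots> = 1 / ln (real n)" using elim by simp
    finally have "1 - 1 / ln (real n) \<le> 1 + real (n - k n) * (- r' n)" by simp
    also have "\<dots> \<le> (1 + (- r' n)) ^ (n - k n)" by (rule Bernoulli_inequality) (use elim in simp)
    finally show ?case by simp
  qed
  show "eventually (\<lambda>n. (1 - r' n) ^ (n - k n) \<le> 1) at_top"
    using ev by eventually_elim (use assms(1) in \<open>auto intro: power_le_one\<close>)
qed simp


lemma one_minus_mult_bounds:
  fixes q s :: real
  assumes "0 < q" "q < 1" "0 < s" "s \<le> 1"
  shows "q \<le> 1 - (1 - q) * s" "1 - (1 - q) * s < 1"
proof -
  have "(1 - q) * s \<le> 1 - q" "0 < (1 - q) * s" using assms by (auto intro: mult_left_le)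
  then show "q \<le> 1 - (1 - q) * s" "1 - (1 - q) * s < 1" by linarith+
qed

theorem theorem1p1:
  fixes p :: real and k :: "nat \<Rightarrow> nat" and p' :: "nat \<Rightarrow> real"
  assumes "0 < p" and "p < 1"
    and "\<forall>n. k n \<le> n"
    and "(\<lambda>n. real (k n)) \<in> o(\<lambda>n. real n powr (1/4) * ln (real n) powr (-17/4))"
    and "\<forall>n. 0 \<le> p' n \<and> p' n \<le> 1"
    and "\<forall>n\<ge>2. p' n \<le> 1 / (real n * ln (real n))"
  shows "\<exists>f g :: nat \<Rightarrow> real \<Rightarrow> real.
    (\<forall>n. f n ` {0<..<1} \<subseteq> {0<..<1} \<and> g n ` {0<..<1} \<subseteq> {0<..<1}) \<and>
    (\<forall>q. 0 < q \<and> q < 1 \<longrightarrow>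
      (\<exists>A_tri A.
        efficient k (\<lambda>n. [p, q, p' n]) A_tri \<and>
        efficient k (\<lambda>n. [p, q, p' n]) A \<and>
        (\<lambda>n. d_TV (bind_pmf (ER n p) (A_tri n)) (RGT n p (p' n))) \<longlonglongrightarrow> 0 \<and>
        (\<lambda>n. d_TV (bind_pmf (planted_ER n p (k n) q) (A_tri n))
                   (planted_RGT n p (p' n) (k n) (f n q))) \<longlonglongrightarrow> 0 \<and>
        (\<lambda>n. d_TV (bind_pmf (RGT n p (p' n)) (A n)) (ER n p)) \<longlonglongrightarrow> 0 \<and>
        (\<lambda>n. d_TV (bind_pmf (planted_RGT n p (p' n) (k n) q) (A n))
                   (planted_ER n p (k n) (g n q))) \<longlonglongrightarrow> 0) \<and>
      (\<lambda>n. (f n \<circ> g n) q) \<longlonglongrightarrow> q \<and>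
      (\<lambda>n. (g n \<circ> f n) q) \<longlonglongrightarrow> q)"
proof -
  define P where "P n = truncate n p" for n
  define R where "R n = truncate n (p' n)" for n
  define s where "s n = (1 - R n) ^ (n - k n)" for n
  \<comment> \<open>For finitely many \<open>n\<close> the truncations can degenerate, with
    \<open>P n = 0\<close> or \<open>R n = 1\<close>. There \<open>f\<close> and \<open>g\<close>
    are set to the identity, so that they preserve the open unit interval for every
    \<open>n\<close>.\<close>
  define good where "good n \<longleftrightarrow> 0 < P n \<and> R n < 1" for n
  define f where "f n q = (if good n then 1 - (1 - q) * s n else q)" for n q
  define g where "g n q = (if good n then q * (P n / (1 - (1 - P n) * s n)) else q)" for n q
  have P: "P n \<le> p" "p - 1 / 2 ^ n \<le> P n" for n
    using truncate_bounds[of p n] assms(1) by (auto simp: P_def)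
  have R: "0 \<le> R n" for n using truncate_bounds[of "p' n" n] assms(5) by (auto simp: R_def)
  have reg: "eventually (\<lambda>n. regime n (k n) p (p' n) (P n) (R n) (4 / p\<^sup>2)) at_top"
    unfolding P_def R_def by (rule regime_eventually) (use assms in auto)
  have good: "eventually (\<lambda>n. good n \<and> R n \<le> 1 / (real n * ln (real n))) at_top"
    using reg
  proof eventually_elim
    case (elim n)
    interpret regime n "k n" p "p' n" "P n" "R n" "4 / p\<^sup>2" by (rule elim)
    show ?case using p r r'_less by (auto simp: good_def)
  qed
  have s: "0 < s n \<and> s n \<le> 1" if "good n" for n
    using that R[of n] by (auto simp: s_def good_def intro: power_le_one)
  have "P \<longlonglongrightarrow> p"
  proof (rule tendsto_sandwich)
    show "(\<lambda>n. p - 1 / 2 ^ n) \<longlonglongrightarrow> p" by real_asymp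
  qed (use P in auto)
  moreover have "s \<longlonglongrightarrow> 1"
    unfolding s_def by (rule survival_tendsto[OF R]) (use good in \<open>auto elim: eventually_mono\<close>)
  \<comment> \<open>With \<open>s\<close> tending to 1 and \<open>P\<close> to \<open>p\<close>, the
    retention probability \<open>P n / (1 - (1 - P n) * s n)\<close> tends to 1;
    \<open>p > 0\<close> keeps the limit of the denominator away from 0.\<close>
  ultimately have lim: "(\<lambda>n. 1 - (1 - q * (P n / (1 - (1 - P n) * s n))) * s n) \<longlonglongrightarrow> q"
    "(\<lambda>n. (1 - (1 - q) * s n) * (P n / (1 - (1 - P n) * s n))) \<longlonglongrightarrow> q" for q
    using assms(1) by (auto intro!: tendsto_eq_intros)
  have range: "f n ` {0<..<1} \<subseteq> {0<..<1} \<and> g n ` {0<..<1} \<subseteq> {0<..<1}" for n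
  proof (cases "good n")
    case True
    have "0 < P n" "P n < 1" using True P[of n] assms(2) by (auto simp: good_def)
    then have h: "P n \<le> 1 - (1 - P n) * s n" using one_minus_mult_bounds s[OF True] by blast
    have "0 < f n q \<and> f n q < 1" if "0 < q" "q < 1" for q
      using one_minus_mult_bounds[OF that, of "s n"] s[OF True] True that by (auto simp: f_def)
    moreover have "0 < g n q \<and> g n q < 1" if "0 < q" "q < 1" for q
    proof -
      define \<rho> where "\<rho> = P n / (1 - (1 - P n) * s n)"
      have "0 < \<rho>" "\<rho> \<le> 1" using h \<open>0 < P n\<close> by (auto simp: \<rho>_def)
      then have "0 < q * \<rho>" "q * \<rho> \<le> q" using that by (auto intro: mult_left_le)
      moreover have "g n q = q * \<rho>" using True by (simp add: g_def \<rho>_def)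
      ultimately show ?thesis using that by linarith
    qed
    ultimately show ?thesis by auto
  qed (auto simp: f_def g_def)
  have comp: "(\<lambda>n. (f n \<circ> g n) q) \<longlonglongrightarrow> q" "(\<lambda>n. (g n \<circ> f n) q) \<longlonglongrightarrow> q" for q
  proof -
    show "(\<lambda>n. (f n \<circ> g n) q) \<longlonglongrightarrow> q"
      by (rule Lim_transform_eventually[OF lim(1)]) (use good in \<open>auto simp: f_def g_def elim: eventually_mono\<close>)
    show "(\<lambda>n. (g n \<circ> f n) q) \<longlonglongrightarrow> q"
      by (rule Lim_transform_eventually[OF lim(2)]) (use good in \<open>auto simp: f_def g_def elim: eventually_mono\<close>)
  qed
  have main: "\<exists>A_tri A.
        efficient k (\<lambda>n. [p, q, p' n]) A_tri \<and>
        efficient k (\<lambda>n. [p, q, p' n]) A \<and>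
        (\<lambda>n. d_TV (bind_pmf (ER n p) (A_tri n)) (RGT n p (p' n))) \<longlonglongrightarrow> 0 \<and>
        (\<lambda>n. d_TV (bind_pmf (planted_ER n p (k n) q) (A_tri n))
                   (planted_RGT n p (p' n) (k n) (f n q))) \<longlonglongrightarrow> 0 \<and>
        (\<lambda>n. d_TV (bind_pmf (RGT n p (p' n)) (A n)) (ER n p)) \<longlonglongrightarrow> 0 \<and>
        (\<lambda>n. d_TV (bind_pmf (planted_RGT n p (p' n) (k n) q) (A n))
                   (planted_ER n p (k n) (g n q))) \<longlonglongrightarrow> 0"
    if q: "0 < q" "q < 1" for q
  proof -
    obtain ts where ts: "\<And>n. set (ts n) = nsets {..<n} 3"
      "efficient k (\<lambda>n. [p, q, p' n]) (\<lambda>n. inverse_sampler n (P n) (R n) (ts n))"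
      unfolding P_def R_def by (rule efficient_inverse_sampler[of p p' k q]) (use assms in auto)
    define c where "c = 4 / p\<^sup>2"
    have tiny: "0 \<le> real n ^ 3 / 2 ^ n" for n by simp
    have "(\<lambda>n. d_TV (bind_pmf (ER n p) (add_triangles n (R n))) (RGT n p (p' n))) \<longlonglongrightarrow> 0"
    proof (rule squeeze_null[where C = 0])
      show "eventually (\<lambda>n. d_TV (bind_pmf (ER n p) (add_triangles n (R n))) (RGT n p (p' n))
          \<le> 0 / ln (real n) + 4 * (real n ^ 3 / 2 ^ n)) at_top"
        using reg
      proof eventually_elim
        case (elim n)
        show ?case using regime.add_triangles_null[OF elim] tiny[of n]
          unfolding regime.tiny_def[OF elim] by linarith
      qed
    qed (rule d_TV_nonneg)
    moreover have "(\<lambda>n. d_TV (bind_pmf (planted_ER n p (k n) q) (add_triangles n (R n)))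
        (planted_RGT n p (p' n) (k n) (f n q))) \<longlonglongrightarrow> 0"
    proof (rule squeeze_null[where C = "1 + sqrt (2 * c) / q + sqrt (2 * c)"])
      show "eventually (\<lambda>n. d_TV (bind_pmf (planted_ER n p (k n) q) (add_triangles n (R n)))
          (planted_RGT n p (p' n) (k n) (f n q))
          \<le> (1 + sqrt (2 * c) / q + sqrt (2 * c)) / ln (real n) + 4 * (real n ^ 3 / 2 ^ n)) at_top"
        using reg good
      proof eventually_elim
        case (elim n)
        have "f n q = 1 - (1 - q) * (1 - R n) ^ (n - k n)" using elim(2) by (simp add: f_def s_def)
        with regime.add_triangles_planted[OF elim(1) q] tiny[of n] show ?case
          unfolding regime.tiny_def[OF elim(1)] c_def by (simp only:)
      qed
    qed (rule d_TV_nonneg)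
    moreover have "(\<lambda>n. d_TV (bind_pmf (RGT n p (p' n)) (inverse_sampler n (P n) (R n) (ts n))) (ER n p)) \<longlonglongrightarrow> 0"
    proof (rule squeeze_null[where C = 0])
      show "eventually (\<lambda>n. d_TV (bind_pmf (RGT n p (p' n)) (inverse_sampler n (P n) (R n) (ts n))) (ER n p)
          \<le> 0 / ln (real n) + 4 * (real n ^ 3 / 2 ^ n)) at_top"
        using reg
      proof eventually_elim
        case (elim n)
        show ?case using regime.inverse_null[OF elim ts(1)] unfolding regime.tiny_def[OF elim] by simp
      qed
    qed (rule d_TV_nonneg)
    moreover have "(\<lambda>n. d_TV (bind_pmf (planted_RGT n p (p' n) (k n) q) (inverse_sampler n (P n) (R n) (ts n)))
        (planted_ER n p (k n) (g n q))) \<longlonglongrightarrow> 0"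
    proof (rule squeeze_null[where C = "16 / p ^ 3 + sqrt (2 * c) + sqrt (2 * c) / (p / 2)"])
      show "eventually (\<lambda>n. d_TV (bind_pmf (planted_RGT n p (p' n) (k n) q) (inverse_sampler n (P n) (R n) (ts n)))
          (planted_ER n p (k n) (g n q))
          \<le> (16 / p ^ 3 + sqrt (2 * c) + sqrt (2 * c) / (p / 2)) / ln (real n) + 4 * (real n ^ 3 / 2 ^ n)) at_top"
        using reg good
      proof eventually_elim
        case (elim n)
        have "g n q = q * (P n / (1 - (1 - P n) * (1 - R n) ^ (n - k n)))" using elim(2) by (simp add: g_def s_def)
        then show ?case using regime.inverse_planted[OF elim(1) ts(1) q]
          unfolding regime.tiny_def[OF elim(1)] c_def by simp
      qed
    qed (rule d_TV_nonneg)
    moreover have "efficient k (\<lambda>n. [p, q, p' n]) (\<lambda>n. add_triangles n (R n))"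
      unfolding R_def by (rule efficient_add_triangles) (use assms in auto)
    ultimately show ?thesis
      by (intro exI[of _ "\<lambda>n. add_triangles n (R n)"] exI[of _ "\<lambda>n. inverse_sampler n (P n) (R n) (ts n)"]
          conjI ts(2))
  qed
  show ?thesis
  proof (rule exI[of _ f], rule exI[of _ g], rule conjI)
    show "\<forall>n. f n ` {0<..<1} \<subseteq> {0<..<1} \<and> g n ` {0<..<1} \<subseteq> {0<..<1}" using range by simp
  qed (intro allI impI conjI main comp; simp)
qed

end
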